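(* Let $b\in[0,1/2)$ and define the rescaled realized spatial quadratic variation $$V_{\mathrm{sp}}:=\frac{1}{NM\delta}\sum_{i=0}^{N-1}\sum_{k=0}^{M-1}\mathrm{e}^{\kappa y_k}\big(X_{t_i}(y_{k+1})-X_{t_i}(y_k)\big)^2 .$$ If $N/M\to 0$, then $$\sqrt{MN}\left(V_{\mathrm{sp}}-\frac{\sigma^2}{2\vartheta_2}\right)\overset{\mathcal D}{\longrightarrow}\mathcal N\left(0,\frac{\sigma^4}{2\vartheta_2^2}\right),\qquad M,N\to\infty .$$
   Context: Let $\sigma^2>0$, $\vartheta_2>0$, $\vartheta_1,\vartheta_0\in\mathbb R$, and put $\kappa=\vartheta_1/\vartheta_2$, $\Gamma=\frac{\vartheta_1^2}{4\vartheta_2^2}-\frac{\vartheta_0}{\vartheta_2}$; it is assumed that $\Gamma+\pi^2>0$. For $\ell\ge1$, $y\in[0,1]$ let $e_\ell(y)=\sqrt2\sin(\pi\ell y)\mathrm{e}^{-\kappa y/2}$ and $\lambda_\ell=\vartheta_2(\pi^2\ell^2+\Gamma)$. $X$ is the stationary solution of the SPDE $dX_t(x)=(\vartheta_2\partial_x^2X_t(x)+\vartheta_1\partial_xX_t(x)+\vartheta_0X_t(x))\,dt+\sigma\,dW_t(x)$ on $[0,1]$ with Dirichlet boundary conditions and $W$ a cylindrical Brownian motion, i.e. $X_t(x)=\sum_{\ell\ge1}u_\ell(t)e_\ell(x)$, $t\ge0$, $x\in[0,1]$, where $(u_\ell)_{\ell\ge1}$ are independent processes with $du_\ell(t)=-\lambda_\ell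 u_\ell(t)\,dt+\sigma\,d\beta_\ell(t)$, $u_\ell(0)\sim\mathcal N(0,\sigma^2/(2\lambda_\ell))$, and the $\beta_\ell$ are standard Brownian motions such that $\{\beta_\ell,u_\ell(0):\ell\ge1\}$ is an independent family. Equivalently, $X$ is the (continuous version of the) centered Gaussian field with $\mathrm{Cov}(X_s(x),X_t(y))=\sigma^2\sum_{\ell\ge1}\frac{\mathrm{e}^{-\lambda_\ell|t-s|}}{2\lambda_\ell}e_\ell(x)e_\ell(y)$. Observation grid: for a fixed time horizon $T>0$ and fixed $b$, $t_i=i\Delta$ with $\Delta=T/N$, $i=0,\dots,N$, and $y_k=b+k\delta$ with $\delta=(1-2b)/M$, $k=0,\dots,M$. The limit $M,N\to\infty$ means $\min(M,N)\to\infty$. *)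

theory Defs
  imports "HOL-Probability.Probability"
begin

definition brownian_motion :: "'a measure \<Rightarrow> (real \<Rightarrow> 'a \<Rightarrow> real) \<Rightarrow> bool" where
  "brownian_motion P B \<longleftrightarrow>
     prob_space P \<and>
     (\<forall>t\<ge>0. B t \<in> borel_measurable P) \<and>
     (AE \<omega> in P. B 0 \<omega> = 0) \<and>
     (AE \<omega> in P. continuous_on {0..} (\<lambda>t. B t \<omega>)) \<and>
     (\<forall>s t. 0 \<le> s \<and> s < t \<longrightarrow>
        distributed P lborel (\<lambda>\<omega>. B t \<omega> - B s \<omega>) (normal_density 0 (sqrt (t - s)))) \<and>
     (\<forall>(n::nat) (\<tau>::nat \<Rightarrow> real). 0 \<le> \<tau> 0 \<and> (\<forall>i<n. \<tau> i < \<tau> (Suc i)) \<longrightarrow>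
        prob_space.indep_vars P (\<lambda>_. borel) (\<lambda>i \<omega>. B (\<tau> (Suc i)) \<omega> - B (\<tau> i) \<omega>) {..<n})"

text \<open>
  Since the noise is additive, a solution of \<open>du(t) = - a u(t) dt + \<sigma> dB(t)\<close> is a process with
  continuous paths satisfying the integrated equation pathwise; no stochastic integral is needed,
  because the integral of the constant \<open>\<sigma>\<close> against \<open>B\<close> over \<open>[0, t]\<close> is \<open>\<sigma> B(t)\<close> (as \<open>B(0) = 0\<close>).
\<close>

definition solves_ou_sde ::
  "'a measure \<Rightarrow> real \<Rightarrow> real \<Rightarrow> (real \<Rightarrow> 'a \<Rightarrow> real) \<Rightarrow> (real \<Rightarrow> 'a \<Rightarrow> real) \<Rightarrow> bool" where
  "solves_ou_sde P a \<sigma> B u \<longleftrightarrow>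
     (\<forall>t\<ge>0. u t \<in> borel_measurable P) \<and>
     (AE \<omega> in P. continuous_on {0..} (\<lambda>t. u t \<omega>) \<and>
        (\<forall>t\<ge>0. u t \<omega> = u 0 \<omega> - a * integral {0..t} (\<lambda>s. u s \<omega>) + \<sigma> * B t \<omega>))"

text \<open>
  Independence of a family consisting of processes \<open>\<beta>\<^sub>\<ell>\<close> and random variables \<open>\<xi>\<^sub>\<ell>\<close> with
  \<open>\<ell> \<ge> 1\<close>: the \<open>\<sigma>\<close>-algebra of a process is the one generated by its whole path, seen
  as a random element of the product space \<open>\<real>\<^bsup>[0,\<infinity>)\<^esup>\<close>.
\<close>

definition indep_drivers ::
  "'a measure \<Rightarrow> (nat \<Rightarrow> real \<Rightarrow> 'a \<Rightarrow> real) \<Rightarrow> (nat \<Rightarrow> 'a \<Rightarrow> real) \<Rightarrow> bool" where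
  "indep_drivers P \<beta> \<xi> \<longleftrightarrow>
     prob_space.indep_sets P
       (case_sum
          (\<lambda>l. sets (vimage_algebra (space P) (\<lambda>\<omega>. \<lambda>t\<in>{0..}. \<beta> l t \<omega>)
                      (\<Pi>\<^sub>M t\<in>{0::real..}. (borel :: real measure))))
          (\<lambda>l. sets (vimage_algebra (space P) (\<xi> l) borel)))
       ({1..} <+> {1..})"

definition spde_kappa :: "real \<Rightarrow> real \<Rightarrow> real" where
  "spde_kappa \<theta>1 \<theta>2 = \<theta>1 / \<theta>2"

definition spde_Gamma :: "real \<Rightarrow> real \<Rightarrow> real \<Rightarrow> real" where
  "spde_Gamma \<theta>0 \<theta>1 \<theta>2 = \<theta>1\<^sup>2 / (4 * \<theta>2\<^sup>2) - \<theta>0 / \<theta>2"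

definition spde_eigenfun :: "real \<Rightarrow> real \<Rightarrow> nat \<Rightarrow> real \<Rightarrow> real" where
  "spde_eigenfun \<theta>1 \<theta>2 l y = sqrt 2 * sin (pi * real l * y) * exp (- spde_kappa \<theta>1 \<theta>2 * y / 2)"

definition spde_eigenval :: "real \<Rightarrow> real \<Rightarrow> real \<Rightarrow> nat \<Rightarrow> real" where
  "spde_eigenval \<theta>0 \<theta>1 \<theta>2 l = \<theta>2 * (pi\<^sup>2 * (real l)\<^sup>2 + spde_Gamma \<theta>0 \<theta>1 \<theta>2)"

text \<open>
  The stationary solution \<open>X\<close> of
  \<open>dX = (\<theta>2 \<partial>\<^sub>x\<^sup>2 X + \<theta>1 \<partial>\<^sub>x X + \<theta>0 X) dt + \<sigma> dW\<close> on \<open>[0, 1]\<close> with Dirichlet boundary conditions,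
  given by its spectral expansion with stationary coefficient processes \<open>u\<^sub>\<ell>\<close>, \<open>\<ell> \<ge> 1\<close>.
  The expansion is required almost surely for each fixed \<open>(t, x)\<close>, which determines \<open>X\<close> up to
  modification; in particular the continuous version is covered. Independence of the \<open>u\<^sub>\<ell>\<close>
  follows from that of the driving family, as each \<open>u\<^sub>\<ell>\<close> is a pathwise functional of
  \<open>(\<beta>\<^sub>\<ell>, u\<^sub>\<ell>(0))\<close>.
\<close>

definition stationary_spde_solution ::
  "'a measure \<Rightarrow> real \<Rightarrow> real \<Rightarrow> real \<Rightarrow> real \<Rightarrow>
   (nat \<Rightarrow> real \<Rightarrow> 'a \<Rightarrow> real) \<Rightarrow> (nat \<Rightarrow> real \<Rightarrow> 'a \<Rightarrow> real) \<Rightarrow> (real \<Rightarrow> real \<Rightarrow> 'a \<Rightarrow> real) \<Rightarrow> bool" where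
  "stationary_spde_solution P \<sigma> \<theta>0 \<theta>1 \<theta>2 \<beta> u X \<longleftrightarrow>
     prob_space P \<and>
     (\<forall>l\<ge>1. brownian_motion P (\<beta> l)) \<and>
     indep_drivers P \<beta> (\<lambda>l. u l 0) \<and>
     (\<forall>l\<ge>1. distributed P lborel (u l 0)
        (normal_density 0 (sqrt (\<sigma>\<^sup>2 / (2 * spde_eigenval \<theta>0 \<theta>1 \<theta>2 l))))) \<and>
     (\<forall>l\<ge>1. solves_ou_sde P (spde_eigenval \<theta>0 \<theta>1 \<theta>2 l) \<sigma> (\<beta> l) (u l)) \<and>
     (\<forall>t\<ge>0. \<forall>x\<in>{0..1}. X t x \<in> borel_measurable P \<and>
        (AE \<omega> in P. (\<lambda>n. u (Suc n) t \<omega> * spde_eigenfun \<theta>1 \<theta>2 (Suc n) x) sums X t x \<omega>))"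

definition grid_time :: "real \<Rightarrow> nat \<Rightarrow> nat \<Rightarrow> real" where
  "grid_time T N i = real i * (T / real N)"

definition grid_mesh :: "real \<Rightarrow> nat \<Rightarrow> real" where
  "grid_mesh b M = (1 - 2 * b) / real M"

definition grid_space :: "real \<Rightarrow> nat \<Rightarrow> nat \<Rightarrow> real" where
  "grid_space b M k = b + real k * grid_mesh b M"

definition V_sp ::
  "real \<Rightarrow> real \<Rightarrow> real \<Rightarrow> (real \<Rightarrow> real \<Rightarrow> 'a \<Rightarrow> real) \<Rightarrow> nat \<Rightarrow> nat \<Rightarrow> 'a \<Rightarrow> real" where
  "V_sp \<kappa> T b X M N \<omega> =
     1 / (real N * real M * grid_mesh b M) *
     (\<Sum>i<N. \<Sum>k<M. exp (\<kappa> * grid_space b M k) *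
        (X (grid_time T N i) (grid_space b M (Suc k)) \<omega>
         - X (grid_time T N i) (grid_space b M k) \<omega>)\<^sup>2)"

end

theory Submission
  imports Defs "HOL-Real_Asymp.Real_Asymp"
begin

text \<open>
  Put \<open>v = \<sigma>\<^sup>2 / (2 \<vartheta>2)\<close> and let \<open>\<xi>\<close> be the vector of the \<open>M N\<close> increments of \<open>X\<close>, multiplied by \<open>exp (\<kappa> y\<^sub>k / 2)\<close> and
  divided by \<open>sqrt (v \<delta>)\<close>. Then the centred, rescaled statistic is \<open>v (|\<xi>|\<^sup>2 - M N) / sqrt (M N)\<close>, so the theorem is a central limit
  theorem for the squared norm of a Gaussian vector. It holds because the covariance matrix \<open>C\<close> of \<open>\<xi>\<close> is close to the
  identity in the Hilbert-Schmidt norm: at a fixed time the field is a Brownian bridge up to a smooth perturbation,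
  and the heat semigroup decorrelates the increments at different times.

  The matrix \<open>C\<close> is never diagonalised. If \<open>h\<close> is a standard normal vector, independent of \<open>\<xi>\<close>, then taking the two
  expectations of \<open>exp (\<i> sqrt (2 s) \<langle>h, \<xi>\<rangle>)\<close> in either order shows that \<open>|\<xi>|\<^sup>2\<close> and \<open>\<langle>h, C h\<rangle>\<close> have the same Laplace transform
  (\<open>gaussian_family_laplace_square_norm\<close>), hence the same law (\<open>char_eq_if_laplace_eq\<close>). But
  \<open>\<langle>h, C h\<rangle> = |h|\<^sup>2 + \<langle>h, (C - 1) h\<rangle>\<close>. The first term obeys the classical central limit theorem with variance \<open>2\<close> per
  coordinate, and the second one is negligible as soon as \<open>\<Sum>\<^sub>p |C\<^sub>p\<^sub>p - 1| = o(sqrt (M N))\<close> and the sum of the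
  squared off-diagonal entries is \<open>o(M N)\<close> (\<open>gaussian_families_char_limit\<close>).

  Both sums are estimated from the spectral series of \<open>C\<close> (\<open>grid_cov_bounds\<close>). At equal times the expansion
  \<open>\<Sum>\<^sub>l 2 sin (\<pi> l x) sin (\<pi> l y) / (\<pi> l)\<^sup>2 = min x y - x y\<close> gives \<open>|C - 1| \<le> K \<delta>\<close> entrywise (\<open>incr_cov_equal_times\<close>). At time lag
  \<open>t > 0\<close> a Bessel inequality for increments gives the bound \<open>K / sqrt t\<close> for the sum of the squares over all pairs of cells
  (\<open>incr_cov_different_times\<close>). Altogether the diagonal sum is \<open>O(N)\<close> and the off-diagonal sum \<open>O(N\<^sup>2)\<close>, which after
  normalisation is \<open>O(sqrt (N / M))\<close> and \<open>O(N / M)\<close>; this is where \<open>N / M \<rightarrow> 0\<close> enters.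

  That \<open>\<xi>\<close> is Gaussian with covariance \<open>C\<close> follows from the equations of the coefficient processes: pathwise, each
  coefficient process is a limit of linear combinations of its initial value and of Brownian increments
  (\<open>ou_path_limit\<close>), and characteristic functions pass to the limit (\<open>finite_dim_char\<close>).
\<close>

section \<open>Laplace transforms determine laws on the half-line\<close>

lemma (in prob_space) expectation_uniform_approx:
  fixes f g :: "'a \<Rightarrow> real"
  assumes f: "integrable M f" and g: "integrable M g" and e: "\<And>\<omega>. \<bar>f \<omega> - g \<omega>\<bar> \<le> e"
  shows "\<bar>expectation f - expectation g\<bar> \<le> e"
proof -
  have "\<bar>expectation (\<lambda>\<omega>. f \<omega> - g \<omega>)\<bar> \<le> expectation (\<lambda>\<omega>. \<bar>f \<omega> - g \<omega>\<bar>)"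
    by (rule integral_abs_bound)
  also have "\<dots> \<le> expectation (\<lambda>\<omega>. e)"
    using f g e by (intro integral_mono) auto
  finally show ?thesis using f g by (simp add: prob_space)
qed

text \<open>
  On a compact interval continuous functions are uniform limits of polynomials, so that the moments
  of a bounded variable determine the expectations of all its continuous functions.
\<close>

lemma expectation_eq_if_moments_eq:
  fixes U :: "'a \<Rightarrow> real" and V :: "'b \<Rightarrow> real" and g :: "real \<Rightarrow> real"
  assumes P: "prob_space P" and Q: "prob_space Q"
    and U [measurable]: "U \<in> borel_measurable P" and V [measurable]: "V \<in> borel_measurable Q"
    and U01: "\<And>\<omega>. U \<omega> \<in> {0..1}" and V01: "\<And>\<omega>. V \<omega> \<in> {0..1}"
    and mom: "\<And>k::nat. (\<integral>\<omega>. U \<omega> ^ k \<partial>P) = (\<integral>\<omega>. V \<omega> ^ k \<partial>Q)"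
    and g: "continuous_on {0..1} g" and [measurable]: "g \<in> borel_measurable borel"
  shows "(\<integral>\<omega>. g (U \<omega>) \<partial>P) = (\<integral>\<omega>. g (V \<omega>) \<partial>Q)"
proof -
  interpret P: prob_space P by fact
  interpret Q: prob_space Q by fact
  obtain B where B: "\<And>x. x \<in> {0..1} \<Longrightarrow> \<bar>g x\<bar> \<le> B"
    using compact_continuous_image[OF g compact_Icc] 
    by (metis (no_types, lifting) bounded_iff compact_imp_bounded image_eqI real_norm_def)
  have intU: "integrable P (\<lambda>\<omega>. g (U \<omega>))"
    by (rule P.integrable_const_bound[where B=B]) (auto intro!: B U01)
  have intV: "integrable Q (\<lambda>\<omega>. g (V \<omega>))"
    by (rule Q.integrable_const_bound[where B=B]) (auto intro!: B V01)
  have pU: "integrable P (\<lambda>\<omega>. U \<omega> ^ k)" for k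
    by (rule P.integrable_const_bound[where B=1]) (use U01 in \<open>auto simp: power_le_one abs_le_iff power_abs\<close>)
  have pV: "integrable Q (\<lambda>\<omega>. V \<omega> ^ k)" for k
    by (rule Q.integrable_const_bound[where B=1]) (use V01 in \<open>auto simp: power_le_one abs_le_iff power_abs\<close>)
  have "\<bar>(\<integral>\<omega>. g (U \<omega>) \<partial>P) - (\<integral>\<omega>. g (V \<omega>) \<partial>Q)\<bar> \<le> e" if e: "e > 0" for e
  proof -
    obtain p where p: "real_polynomial_function p" "\<And>x. x \<in> {0..1} \<Longrightarrow> \<bar>g x - p x\<bar> < e / 2"
      using Stone_Weierstrass_real_polynomial_function[OF compact_Icc g, of "e/2"] e by auto
    then obtain a n where pn: "p = (\<lambda>x. \<Sum>i\<le>n. a i * x ^ i)"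
      by (auto simp: real_polynomial_function_iff_sum)
    have ipU: "integrable P (\<lambda>\<omega>. p (U \<omega>))" and ipV: "integrable Q (\<lambda>\<omega>. p (V \<omega>))"
      unfolding pn using pU pV by auto
    have eq: "(\<integral>\<omega>. p (U \<omega>) \<partial>P) = (\<integral>\<omega>. p (V \<omega>) \<partial>Q)"
      unfolding pn using pU pV by (simp add: mom)
    have 1: "\<bar>(\<integral>\<omega>. g (U \<omega>) \<partial>P) - (\<integral>\<omega>. p (U \<omega>) \<partial>P)\<bar> \<le> e / 2"
      using p(2)[OF U01] by (intro P.expectation_uniform_approx intU ipU) (auto intro: less_imp_le)
    have 2: "\<bar>(\<integral>\<omega>. g (V \<omega>) \<partial>Q) - (\<integral>\<omega>. p (V \<omega>) \<partial>Q)\<bar> \<le> e / 2"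
      using p(2)[OF V01] by (intro Q.expectation_uniform_approx intV ipV) (auto intro: less_imp_le)
    show ?thesis using 1 2 eq by linarith
  qed
  then have "\<bar>(\<integral>\<omega>. g (U \<omega>) \<partial>P) - (\<integral>\<omega>. g (V \<omega>) \<partial>Q)\<bar> \<le> 0"
    by (rule field_le_epsilon[of _ 0, simplified])
  then show ?thesis by simp
qed

text \<open>
  A bounded function of \<open>ln y\<close> may oscillate as \<open>y\<close> tends to \<open>0\<close>; a small power of \<open>y\<close> makes it continuous there.
\<close>

lemma continuous_on_powr_times_bounded_ln:
  fixes h :: "real \<Rightarrow> real"
  assumes h: "continuous_on UNIV h" and hb: "\<And>x. \<bar>h x\<bar> \<le> 1" and \<epsilon>: "\<epsilon> > 0"
  shows "continuous_on {0..1} (\<lambda>y. y powr \<epsilon> * h (ln y))"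
proof (rule continuous_on_eq_continuous_within[THEN iffD2], rule ballI)
  fix x :: real assume x: "x \<in> {0..1}"
  show "continuous (at x within {0..1}) (\<lambda>y. y powr \<epsilon> * h (ln y))"
  proof (cases "x = 0")
    case False
    with x have "x > 0" by auto
    then have "isCont (\<lambda>y. h (ln y)) x"
      using h by (intro isCont_o2[of _ ln h]) (auto simp: continuous_on_eq_continuous_at intro: isCont_ln)
    then have "isCont (\<lambda>y. y powr \<epsilon> * h (ln y)) x"
      using \<open>x > 0\<close> by (intro continuous_intros) auto
    then show ?thesis by (rule continuous_at_imp_continuous_at_within)
  next
    case True
    have "((\<lambda>y. y powr \<epsilon>) \<longlongrightarrow> 0 powr \<epsilon>) (at 0 within {0..1})"
      using \<epsilon> by (intro tendsto_powr') (auto intro!: tendsto_intros simp: eventually_at_filter)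
    then have lim: "((\<lambda>y::real. y powr \<epsilon>) \<longlongrightarrow> 0) (at 0 within {0..1})" by simp
    have "((\<lambda>y. y powr \<epsilon> * h (ln y)) \<longlongrightarrow> 0) (at 0 within {0..1})"
      by (rule Lim_null_comparison[OF _ lim]) (auto simp: abs_mult intro!: always_eventually mult_left_le hb)
    then show ?thesis using True by (simp add: continuous_within)
  qed
qed

lemma (in prob_space) expectation_damped_limit:
  assumes [measurable]: "Y \<in> borel_measurable M" "h \<in> borel_measurable borel"
    and Y0: "\<And>\<omega>. Y \<omega> \<ge> 0" and hb: "\<And>x. \<bar>h x\<bar> \<le> 1"
  shows "(\<lambda>n. expectation (\<lambda>\<omega>. exp (- Y \<omega>) powr (1 / real (Suc n)) * h (- Y \<omega>))) \<longlonglongrightarrow> expectation (\<lambda>\<omega>. h (- Y \<omega>))"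
proof (rule integral_dominated_convergence[where w="\<lambda>_. 1"])
  have "(\<lambda>n. exp (- y) powr (1 / real (Suc n)) * h (- y)) \<longlonglongrightarrow> exp (- y) powr 0 * h (- y)" for y
    using LIMSEQ_inverse_real_of_nat by (intro tendsto_intros) (auto simp: inverse_eq_divide)
  then show "AE \<omega> in M. (\<lambda>n. exp (- Y \<omega>) powr (1 / real (Suc n)) * h (- Y \<omega>)) \<longlonglongrightarrow> h (- Y \<omega>)" by simp
  show "AE \<omega> in M. norm (exp (- Y \<omega>) powr (1 / real (Suc n)) * h (- Y \<omega>)) \<le> 1" for n
    using Y0 hb by (auto simp: abs_mult powr_def intro!: mult_le_one)
qed simp_all

lemma (in prob_space) expectation_iexp_parts:
  assumes [measurable]: "Y \<in> borel_measurable M"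
  shows "(\<integral>\<omega>. iexp (t * Y \<omega>) \<partial>M) = Complex (expectation (\<lambda>\<omega>. cos (t * Y \<omega>))) (expectation (\<lambda>\<omega>. sin (t * Y \<omega>)))"
proof -
  have i: "integrable M (\<lambda>\<omega>. iexp (t * Y \<omega>))" by (rule integrable_iexp) auto
  show ?thesis using integral_Re[OF i] integral_Im[OF i] by (simp add: complex_eq_iff Re_exp Im_exp)
qed

text \<open>
  The values of the Laplace transform of \<open>Y \<ge> 0\<close> at the natural numbers are the moments of \<open>exp (- Y)\<close>,
  a variable in \<open>[0, 1]\<close>. They determine the expectations of continuous functions of \<open>exp (- Y)\<close>,
  and \<open>cos (t Y)\<close>, \<open>sin (t Y)\<close> are limits of such functions.
\<close>

lemma char_eq_if_laplace_eq:
  fixes Y :: "'a \<Rightarrow> real" and Z :: "'b \<Rightarrow> real"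
  assumes P: "prob_space P" and Q: "prob_space Q"
    and [measurable]: "Y \<in> borel_measurable P" "Z \<in> borel_measurable Q"
    and Y0: "\<And>\<omega>. Y \<omega> \<ge> 0" and Z0: "\<And>\<omega>. Z \<omega> \<ge> 0"
    and laplace: "\<And>k::nat. (\<integral>\<omega>. exp (- (real k * Y \<omega>)) \<partial>P) = (\<integral>\<omega>. exp (- (real k * Z \<omega>)) \<partial>Q)"
  shows "char (distr P borel Y) t = char (distr Q borel Z) t"
proof -
  interpret P: prob_space P by fact
  interpret Q: prob_space Q by fact
  have main: "(\<integral>\<omega>. h (- Y \<omega>) \<partial>P) = (\<integral>\<omega>. h (- Z \<omega>) \<partial>Q)"
    if h: "continuous_on UNIV h" and hb: "\<And>x. \<bar>h x\<bar> \<le> 1" for h :: "real \<Rightarrow> real"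
  proof -
    have [measurable]: "h \<in> borel_measurable borel" using h by (rule borel_measurable_continuous_onI)
    \<comment> \<open>The factor with exponent \<open>1 / (n + 1)\<close> restores continuity at \<open>exp (- Y) = 0\<close> and disappears as \<open>n\<close> grows.\<close>
    have eq: "(\<integral>\<omega>. exp (- Y \<omega>) powr (1 / real (Suc n)) * h (- Y \<omega>) \<partial>P)
      = (\<integral>\<omega>. exp (- Z \<omega>) powr (1 / real (Suc n)) * h (- Z \<omega>) \<partial>Q)" for n
    proof -
      let ?g = "\<lambda>y. y powr (1 / real (Suc n)) * h (ln y)"
      have "(\<integral>\<omega>. ?g (exp (- Y \<omega>)) \<partial>P) = (\<integral>\<omega>. ?g (exp (- Z \<omega>)) \<partial>Q)"
      proof (rule expectation_eq_if_moments_eq[OF P Q, where U="\<lambda>\<omega>. exp (- Y \<omega>)" and V="\<lambda>\<omega>. exp (- Z \<omega>)" and g="?g"])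
        show "(\<integral>\<omega>. exp (- Y \<omega>) ^ k \<partial>P) = (\<integral>\<omega>. exp (- Z \<omega>) ^ k \<partial>Q)" for k
          using laplace[of k] by (simp only: exp_of_nat_mult[symmetric] mult_minus_right)
        show "continuous_on {0..1} ?g"
          by (rule continuous_on_powr_times_bounded_ln[OF h hb]) simp
      qed (simp_all add: Y0 Z0)
      then show ?thesis by simp
    qed
    show ?thesis
      using P.expectation_damped_limit[of Y h] Q.expectation_damped_limit[of Z h] Y0 Z0 hb unfolding eq
      by (intro LIMSEQ_unique) auto
  qed
  have "(\<integral>\<omega>. cos (- t * - Y \<omega>) \<partial>P) = (\<integral>\<omega>. cos (- t * - Z \<omega>) \<partial>Q)"
    by (rule main) (auto intro!: continuous_intros)
  moreover have "(\<integral>\<omega>. sin (- t * - Y \<omega>) \<partial>P) = (\<integral>\<omega>. sin (- t * - Z \<omega>) \<partial>Q)"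
    by (rule main) (auto intro!: continuous_intros)
  ultimately have "(\<integral>\<omega>. iexp (t * Y \<omega>) \<partial>P) = (\<integral>\<omega>. iexp (t * Z \<omega>) \<partial>Q)"
    by (simp add: P.expectation_iexp_parts Q.expectation_iexp_parts del: of_real_mult)
  then show ?thesis by (simp add: char_def integral_distr)
qed

section \<open>Squared norms of Gaussian families\<close>

abbreviation std_normals :: "'i set \<Rightarrow> ('i \<Rightarrow> real) measure" where
  "std_normals I \<equiv> Pi\<^sub>M I (\<lambda>_. std_normal_distribution)"

lemma prob_space_std_normals: "prob_space (std_normals I)"
  by (intro prob_space_PiM) (simp add: prob_space_normal_density)

lemma measurable_coordinate_std_normals:
  assumes "p \<in> I" shows "(\<lambda>h. h p) \<in> borel_measurable (std_normals I)"
proof -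
  have "(\<lambda>h. h p) \<in> measurable (std_normals I) std_normal_distribution"
    using assms by (rule measurable_component_singleton)
  then show ?thesis by simp
qed

lemma distr_coordinate_std_normals:
  assumes "p \<in> I"
  shows "distr (std_normals I) borel (\<lambda>h. h p) = std_normal_distribution"
proof -
  have "distr (std_normals I) borel (\<lambda>h. h p) = distr (std_normals I) std_normal_distribution (\<lambda>h. h p)"
    by (intro distr_cong) auto
  also have "\<dots> = std_normal_distribution"
    using assms by (intro distr_PiM_component) (simp_all add: prob_space_normal_density)
  finally show ?thesis .
qed

lemma indep_coordinates_std_normals:
  fixes I :: "'i set"
  shows "prob_space.indep_vars (std_normals I) (\<lambda>_. borel) (\<lambda>p h. h p) I"
proof (cases "I = {}")
  case True
  interpret prob_space "std_normals ({} :: 'i set)" by (rule prob_space_std_normals)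
  show ?thesis unfolding True indep_vars_def2 indep_sets_def by simp
next
  case False
  interpret prob_space "std_normals I" by (rule prob_space_std_normals)
  have "distr (std_normals I) (Pi\<^sub>M I (\<lambda>_. borel)) (\<lambda>x. \<lambda>i\<in>I. x i)
      = distr (std_normals I) (std_normals I) (\<lambda>x. x)"
    by (intro distr_cong) (auto intro!: sets_PiM_cong simp: space_PiM)
  also have "\<dots> = std_normals I" by (rule distr_id)
  also have "\<dots> = Pi\<^sub>M I (\<lambda>i. distr (std_normals I) borel (\<lambda>h. h i))"
    by (intro PiM_cong) (simp_all add: distr_coordinate_std_normals)
  finally show ?thesis
    using False by (subst indep_vars_iff_distr_eq_PiM') (auto simp: measurable_coordinate_std_normals)
qed

lemma std_normal_distribution_moments:
  shows "(\<integral>x. x \<partial>std_normal_distribution) = 0"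
    and "(\<integral>x. x\<^sup>2 \<partial>std_normal_distribution) = 1"
    and "(\<integral>x. x ^ 4 \<partial>std_normal_distribution) = 3"
    and "integrable std_normal_distribution (\<lambda>x. x ^ k)"
proof -
  show "(\<integral>x. x \<partial>std_normal_distribution) = 0"
    using integral_std_normal_moment_odd[of 0] by (simp add: integral_density)
  show "(\<integral>x. x\<^sup>2 \<partial>std_normal_distribution) = 1"
    using std_normal_distribution_even_moments(1)[of 1] by (simp add: fact_numeral)
  show "(\<integral>x. x ^ 4 \<partial>std_normal_distribution) = 3"
    using std_normal_distribution_even_moments(1)[of 2] by (simp add: fact_numeral)
  show "integrable std_normal_distribution (\<lambda>x. x ^ k)"
    using integrable_std_normal_moment[of k] by (subst integrable_density) auto
qed

lemma std_normals_moments: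
  assumes "p \<in> I"
  shows "(\<integral>h. h p \<partial>std_normals I) = 0"
    and "(\<integral>h. (h p)\<^sup>2 \<partial>std_normals I) = 1"
    and "integrable (std_normals I) (\<lambda>h. h p)"
    and "integrable (std_normals I) (\<lambda>h. (h p)\<^sup>2)"
proof -
  note m [measurable] = measurable_coordinate_std_normals[OF assms]
  have i: "integral\<^sup>L (std_normals I) (\<lambda>h. f (h p)) = integral\<^sup>L std_normal_distribution f"
    if "f \<in> borel_measurable borel" for f :: "real \<Rightarrow> real"
    using that by (subst distr_coordinate_std_normals[OF assms, symmetric]) (simp add: integral_distr)
  have j: "integrable (std_normals I) (\<lambda>h. f (h p)) \<longleftrightarrow> integrable std_normal_distribution f"
    if "f \<in> borel_measurable borel" for f :: "real \<Rightarrow> real"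
    using that by (subst distr_coordinate_std_normals[OF assms, symmetric]) (simp add: integrable_distr_eq)
  show "(\<integral>h. h p \<partial>std_normals I) = 0" using i[of "\<lambda>x. x"] by (simp add: std_normal_distribution_moments)
  show "(\<integral>h. (h p)\<^sup>2 \<partial>std_normals I) = 1" using i[of "\<lambda>x. x\<^sup>2"] by (simp add: std_normal_distribution_moments)
  show "integrable (std_normals I) (\<lambda>h. h p)" using j[of "\<lambda>x. x"] std_normal_distribution_moments(4)[of 1] by simp
  show "integrable (std_normals I) (\<lambda>h. (h p)\<^sup>2)" using j[of "\<lambda>x. x\<^sup>2"] std_normal_distribution_moments(4)[of 2] by simp
qed

lemma (in prob_space) expectation_iexp_sum_indep:
  assumes "finite A" and "indep_vars (\<lambda>_. borel) Z A"
  shows "(\<integral>\<omega>. iexp (\<Sum>i\<in>A. Z i \<omega>) \<partial>M) = (\<Prod>i\<in>A. \<integral>\<omega>. iexp (Z i \<omega>) \<partial>M)"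
proof -
  have m: "Z i \<in> borel_measurable M" if "i \<in> A" for i
    using assms(2) that by (simp add: indep_vars_def)
  have "(\<integral>\<omega>. iexp (\<Sum>i\<in>A. Z i \<omega>) \<partial>M) = char (distr M borel (\<lambda>\<omega>. \<Sum>i\<in>A. Z i \<omega>)) 1"
    using m by (subst char_def, subst integral_distr) auto
  also have "\<dots> = (\<Prod>i\<in>A. char (distr M borel (Z i)) 1)"
    by (rule char_distr_sum[OF assms(2)])
  also have "\<dots> = (\<Prod>i\<in>A. \<integral>\<omega>. iexp (Z i \<omega>) \<partial>M)"
    using m by (intro prod.cong refl, subst char_def, subst integral_distr) auto
  finally show ?thesis .
qed

lemma (in prob_space) indep_vars_of_vars:
  fixes Z :: "'i \<Rightarrow> 'a \<Rightarrow> real" and f :: "'i \<Rightarrow> real \<Rightarrow> real"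
  assumes "indep_vars (\<lambda>_. borel) Z A" and "\<And>i. i \<in> A \<Longrightarrow> f i \<in> borel_measurable borel"
  shows "indep_vars (\<lambda>_. borel) (\<lambda>i \<omega>. f i (Z i \<omega>)) A"
  using assms by (rule indep_vars_compose2)

lemma std_normals_iexp_linear:
  assumes "finite I"
  shows "(\<integral>h. iexp (\<Sum>p\<in>I. x p * h p) \<partial>std_normals I) = of_real (exp (- (\<Sum>p\<in>I. (x p)\<^sup>2) / 2))"
proof -
  interpret prob_space "std_normals I" by (rule prob_space_std_normals)
  have "(\<integral>h. iexp (\<Sum>p\<in>I. x p * h p) \<partial>std_normals I) = (\<Prod>p\<in>I. \<integral>h. iexp (x p * h p) \<partial>std_normals I)"
    by (rule expectation_iexp_sum_indep[OF assms indep_vars_of_vars[OF indep_coordinates_std_normals, of "\<lambda>p y. x p * y"]]) simp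
  also have "\<dots> = (\<Prod>p\<in>I. of_real (exp (- (x p)\<^sup>2 / 2)))"
  proof (rule prod.cong[OF refl])
    fix p assume p: "p \<in> I"
    note [measurable] = measurable_coordinate_std_normals[OF p]
    have "(\<integral>h. iexp (x p * h p) \<partial>std_normals I) = char (distr (std_normals I) borel (\<lambda>h. h p)) (x p)"
      by (simp add: char_def integral_distr)
    also have "\<dots> = of_real (exp (- (x p)\<^sup>2 / 2))"
      by (simp add: distr_coordinate_std_normals[OF p] char_std_normal_distribution)
    finally show "(\<integral>h. iexp (x p * h p) \<partial>std_normals I) = of_real (exp (- (x p)\<^sup>2 / 2))" .
  qed
  also have "\<dots> = of_real (exp (- (\<Sum>p\<in>I. (x p)\<^sup>2) / 2))"
    using assms by (simp add: exp_sum[symmetric] sum_negf sum_divide_distrib flip: of_real_prod)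
  finally show ?thesis .
qed

text \<open>
  The joint characteristic function characterises Gaussian vectors, degenerate ones included, and it is
  the form of Gaussianity to which Fubini's theorem applies below.
\<close>

definition gaussian_family ::
  "'a measure \<Rightarrow> 'i set \<Rightarrow> ('i \<Rightarrow> 'a \<Rightarrow> real) \<Rightarrow> ('i \<Rightarrow> 'i \<Rightarrow> real) \<Rightarrow> bool" where
  "gaussian_family P I \<xi> C \<longleftrightarrow> prob_space P \<and> finite I \<and> (\<forall>p\<in>I. \<xi> p \<in> borel_measurable P) \<and>
     (\<forall>x. (\<integral>\<omega>. iexp (\<Sum>p\<in>I. x p * \<xi> p \<omega>) \<partial>P)
          = of_real (exp (- (\<Sum>p\<in>I. \<Sum>q\<in>I. C p q * x p * x q) / 2)))"

text \<open>
  A characteristic function is bounded by \<open>1\<close> in modulus, which forces the exponent to be nonpositive.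
\<close>

lemma gaussian_family_quadratic_form_nonneg:
  assumes "gaussian_family P I \<xi> C"
  shows "(\<Sum>p\<in>I. \<Sum>q\<in>I. C p q * x p * x q) \<ge> 0"
proof -
  interpret prob_space P using assms by (simp add: gaussian_family_def)
  have "norm (\<integral>\<omega>. iexp (\<Sum>p\<in>I. x p * \<xi> p \<omega>) \<partial>P) \<le> (\<integral>\<omega>. norm (iexp (\<Sum>p\<in>I. x p * \<xi> p \<omega>)) \<partial>P)"
    by (rule integral_norm_bound)
  also have "\<dots> = 1" by (simp add: prob_space del: of_real_sum of_real_mult)
  finally have "exp (- (\<Sum>p\<in>I. \<Sum>q\<in>I. C p q * x p * x q) / 2) \<le> 1"
    using assms by (simp add: gaussian_family_def)
  then show ?thesis by simp
qed

text \<open>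
  Write \<open>exp (- s |\<xi>|\<^sup>2)\<close> as the characteristic function, evaluated at \<open>sqrt (2 s) \<xi>\<close>, of an independent
  standard normal vector \<open>h\<close>. Exchanging the two expectations, the inner one becomes the
  characteristic function of \<open>\<xi>\<close> at \<open>sqrt (2 s) h\<close>. In this way the squared norm is compared with a quadratic
  form in independent normal variables without diagonalising \<open>C\<close>.
\<close>

lemma gaussian_family_laplace_square_norm:
  assumes G: "gaussian_family P I \<xi> C" and s: "s \<ge> 0"
  shows "(\<integral>\<omega>. exp (- (s * (\<Sum>p\<in>I. (\<xi> p \<omega>)\<^sup>2))) \<partial>P)
       = (\<integral>h. exp (- (s * (\<Sum>p\<in>I. \<Sum>q\<in>I. C p q * h p * h q))) \<partial>std_normals I)"
proof -
  let ?Q = "std_normals I"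
  define r where "r = sqrt (2 * s)"
  have r2: "r\<^sup>2 = 2 * s" using s by (simp add: r_def)
  interpret P: prob_space P using G by (simp add: gaussian_family_def)
  interpret Q: prob_space ?Q by (rule prob_space_std_normals)
  interpret PQ: pair_prob_space P ?Q ..
  have fin: "finite I" and xi [measurable]: "\<And>p. p \<in> I \<Longrightarrow> \<xi> p \<in> borel_measurable P"
    using G by (auto simp: gaussian_family_def)
  note [measurable] = measurable_coordinate_std_normals
  let ?f = "\<lambda>\<omega> h. iexp (\<Sum>p\<in>I. r * h p * \<xi> p \<omega>)"
  have int: "integrable (P \<Otimes>\<^sub>M ?Q) (case_prod ?f)"
  proof (rule PQ.P.integrable_const_bound[where B=1])
    show "AE x in P \<Otimes>\<^sub>M ?Q. norm (case_prod ?f x) \<le> 1"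
      by (auto simp del: of_real_sum of_real_mult)
    have "(\<lambda>z. \<Sum>p\<in>I. r * (snd z) p * \<xi> p (fst z)) \<in> borel_measurable (P \<Otimes>\<^sub>M ?Q)"
      by (intro borel_measurable_sum borel_measurable_times borel_measurable_const
          measurable_compose[OF measurable_snd measurable_coordinate_std_normals]
          measurable_compose[OF measurable_fst xi])
    then have "(\<lambda>z. iexp (\<Sum>p\<in>I. r * (snd z) p * \<xi> p (fst z))) \<in> borel_measurable (P \<Otimes>\<^sub>M ?Q)"
      by measurable
    then show "case_prod ?f \<in> borel_measurable (P \<Otimes>\<^sub>M ?Q)" by (simp add: case_prod_beta)
  qed
  have "(\<integral>h. (\<integral>\<omega>. ?f \<omega> h \<partial>P) \<partial>?Q) = (\<integral>\<omega>. (\<integral>h. ?f \<omega> h \<partial>?Q) \<partial>P)"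
    by (rule PQ.Fubini_integral[OF int])
  moreover have "(\<integral>\<omega>. ?f \<omega> h \<partial>P) = of_real (exp (- (s * (\<Sum>p\<in>I. \<Sum>q\<in>I. C p q * h p * h q))))" for h
  proof -
    have "(\<integral>\<omega>. ?f \<omega> h \<partial>P) = of_real (exp (- (\<Sum>p\<in>I. \<Sum>q\<in>I. C p q * (r * h p) * (r * h q)) / 2))"
      using G unfolding gaussian_family_def by (elim conjE allE[where x="\<lambda>p. r * h p"])
    also have "(\<Sum>p\<in>I. \<Sum>q\<in>I. C p q * (r * h p) * (r * h q)) = r\<^sup>2 * (\<Sum>p\<in>I. \<Sum>q\<in>I. C p q * h p * h q)"
      by (simp add: sum_distrib_left power2_eq_square mult_ac)
    finally show ?thesis by (simp add: r2)
  qed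
  moreover have "(\<integral>h. ?f \<omega> h \<partial>?Q) = of_real (exp (- (s * (\<Sum>p\<in>I. (\<xi> p \<omega>)\<^sup>2))))" for \<omega>
  proof -
    have "(\<integral>h. ?f \<omega> h \<partial>?Q) = (\<integral>h. iexp (\<Sum>p\<in>I. (r * \<xi> p \<omega>) * h p) \<partial>?Q)"
      by (simp add: mult_ac)
    also have "\<dots> = of_real (exp (- (\<Sum>p\<in>I. (r * \<xi> p \<omega>)\<^sup>2) / 2))"
      by (rule std_normals_iexp_linear[OF fin])
    also have "(\<Sum>p\<in>I. (r * \<xi> p \<omega>)\<^sup>2) = r\<^sup>2 * (\<Sum>p\<in>I. (\<xi> p \<omega>)\<^sup>2)"
      by (simp add: sum_distrib_left power_mult_distrib)
    finally show ?thesis by (simp add: r2)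
  qed
  ultimately have "(\<integral>h. complex_of_real (exp (- (s * (\<Sum>p\<in>I. \<Sum>q\<in>I. C p q * h p * h q)))) \<partial>?Q)
     = (\<integral>\<omega>. complex_of_real (exp (- (s * (\<Sum>p\<in>I. (\<xi> p \<omega>)\<^sup>2)))) \<partial>P)" by simp
  then show ?thesis by (simp only: integral_complex_of_real of_real_eq_iff)
qed

lemma gaussian_family_char_square_norm:
  assumes G: "gaussian_family P I \<xi> C"
  shows "char (distr P borel (\<lambda>\<omega>. \<Sum>p\<in>I. (\<xi> p \<omega>)\<^sup>2)) t
       = char (distr (std_normals I) borel (\<lambda>h. \<Sum>p\<in>I. \<Sum>q\<in>I. C p q * h p * h q)) t"
proof (rule char_eq_if_laplace_eq)
  note [measurable] = measurable_coordinate_std_normals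
  have fin: "finite I" and xi [measurable]: "\<And>p. p \<in> I \<Longrightarrow> \<xi> p \<in> borel_measurable P"
    using G by (auto simp: gaussian_family_def)
  show "prob_space P" using G by (simp add: gaussian_family_def)
  show "prob_space (std_normals I)" by (rule prob_space_std_normals)
  show "(\<lambda>\<omega>. \<Sum>p\<in>I. (\<xi> p \<omega>)\<^sup>2) \<in> borel_measurable P" by measurable
  show "(\<lambda>h. \<Sum>p\<in>I. \<Sum>q\<in>I. C p q * h p * h q) \<in> borel_measurable (std_normals I)" by measurable
  show "0 \<le> (\<Sum>p\<in>I. (\<xi> p \<omega>)\<^sup>2)" for \<omega> by (intro sum_nonneg) simp
  show "0 \<le> (\<Sum>p\<in>I. \<Sum>q\<in>I. C p q * h p * h q)" for h
    by (rule gaussian_family_quadratic_form_nonneg[OF G])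
  show "(\<integral>\<omega>. exp (- (real k * (\<Sum>p\<in>I. (\<xi> p \<omega>)\<^sup>2))) \<partial>P)
    = (\<integral>h. exp (- (real k * (\<Sum>p\<in>I. \<Sum>q\<in>I. C p q * h p * h q))) \<partial>std_normals I)" for k :: nat
    by (rule gaussian_family_laplace_square_norm[OF G]) simp
qed

section \<open>A central limit theorem for nearly white Gaussian families\<close>

text \<open>
  The cross term \<open>2 H\<^sub>n F G\<close> has mean zero because \<open>H\<^sub>n\<close> is centred and independent of \<open>F\<close> and \<open>G\<close>.
  This is the induction step for the second moments of linear and quadratic forms.
\<close>

lemma (in prob_space) second_moment_indep_affine:
  fixes H :: "'i \<Rightarrow> 'a \<Rightarrow> real" and f g :: "('i \<Rightarrow> real) \<Rightarrow> real"
  assumes ind: "indep_vars (\<lambda>_. borel) H (insert n A)" and n: "n \<notin> A"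
    and H0: "expectation (H n) = 0" and H1: "expectation (\<lambda>\<omega>. (H n \<omega>)\<^sup>2) = 1"
    and iH: "integrable M (\<lambda>\<omega>. (H n \<omega>)\<^sup>2)"
    and f [measurable]: "f \<in> borel_measurable (Pi\<^sub>M A (\<lambda>_. borel))"
    and g [measurable]: "g \<in> borel_measurable (Pi\<^sub>M A (\<lambda>_. borel))"
  defines "F \<equiv> \<lambda>\<omega>. f (\<lambda>i\<in>A. H i \<omega>)" and "G \<equiv> \<lambda>\<omega>. g (\<lambda>i\<in>A. H i \<omega>)"
  assumes iF: "integrable M (\<lambda>\<omega>. (F \<omega>)\<^sup>2)" and iG: "integrable M (\<lambda>\<omega>. (G \<omega>)\<^sup>2)"
  shows "integrable M (\<lambda>\<omega>. (H n \<omega> * F \<omega> + G \<omega>)\<^sup>2)"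
    and "expectation (\<lambda>\<omega>. (H n \<omega> * F \<omega> + G \<omega>)\<^sup>2) = expectation (\<lambda>\<omega>. (F \<omega>)\<^sup>2) + expectation (\<lambda>\<omega>. (G \<omega>)\<^sup>2)"
proof -
  have mH [measurable]: "H i \<in> borel_measurable M" if "i \<in> insert n A" for i
    using ind that unfolding indep_vars_def2 by blast
  have "(\<lambda>\<omega>. \<lambda>i\<in>A. H i \<omega>) \<in> measurable M (Pi\<^sub>M A (\<lambda>_. borel))"
    by (intro measurable_restrict) (simp add: mH)
  then have [measurable]: "F \<in> borel_measurable M" "G \<in> borel_measurable M"
    unfolding F_def G_def by measurable
  have [measurable]: "H n \<in> borel_measurable M" by (rule mH) simp
  have base: "indep_var (Pi\<^sub>M {n} (\<lambda>_. borel)) (\<lambda>\<omega>. \<lambda>i\<in>{n}. H i \<omega>) (Pi\<^sub>M A (\<lambda>_. borel)) (\<lambda>\<omega>. \<lambda>i\<in>A. H i \<omega>)"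
    using n by (intro indep_var_restrict[OF ind]) auto
  have ind': "indep_var borel (\<lambda>\<omega>. \<phi> (H n \<omega>)) borel (\<lambda>\<omega>. \<psi> (\<lambda>i\<in>A. H i \<omega>))"
    if [measurable]: "\<phi> \<in> borel_measurable borel" "\<psi> \<in> borel_measurable (Pi\<^sub>M A (\<lambda>_. borel))"
    for \<phi> :: "real \<Rightarrow> real" and \<psi> :: "('i \<Rightarrow> real) \<Rightarrow> real"
  proof -
    have "(\<lambda>x. \<phi> (x n)) \<in> borel_measurable (Pi\<^sub>M {n} (\<lambda>_. borel))" by measurable
    from indep_var_compose[OF base this that(2)] show ?thesis by (simp add: comp_def)
  qed
  have iH1: "integrable M (H n)"
    by (rule square_integrable_imp_integrable[OF _ iH]) simp
  have iFG: "integrable M (\<lambda>\<omega>. F \<omega> * G \<omega>)"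
  proof (rule Bochner_Integration.integrable_bound)
    show "integrable M (\<lambda>\<omega>. (F \<omega>)\<^sup>2 + (G \<omega>)\<^sup>2)" using iF iG by simp
    have "\<bar>a * b\<bar> \<le> a\<^sup>2 + b\<^sup>2" for a b :: real
      using sum_squares_bound[of "\<bar>a\<bar>" "\<bar>b\<bar>"] mult_nonneg_nonneg[OF abs_ge_zero[of a] abs_ge_zero[of b]]
      unfolding abs_mult power2_abs by linarith
    then show "AE \<omega> in M. norm (F \<omega> * G \<omega>) \<le> norm ((F \<omega>)\<^sup>2 + (G \<omega>)\<^sup>2)"
      by (intro always_eventually allI) simp
  qed simp
  have v1: "indep_var borel (\<lambda>\<omega>. (H n \<omega>)\<^sup>2) borel (\<lambda>\<omega>. (F \<omega>)\<^sup>2)"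
    unfolding F_def by (rule ind'[of "\<lambda>x. x\<^sup>2" "\<lambda>x. (f x)\<^sup>2"]) measurable
  have v2: "indep_var borel (H n) borel (\<lambda>\<omega>. F \<omega> * G \<omega>)"
    unfolding F_def G_def by (rule ind'[of "\<lambda>x. x" "\<lambda>x. f x * g x"]) measurable
  have i1: "integrable M (\<lambda>\<omega>. (H n \<omega>)\<^sup>2 * (F \<omega>)\<^sup>2)" by (rule indep_var_integrable[OF v1 iH iF])
  have i2: "integrable M (\<lambda>\<omega>. H n \<omega> * (F \<omega> * G \<omega>))" by (rule indep_var_integrable[OF v2 iH1 iFG])
  have e1: "expectation (\<lambda>\<omega>. (H n \<omega>)\<^sup>2 * (F \<omega>)\<^sup>2) = expectation (\<lambda>\<omega>. (F \<omega>)\<^sup>2)"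
    using indep_var_lebesgue_integral[OF v1 iH iF] by (simp add: H1)
  have e2: "expectation (\<lambda>\<omega>. H n \<omega> * (F \<omega> * G \<omega>)) = 0"
    using indep_var_lebesgue_integral[OF v2 iH1 iFG] by (simp add: H0)
  have eq: "(H n \<omega> * F \<omega> + G \<omega>)\<^sup>2 = (H n \<omega>)\<^sup>2 * (F \<omega>)\<^sup>2 + 2 * (H n \<omega> * (F \<omega> * G \<omega>)) + (G \<omega>)\<^sup>2" for \<omega>
    by (simp add: power2_eq_square algebra_simps)
  show "integrable M (\<lambda>\<omega>. (H n \<omega> * F \<omega> + G \<omega>)\<^sup>2)"
    unfolding eq using i1 i2 iG by auto
  show "expectation (\<lambda>\<omega>. (H n \<omega> * F \<omega> + G \<omega>)\<^sup>2) = expectation (\<lambda>\<omega>. (F \<omega>)\<^sup>2) + expectation (\<lambda>\<omega>. (G \<omega>)\<^sup>2)"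
    unfolding eq using i1 i2 iG e1 e2 by simp
qed

context prob_space
begin

context
  fixes H :: "'i \<Rightarrow> 'a \<Rightarrow> real" and I :: "'i set"
  assumes fin: "finite I" and ind: "indep_vars (\<lambda>_. borel) H I"
    and H0: "\<And>i. i \<in> I \<Longrightarrow> expectation (H i) = 0"
    and H1: "\<And>i. i \<in> I \<Longrightarrow> expectation (\<lambda>\<omega>. (H i \<omega>)\<^sup>2) = 1"
    and iH: "\<And>i. i \<in> I \<Longrightarrow> integrable M (\<lambda>\<omega>. (H i \<omega>)\<^sup>2)"
begin

lemma second_moment_linear_form:
  assumes "A \<subseteq> I"
  shows "integrable M (\<lambda>\<omega>. (\<Sum>q\<in>A. c q * H q \<omega>)\<^sup>2) \<and>
    expectation (\<lambda>\<omega>. (\<Sum>q\<in>A. c q * H q \<omega>)\<^sup>2) = (\<Sum>q\<in>A. (c q)\<^sup>2)"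
  using finite_subset[OF assms fin] assms
proof (induction A rule: finite_induct)
  case empty
  then show ?case by simp
next
  case (insert n A)
  have ind': "indep_vars (\<lambda>_. borel) H (insert n A)" by (rule indep_vars_subset[OF ind insert.prems])
  have n: "n \<in> I" using insert.prems by auto
  let ?g = "\<lambda>x. \<Sum>q\<in>A. c q * x q"
  have g: "?g \<in> borel_measurable (Pi\<^sub>M A (\<lambda>_. borel))" by measurable
  have gr: "?g (\<lambda>i\<in>A. H i \<omega>) = (\<Sum>q\<in>A. c q * H q \<omega>)" for \<omega> by (intro sum.cong) auto
  have *: "(\<Sum>q\<in>insert n A. c q * H q \<omega>) = H n \<omega> * c n + ?g (\<lambda>i\<in>A. H i \<omega>)" for \<omega>
    using insert.hyps unfolding gr by simp
  note s = second_moment_indep_affine[OF ind' insert.hyps(2) H0[OF n] H1[OF n] iH[OF n], of "\<lambda>_. c n" ?g]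
  have IH: "integrable M (\<lambda>\<omega>. (?g (\<lambda>i\<in>A. H i \<omega>))\<^sup>2)"
    "expectation (\<lambda>\<omega>. (?g (\<lambda>i\<in>A. H i \<omega>))\<^sup>2) = (\<Sum>q\<in>A. (c q)\<^sup>2)"
    unfolding gr using insert by auto
  show ?case unfolding * using s[OF _ g _ IH(1)] insert.hyps IH(2) by (simp add: prob_space)
qed

text \<open>
  Adding an index \<open>n\<close> to \<open>A\<close> adds \<open>H\<^sub>n\<close> times a linear form in the earlier variables, which is orthogonal to the
  quadratic form in the earlier variables; so second moments add up.
\<close>

lemma second_moment_off_diagonal_form:
  assumes "A \<subseteq> I" and D0: "\<And>p. D p p = 0" and sym: "\<And>p q. D p q = D q p"
  shows "integrable M (\<lambda>\<omega>. (\<Sum>p\<in>A. \<Sum>q\<in>A. D p q * H p \<omega> * H q \<omega>)\<^sup>2) \<and>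
    expectation (\<lambda>\<omega>. (\<Sum>p\<in>A. \<Sum>q\<in>A. D p q * H p \<omega> * H q \<omega>)\<^sup>2) = 2 * (\<Sum>p\<in>A. \<Sum>q\<in>A. (D p q)\<^sup>2)"
  using finite_subset[OF assms(1) fin] assms(1)
proof (induction A rule: finite_induct)
  case empty
  then show ?case by simp
next
  case (insert n A)
  have ind': "indep_vars (\<lambda>_. borel) H (insert n A)" by (rule indep_vars_subset[OF ind insert.prems])
  let ?A = "\<lambda>\<omega>. \<lambda>i\<in>A. H i \<omega>"
  have n: "n \<in> I" using insert.prems by auto
  let ?f = "\<lambda>x. \<Sum>q\<in>A. (2 * D n q) * x q"
  let ?g = "\<lambda>x. \<Sum>p\<in>A. \<Sum>q\<in>A. D p q * x p * x q"
  have f: "?f \<in> borel_measurable (Pi\<^sub>M A (\<lambda>_. borel))" by measurable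
  have g: "?g \<in> borel_measurable (Pi\<^sub>M A (\<lambda>_. borel))" by measurable
  have fr: "?f (?A \<omega>) = (\<Sum>q\<in>A. (2 * D n q) * H q \<omega>)" for \<omega> by (intro sum.cong) auto
  have gr: "?g (?A \<omega>) = (\<Sum>p\<in>A. \<Sum>q\<in>A. D p q * H p \<omega> * H q \<omega>)" for \<omega> by (intro sum.cong) auto
  have *: "(\<Sum>p\<in>insert n A. \<Sum>q\<in>insert n A. D p q * H p \<omega> * H q \<omega>)
    = H n \<omega> * ?f (?A \<omega>) + ?g (?A \<omega>)" for \<omega>
  proof -
    have "(\<Sum>p\<in>A. D p n * H p \<omega> * H n \<omega>) = (\<Sum>q\<in>A. D n q * H n \<omega> * H q \<omega>)"
      by (intro sum.cong refl) (subst sym, simp)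
    then have "(\<Sum>p\<in>insert n A. \<Sum>q\<in>insert n A. D p q * H p \<omega> * H q \<omega>)
       = 2 * (\<Sum>q\<in>A. D n q * H n \<omega> * H q \<omega>) + (\<Sum>p\<in>A. \<Sum>q\<in>A. D p q * H p \<omega> * H q \<omega>)"
      using insert.hyps by (simp add: D0 sum.distrib)
    then show ?thesis unfolding fr gr by (simp add: sum_distrib_left mult_ac)
  qed
  have F: "integrable M (\<lambda>\<omega>. (?f (?A \<omega>))\<^sup>2)"
    "expectation (\<lambda>\<omega>. (?f (?A \<omega>))\<^sup>2) = (\<Sum>q\<in>A. (2 * D n q)\<^sup>2)"
    unfolding fr using second_moment_linear_form[of A "\<lambda>q. 2 * D n q"] insert.prems by auto
  have G: "integrable M (\<lambda>\<omega>. (?g (?A \<omega>))\<^sup>2)"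
    "expectation (\<lambda>\<omega>. (?g (?A \<omega>))\<^sup>2) = 2 * (\<Sum>p\<in>A. \<Sum>q\<in>A. (D p q)\<^sup>2)"
    unfolding gr using insert by auto
  have D2: "(\<Sum>p\<in>insert n A. \<Sum>q\<in>insert n A. (D p q)\<^sup>2) = 2 * (\<Sum>q\<in>A. (D n q)\<^sup>2) + (\<Sum>p\<in>A. \<Sum>q\<in>A. (D p q)\<^sup>2)"
  proof -
    have "(\<Sum>p\<in>A. (D p n)\<^sup>2) = (\<Sum>q\<in>A. (D n q)\<^sup>2)"
      by (intro sum.cong refl) (subst sym, simp)
    then show ?thesis using insert.hyps by (simp add: D0 sum.distrib)
  qed
  note s = second_moment_indep_affine[OF ind' insert.hyps(2) H0[OF n] H1[OF n] iH[OF n] f g F(1) G(1)]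
  have "2 * (2 * (\<Sum>q\<in>A. (D n q)\<^sup>2)) = (\<Sum>q\<in>A. (2 * D n q)\<^sup>2)"
    by (simp add: power_mult_distrib sum_distrib_left)
  then show ?case unfolding * D2 using s unfolding F(2) G(2) by (simp only: distrib_left)
qed

end

end

lemma sum_split_diagonal:
  fixes E :: "'i \<Rightarrow> 'i \<Rightarrow> real"
  assumes fin: "finite I"
  shows "(\<Sum>p\<in>I. \<Sum>q\<in>I. E p q) = (\<Sum>p\<in>I. E p p) + (\<Sum>p\<in>I. \<Sum>q\<in>I. if p = q then 0 else E p q)"
proof -
  have "(\<Sum>q\<in>I. E p q) = E p p + (\<Sum>q\<in>I. if p = q then 0 else E p q)" if p: "p \<in> I" for p
  proof -
    have "(\<Sum>q\<in>I. E p q) = (\<Sum>q\<in>I. (if p = q then E p q else 0) + (if p = q then 0 else E p q))"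
      by (intro sum.cong) auto
    then show ?thesis using fin p by (simp add: sum.distrib)
  qed
  then show ?thesis by (simp add: sum.distrib)
qed
lemma sum_off_diagonal:
  fixes E :: "'i \<Rightarrow> 'i \<Rightarrow> real"
  assumes fin: "finite I"
  shows "(\<Sum>p\<in>I. \<Sum>q\<in>I. if p = q then 0 else E p q) = (\<Sum>p\<in>I. \<Sum>q\<in>I - {p}. E p q)"
proof (rule sum.cong[OF refl])
  fix p assume "p \<in> I"
  show "(\<Sum>q\<in>I. if p = q then 0 else E p q) = (\<Sum>q\<in>I - {p}. E p q)"
    using fin by (intro sum.mono_neutral_cong_right) auto
qed
text \<open>
  The diagonal part is bounded in mean, the off-diagonal part, which is centred, in mean square.
\<close>

lemma std_normals_abs_quadratic_form_bound:
  assumes fin: "finite I" and sym: "\<And>p q. E p q = E q p"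
  shows "integrable (std_normals I) (\<lambda>h. \<Sum>p\<in>I. \<Sum>q\<in>I. E p q * h p * h q)"
    and "(\<integral>h. \<bar>\<Sum>p\<in>I. \<Sum>q\<in>I. E p q * h p * h q\<bar> \<partial>std_normals I)
       \<le> (\<Sum>p\<in>I. \<bar>E p p\<bar>) + sqrt (2 * (\<Sum>p\<in>I. \<Sum>q\<in>I - {p}. (E p q)\<^sup>2))"
proof -
  interpret prob_space "std_normals I" by (rule prob_space_std_normals)
  define D where "D p q = (if p = q then 0 else E p q)" for p q
  define R where "R h = (\<Sum>p\<in>I. \<Sum>q\<in>I. D p q * h p * h q)" for h
  define S where "S h = (\<Sum>p\<in>I. E p p * (h p)\<^sup>2)" for h
  define S' where "S' h = (\<Sum>p\<in>I. \<bar>E p p\<bar> * (h p)\<^sup>2)" for h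
  define F where "F = (\<Sum>p\<in>I. \<Sum>q\<in>I - {p}. (E p q)\<^sup>2)"
  have D0: "D p p = 0" and Dsym: "D p q = D q p" for p q by (simp_all add: D_def sym[of p q])
  have DF: "(\<Sum>p\<in>I. \<Sum>q\<in>I. (D p q)\<^sup>2) = F"
    unfolding F_def sum_off_diagonal[OF fin, symmetric] by (intro sum.cong refl) (simp add: D_def)
  have "integrable (std_normals I) (\<lambda>h. (R h)\<^sup>2) \<and> (\<integral>h. (R h)\<^sup>2 \<partial>std_normals I) = 2 * F"
    unfolding R_def DF[symmetric]
    by (rule second_moment_off_diagonal_form[where H="\<lambda>p h. h p" and I=I, OF fin
        indep_coordinates_std_normals std_normals_moments(1) std_normals_moments(2)
        std_normals_moments(4) order_refl D0 Dsym])
  then have R: "integrable (std_normals I) (\<lambda>h. (R h)\<^sup>2)" "(\<integral>h. (R h)\<^sup>2 \<partial>std_normals I) = 2 * F"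
    by blast+
  have mR: "R \<in> borel_measurable (std_normals I)"
    unfolding R_def
    by (intro borel_measurable_sum borel_measurable_times borel_measurable_const measurable_coordinate_std_normals)
  have iR: "integrable (std_normals I) R"
    by (rule square_integrable_imp_integrable[OF mR R(1)])
  have iS: "integrable (std_normals I) S" and iS': "integrable (std_normals I) S'"
    unfolding S_def S'_def
    by (intro Bochner_Integration.integrable_sum integrable_mult_right std_normals_moments(4); assumption)+
  have split: "(\<Sum>p\<in>I. \<Sum>q\<in>I. E p q * h p * h q) = S h + R h" for h
  proof -
    have "(\<Sum>p\<in>I. \<Sum>q\<in>I. if p = q then 0 else E p q * h p * h q) = R h"
      unfolding R_def by (intro sum.cong refl) (simp add: D_def)
    then show ?thesis
      using sum_split_diagonal[OF fin, of "\<lambda>p q. E p q * h p * h q"]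
      by (simp add: S_def power2_eq_square mult.assoc)
  qed
  show "integrable (std_normals I) (\<lambda>h. \<Sum>p\<in>I. \<Sum>q\<in>I. E p q * h p * h q)"
    unfolding split using iS iR by (rule Bochner_Integration.integrable_add)
  have "(\<integral>h. \<bar>S h + R h\<bar> \<partial>std_normals I) \<le> (\<integral>h. S' h + \<bar>R h\<bar> \<partial>std_normals I)"
  proof (rule integral_mono)
    fix h
    have "\<bar>S h\<bar> \<le> S' h"
      unfolding S_def S'_def by (rule order_trans[OF sum_abs]) (simp add: abs_mult)
    then show "\<bar>S h + R h\<bar> \<le> S' h + \<bar>R h\<bar>" by linarith
  qed (use iS iS' iR in simp_all)
  also have "\<dots> = (\<Sum>p\<in>I. \<bar>E p p\<bar>) + (\<integral>h. \<bar>R h\<bar> \<partial>std_normals I)"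
  proof -
    have "(\<integral>h. S' h \<partial>std_normals I) = (\<Sum>p\<in>I. \<bar>E p p\<bar>)"
      unfolding S'_def by (subst Bochner_Integration.integral_sum) (auto simp: std_normals_moments)
    then show ?thesis using iS' iR by simp
  qed
  also have "(\<integral>h. \<bar>R h\<bar> \<partial>std_normals I) \<le> sqrt (2 * F)"
  proof (rule real_le_rsqrt)
    have "variance (\<lambda>h. \<bar>R h\<bar>) = expectation (\<lambda>h. \<bar>R h\<bar>\<^sup>2) - (expectation (\<lambda>h. \<bar>R h\<bar>))\<^sup>2"
      using iR R(1) by (intro variance_eq) simp_all
    then show "(expectation (\<lambda>h. \<bar>R h\<bar>))\<^sup>2 \<le> 2 * F"
      using variance_positive[of "\<lambda>h. \<bar>R h\<bar>"] by (simp add: R(2))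
  qed
  finally show "(\<integral>h. \<bar>\<Sum>p\<in>I. \<Sum>q\<in>I. E p q * h p * h q\<bar> \<partial>std_normals I)
       \<le> (\<Sum>p\<in>I. \<bar>E p p\<bar>) + sqrt (2 * (\<Sum>p\<in>I. \<Sum>q\<in>I - {p}. (E p q)\<^sup>2))"
    unfolding split F_def by simp
qed

text \<open>
  The classical central limit theorem for \<open>h\<^sub>i\<^sup>2 - 1\<close>, where the \<open>h\<^sub>i\<close> are independent standard normal variables,
  in terms of the characteristic function of one summand.
\<close>

lemma chi_square_char_limit:
  "(\<lambda>n. (\<integral>x. iexp (t / sqrt (real n) * (x\<^sup>2 - 1)) \<partial>std_normal_distribution) ^ n)
     \<longlonglongrightarrow> of_real (exp (- t\<^sup>2))"
proof -
  let ?Q = "std_normals (UNIV :: nat set)"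
  let ?X = "\<lambda>n h. (h n)\<^sup>2 :: real"
  let ?\<phi> = "\<lambda>n. \<integral>x. iexp (t / sqrt (real n) * (x\<^sup>2 - 1)) \<partial>std_normal_distribution"
  interpret prob_space ?Q by (rule prob_space_std_normals)
  have m [measurable]: "\<And>p. (\<lambda>h. h p) \<in> borel_measurable ?Q" by (rule measurable_coordinate_std_normals) simp
  let ?S = "\<lambda>n. distr ?Q borel (\<lambda>h. (\<Sum>i<n. ?X i h - 1) / sqrt (real n * (sqrt 2)\<^sup>2))"
  have e: "integral\<^sup>L ?Q (\<lambda>h. f (h p)) = integral\<^sup>L std_normal_distribution f"
    if "f \<in> borel_measurable borel" for f :: "real \<Rightarrow> 'b::{banach, second_countable_topology}" and p
    using that by (subst distr_coordinate_std_normals[of p UNIV, symmetric]) (simp_all add: integral_distr)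
  have i: "integrable ?Q (\<lambda>h. (h p) ^ k)" for p k
    using std_normal_distribution_moments(4)[of k]
    by (subst (asm) distr_coordinate_std_normals[of p UNIV, symmetric]) (simp_all add: integrable_distr_eq)
  have indX: "indep_vars (\<lambda>_. borel) ?X UNIV"
    by (rule indep_vars_of_vars[OF indep_coordinates_std_normals, of "\<lambda>_ x. x\<^sup>2"]) simp
  have "weak_conv_m ?S std_normal_distribution"
  proof (rule central_limit_theorem[OF indX])
    show m1: "expectation (?X n) = 1" for n by (rule std_normals_moments) simp
    show "integrable ?Q (\<lambda>h. (?X n h)\<^sup>2)" for n
      using i[of n 4] by simp
    show "variance (?X n) = (sqrt 2)\<^sup>2" for n
    proof -
      have "variance (?X n) = expectation (\<lambda>h. (?X n h)\<^sup>2) - (expectation (?X n))\<^sup>2"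
        using i[of n 4] i[of n 2] by (intro variance_eq) simp_all
      also have "expectation (\<lambda>h. (?X n h)\<^sup>2) = 3"
        using e[of "\<lambda>x. x ^ 4" n] by (simp add: std_normal_distribution_moments)
      finally show ?thesis using m1 by simp
    qed
    show "distr ?Q borel (?X n) = distr std_normal_distribution borel (\<lambda>x. x\<^sup>2)" for n
      by (subst distr_coordinate_std_normals[of n UNIV, symmetric]) (simp_all add: distr_distr comp_def)
  qed simp
  \<comment> \<open>The theorem normalises by the standard deviation \<open>sqrt (2 n)\<close> of the sum, hence the argument \<open>sqrt 2 * t\<close>.\<close>
  then have "(\<lambda>n. char (?S n) (sqrt 2 * t)) \<longlonglongrightarrow> char std_normal_distribution (sqrt 2 * t)"
    by (intro levy_continuity1 real_dist_normal_dist real_distribution_distr) auto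
  moreover have "char (?S n) (sqrt 2 * t) = ?\<phi> n ^ n" for n
  proof -
    have "char (?S n) (sqrt 2 * t) = (\<integral>h. iexp (sqrt 2 * t * ((\<Sum>i<n. ?X i h - 1) / sqrt (real n * (sqrt 2)\<^sup>2))) \<partial>?Q)"
      by (simp add: char_def integral_distr)
    also have "\<dots> = (\<integral>h. iexp (\<Sum>i<n. t / sqrt (real n) * (?X i h - 1)) \<partial>?Q)"
    proof -
      have "sqrt 2 * t * ((\<Sum>i<n. ?X i h - 1) / sqrt (real n * (sqrt 2)\<^sup>2))
          = (\<Sum>i<n. t / sqrt (real n) * (?X i h - 1))" for h
        by (simp only: sum_distrib_left[symmetric]) (simp add: real_sqrt_mult)
      then show ?thesis by (simp only:)
    qed
    also have "\<dots> = (\<Prod>i<n. \<integral>h. iexp (t / sqrt (real n) * (?X i h - 1)) \<partial>?Q)"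
    proof (rule expectation_iexp_sum_indep)
      have "indep_vars (\<lambda>_. borel) (\<lambda>i h. h i) {..<n}"
        by (rule indep_vars_subset[OF indep_coordinates_std_normals]) simp
      then show "indep_vars (\<lambda>_. borel) (\<lambda>i h. t / sqrt (real n) * (?X i h - 1)) {..<n}"
        by (rule indep_vars_of_vars[where f="\<lambda>_ x. t / sqrt (real n) * (x\<^sup>2 - 1)"]) simp
    qed simp
    also have "\<dots> = (\<Prod>i<n. ?\<phi> n)"
      by (intro prod.cong refl e[of "\<lambda>x. iexp (t / sqrt (real n) * (x\<^sup>2 - 1))"]) measurable
    finally show ?thesis by simp
  qed
  moreover have "char std_normal_distribution (sqrt 2 * t) = of_real (exp (- t\<^sup>2))"
    by (simp add: char_std_normal_distribution power_mult_distrib)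
  ultimately show ?thesis by simp
qed

lemma (in prob_space) cmod_expectation_iexp_diff_le:
  assumes [measurable]: "A \<in> borel_measurable M" and B: "integrable M B"
  shows "cmod ((\<integral>\<omega>. iexp (A \<omega> + B \<omega>) \<partial>M) - (\<integral>\<omega>. iexp (A \<omega>) \<partial>M)) \<le> (\<integral>\<omega>. \<bar>B \<omega>\<bar> \<partial>M)"
proof -
  have [measurable]: "B \<in> borel_measurable M" using B by simp
  have i1: "integrable M (\<lambda>\<omega>. iexp (A \<omega> + B \<omega>))" by (rule integrable_iexp) auto
  have i2: "integrable M (\<lambda>\<omega>. iexp (A \<omega>))" by (rule integrable_iexp) auto
  have "cmod ((\<integral>\<omega>. iexp (A \<omega> + B \<omega>) \<partial>M) - (\<integral>\<omega>. iexp (A \<omega>) \<partial>M))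
      = cmod (\<integral>\<omega>. iexp (A \<omega> + B \<omega>) - iexp (A \<omega>) \<partial>M)"
    by (subst Bochner_Integration.integral_diff[OF i1 i2]) (rule refl)
  also have "\<dots> \<le> (\<integral>\<omega>. cmod (iexp (A \<omega> + B \<omega>) - iexp (A \<omega>)) \<partial>M)"
    by (rule integral_norm_bound)
  also have "\<dots> \<le> (\<integral>\<omega>. \<bar>B \<omega>\<bar> \<partial>M)"
  proof (rule integral_mono)
    fix \<omega>
    have "iexp (A \<omega> + B \<omega>) - iexp (A \<omega>) = iexp (A \<omega>) * (iexp (B \<omega>) - 1)"
      by (simp add: exp_add[symmetric] algebra_simps)
    also have "cmod \<dots> = cmod (iexp (B \<omega>) - 1)" by (simp add: norm_mult)
    also have "\<dots> \<le> \<bar>B \<omega>\<bar>" using iexp_approx1[of "B \<omega>" 0] by simp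
    finally show "cmod (iexp (A \<omega> + B \<omega>) - iexp (A \<omega>)) \<le> \<bar>B \<omega>\<bar>" .
  qed (use i1 i2 B in auto)
  finally show ?thesis .
qed

lemma expectation_iexp_shift:
  fixes Y :: "'a \<Rightarrow> real"
  assumes "Y \<in> borel_measurable M"
  shows "(\<integral>\<omega>. iexp (s * (Y \<omega> - K)) \<partial>M) = iexp (- s * K) * char (distr M borel Y) s"
proof -
  have "iexp (s * (Y \<omega> - K)) = iexp (- s * K) * iexp (s * Y \<omega>)" for \<omega>
    by (simp add: exp_add[symmetric] algebra_simps)
  then show ?thesis using assms by (simp add: char_def integral_distr)
qed

text \<open>
  With \<open>h\<close> standard normal, \<open>|\<xi>|\<^sup>2\<close> has the law of \<open>|h|\<^sup>2 + \<langle>h, (C - 1) h\<rangle>\<close>. The first summand produces the power of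
  the characteristic function of one centred chi-square variable, the second one only an error that is
  bounded by its first absolute moment.
\<close>

lemma gaussian_family_iexp_centred_square_norm:
  fixes I :: "'i set" and C :: "'i \<Rightarrow> 'i \<Rightarrow> real"
  assumes G: "gaussian_family P I \<xi> C" and sym: "\<And>p q. C p q = C q p"
  shows "cmod ((\<integral>\<omega>. iexp (s * ((\<Sum>p\<in>I. (\<xi> p \<omega>)\<^sup>2) - real (card I))) \<partial>P)
             - (\<integral>x. iexp (s * (x\<^sup>2 - 1)) \<partial>std_normal_distribution) ^ card I)
     \<le> \<bar>s\<bar> * ((\<Sum>p\<in>I. \<bar>C p p - 1\<bar>) + sqrt (2 * (\<Sum>p\<in>I. \<Sum>q\<in>I - {p}. (C p q)\<^sup>2)))"
proof -
  let ?Q = "std_normals I"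
  let ?\<phi> = "\<integral>x. iexp (s * (x\<^sup>2 - 1)) \<partial>std_normal_distribution"
  interpret P: prob_space P using G by (simp add: gaussian_family_def)
  interpret Q: prob_space ?Q by (rule prob_space_std_normals)
  have fin: "finite I" 
    using G by (auto simp: gaussian_family_def)
  note m = measurable_coordinate_std_normals
  define K where "K = real (card I)"
  define Y where "Y \<omega> = (\<Sum>p\<in>I. (\<xi> p \<omega>)\<^sup>2)" for \<omega>
  define Z where "Z h = (\<Sum>p\<in>I. \<Sum>q\<in>I. C p q * h p * h q)" for h
  define E where "E p q = (if p = q then C p q - 1 else C p q)" for p q
  define A where "A h = s * (\<Sum>p\<in>I. (h p)\<^sup>2 - 1)" for h :: "'i \<Rightarrow> real"
  define B where "B h = (\<Sum>p\<in>I. \<Sum>q\<in>I. E p q * h p * h q)" for h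
  have mY: "Y \<in> borel_measurable P"
    unfolding Y_def using G by (intro borel_measurable_sum borel_measurable_power) (simp add: gaussian_family_def)
  have mZ: "Z \<in> borel_measurable ?Q"
    unfolding Z_def by (intro borel_measurable_sum borel_measurable_times borel_measurable_const m)
  have mA: "A \<in> borel_measurable ?Q"
    unfolding A_def by (intro borel_measurable_sum borel_measurable_times borel_measurable_const
        borel_measurable_diff borel_measurable_power m)
  have symE: "E p q = E q p" for p q using sym[of p q] by (auto simp: E_def)
  have iB: "integrable ?Q B"
    unfolding B_def by (rule std_normals_abs_quadratic_form_bound(1)[OF fin symE])
  have EZ: "s * (Z h - K) = A h + s * B h" for h
  proof -
    have "(\<Sum>p\<in>I. \<Sum>q\<in>I. if p = q then 0 else C p q * h p * h q)
        = (\<Sum>p\<in>I. \<Sum>q\<in>I. if p = q then 0 else E p q * h p * h q)"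
      by (intro sum.cong refl) (simp add: E_def)
    moreover have "(\<Sum>p\<in>I. C p p * h p * h p) = (\<Sum>p\<in>I. ((h p)\<^sup>2 - 1) + E p p * h p * h p) + K"
      by (simp add: E_def K_def sum.distrib[symmetric] sum_subtractf algebra_simps power2_eq_square)
    ultimately have "Z h - K = (\<Sum>p\<in>I. (h p)\<^sup>2 - 1) + B h"
      unfolding Z_def B_def
      using sum_split_diagonal[OF fin, of "\<lambda>p q. C p q * h p * h q"]
        sum_split_diagonal[OF fin, of "\<lambda>p q. E p q * h p * h q"]
      by (simp add: sum.distrib)
    then show ?thesis by (simp add: A_def algebra_simps)
  qed
  have c1: "(\<integral>\<omega>. iexp (s * (Y \<omega> - K)) \<partial>P) = iexp (- s * K) * char (distr P borel Y) s"
    by (rule expectation_iexp_shift[where Y=Y, OF mY])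
  have c2: "(\<integral>h. iexp (s * (Z h - K)) \<partial>?Q) = iexp (- s * K) * char (distr ?Q borel Z) s"
    by (rule expectation_iexp_shift[where Y=Z, OF mZ])
  have c3: "char (distr P borel Y) s = char (distr ?Q borel Z) s"
    unfolding Y_def Z_def by (rule gaussian_family_char_square_norm[OF G])
  have 1: "(\<integral>\<omega>. iexp (s * (Y \<omega> - K)) \<partial>P) = (\<integral>h. iexp (A h + s * B h) \<partial>?Q)"
    unfolding c1 c3 c2[symmetric] EZ ..
  have e: "(\<integral>h. iexp (s * ((h p)\<^sup>2 - 1)) \<partial>?Q) = ?\<phi>"
    if p: "p \<in> I" for p
    by (subst distr_coordinate_std_normals[OF p, symmetric], subst integral_distr) (simp_all add: m[OF p])
  have "(\<integral>h. iexp (A h) \<partial>?Q) = (\<integral>h. iexp (\<Sum>p\<in>I. s * ((h p)\<^sup>2 - 1)) \<partial>?Q)"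
    by (simp only: A_def sum_distrib_left)
  also have "\<dots> = (\<Prod>p\<in>I. \<integral>h. iexp (s * ((h p)\<^sup>2 - 1)) \<partial>?Q)"
    by (rule Q.expectation_iexp_sum_indep[OF fin
        Q.indep_vars_of_vars[OF indep_coordinates_std_normals, where f="\<lambda>_ x. s * (x\<^sup>2 - 1)"]]) simp
  also have "\<dots> = ?\<phi> ^ card I"
    using e by simp
  finally have 2: "(\<integral>h. iexp (A h) \<partial>?Q) = ?\<phi> ^ card I" .
  have "cmod ((\<integral>h. iexp (A h + s * B h) \<partial>?Q) - (\<integral>h. iexp (A h) \<partial>?Q)) \<le> (\<integral>h. \<bar>s * B h\<bar> \<partial>?Q)"
    using iB by (intro Q.cmod_expectation_iexp_diff_le mA) simp
  also have "\<dots> = \<bar>s\<bar> * (\<integral>h. \<bar>B h\<bar> \<partial>?Q)" by (simp add: abs_mult)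
  also have "\<dots> \<le> \<bar>s\<bar> * ((\<Sum>p\<in>I. \<bar>E p p\<bar>) + sqrt (2 * (\<Sum>p\<in>I. \<Sum>q\<in>I - {p}. (E p q)\<^sup>2)))"
    unfolding B_def by (intro mult_left_mono std_normals_abs_quadratic_form_bound(2)[OF fin symE]) simp
  finally have 3: "cmod ((\<integral>h. iexp (A h + s * B h) \<partial>?Q) - (\<integral>h. iexp (A h) \<partial>?Q))
    \<le> \<bar>s\<bar> * ((\<Sum>p\<in>I. \<bar>E p p\<bar>) + sqrt (2 * (\<Sum>p\<in>I. \<Sum>q\<in>I - {p}. (E p q)\<^sup>2)))" .
  have 4: "(\<Sum>p\<in>I. \<Sum>q\<in>I - {p}. (E p q)\<^sup>2) = (\<Sum>p\<in>I. \<Sum>q\<in>I - {p}. (C p q)\<^sup>2)"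
    by (intro sum.cong refl) (auto simp: E_def)
  have 5: "(\<Sum>p\<in>I. \<bar>E p p\<bar>) = (\<Sum>p\<in>I. \<bar>C p p - 1\<bar>)"
    by (intro sum.cong refl) (simp add: E_def)
  show ?thesis using 3 unfolding 1[symmetric] 2 4 5 unfolding Y_def K_def .
qed

text \<open>
  The two conditions on \<open>C - 1\<close> control the mean of \<open>\<langle>h, (C - 1) h\<rangle>\<close> and the standard deviation of its off-diagonal part:
  both are small compared with the fluctuations of \<open>|h|\<^sup>2\<close>, whose order is the square root of the dimension.
\<close>

lemma gaussian_families_char_limit:
  fixes I :: "nat \<Rightarrow> 'i set" and C :: "nat \<Rightarrow> 'i \<Rightarrow> 'i \<Rightarrow> real"
  assumes G: "\<forall>\<^sub>F n in sequentially. gaussian_family P (I n) (\<xi> n) (C n)"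
    and sym: "\<And>n p q. C n p q = C n q p"
    and card: "filterlim (\<lambda>n. card (I n)) at_top sequentially"
    and diag: "(\<lambda>n. (\<Sum>p\<in>I n. \<bar>C n p p - 1\<bar>) / sqrt (real (card (I n)))) \<longlonglongrightarrow> 0"
    and off: "(\<lambda>n. (\<Sum>p\<in>I n. \<Sum>q\<in>I n - {p}. (C n p q)\<^sup>2) / real (card (I n))) \<longlonglongrightarrow> 0"
  shows "(\<lambda>n. \<integral>\<omega>. iexp (t / sqrt (real (card (I n))) * ((\<Sum>p\<in>I n. (\<xi> n p \<omega>)\<^sup>2) - real (card (I n)))) \<partial>P)
     \<longlonglongrightarrow> of_real (exp (- t\<^sup>2))"
proof -
  define L where "L n = (\<integral>\<omega>. iexp (t / sqrt (real (card (I n))) * ((\<Sum>p\<in>I n. (\<xi> n p \<omega>)\<^sup>2) - real (card (I n)))) \<partial>P)" for n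
  define R where "R n = (\<integral>x. iexp (t / sqrt (real (card (I n))) * (x\<^sup>2 - 1)) \<partial>std_normal_distribution) ^ card (I n)" for n
  define d where "d n = (\<Sum>p\<in>I n. \<bar>C n p p - 1\<bar>) / sqrt (real (card (I n)))" for n
  define e where "e n = (\<Sum>p\<in>I n. \<Sum>q\<in>I n - {p}. (C n p q)\<^sup>2) / real (card (I n))" for n
  have bound: "\<forall>\<^sub>F n in sequentially. norm (L n - R n) \<le> \<bar>t\<bar> * (d n + sqrt (2 * e n))"
    using G
  proof eventually_elim
    case (elim n)
    have "norm (L n - R n) \<le> \<bar>t / sqrt (real (card (I n)))\<bar> * ((\<Sum>p\<in>I n. \<bar>C n p p - 1\<bar>)
        + sqrt (2 * (\<Sum>p\<in>I n. \<Sum>q\<in>I n - {p}. (C n p q)\<^sup>2)))"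
      unfolding L_def R_def by (rule gaussian_family_iexp_centred_square_norm[OF elim sym])
    also have "\<dots> = \<bar>t\<bar> * (d n + sqrt (2 * e n))"
      by (simp add: d_def e_def real_sqrt_divide real_sqrt_mult abs_divide add_divide_distrib distrib_left)
    finally show ?case .
  qed
  have "(\<lambda>n. \<bar>t\<bar> * (d n + sqrt (2 * e n))) \<longlonglongrightarrow> \<bar>t\<bar> * (0 + sqrt (2 * 0))"
    using diag off unfolding d_def[symmetric] e_def[symmetric] by (intro tendsto_intros)
  then have "(\<lambda>n. L n - R n) \<longlonglongrightarrow> 0"
    by (intro Lim_null_comparison[OF bound]) simp
  moreover have "R \<longlonglongrightarrow> of_real (exp (- t\<^sup>2))"
    unfolding R_def using filterlim_compose[OF chi_square_char_limit card] by simp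
  ultimately have "(\<lambda>n. (L n - R n) + R n) \<longlonglongrightarrow> 0 + of_real (exp (- t\<^sup>2))"
    by (rule tendsto_add)
  then show ?thesis by (simp add: L_def)
qed

section \<open>The sine expansion of the Brownian bridge covariance\<close>

text \<open>
  This is minus the imaginary part of \<open>ln (1 - z)\<close> and its power series at the point \<open>z = r cis s\<close> inside the unit disc.
\<close>

lemma sine_series_abel:
  fixes r s :: real
  assumes r: "0 \<le> r" "r < 1"
  shows "(\<lambda>n. r ^ n * sin (real n * s) / real n) sums (- Im (Ln (1 - of_real r * cis s)))"
proof -
  have "(\<lambda>n. - ((- (- (of_real r * cis s))) ^ n) / of_nat n) sums Ln (1 + - (of_real r * cis s))"
    using r by (intro Ln_series') (simp add: norm_mult)
  then have "(\<lambda>n. Im (- ((of_real r * cis s) ^ n) / of_nat n)) sums Im (Ln (1 - of_real r * cis s))"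
    by (intro sums_Im) simp
  then have "(\<lambda>n. - Im (- ((of_real r * cis s) ^ n) / of_nat n)) sums (- Im (Ln (1 - of_real r * cis s)))"
    by (rule sums_minus)
  moreover have "- Im (- ((of_real r * cis s) ^ n) / of_nat n) = r ^ n * sin (real n * s) / real n" for n
  proof -
    have "(of_real r * cis s) ^ n = of_real (r ^ n) * cis (real n * s)"
      by (simp only: power_mult_distrib Complex.DeMoivre of_real_power)
    then have "Im ((of_real r * cis s) ^ n) = r ^ n * sin (real n * s)" by (simp del: of_real_power)
    then show ?thesis by simp
  qed
  ultimately show ?thesis by (simp only:)
qed

lemma one_minus_cis: "1 - cis s = of_real (2 * sin (s / 2)) * cis ((s - pi) / 2)"
proof -
  have c: "cis ((s - pi) / 2) = Complex (sin (s / 2)) (- cos (s / 2))"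
    by (simp add: complex_eq_iff diff_divide_distrib cos_diff sin_diff)
  have "cos s = 1 - 2 * (sin (s / 2))\<^sup>2" "sin s = 2 * sin (s / 2) * cos (s / 2)"
    using cos_double_sin[of "s / 2"] sin_double[of "s / 2"] by simp_all
  then show ?thesis unfolding c by (simp add: complex_eq_iff power2_eq_square)
qed

lemma Im_Ln_one_minus_cis:
  assumes "0 < s" "s < 2 * pi"
  shows "- Im (Ln (1 - cis s)) = (pi - s) / 2"
proof -
  have pos: "2 * sin (s / 2) > 0" using assms by (simp add: sin_gt_zero)
  have "Ln (1 - cis s) = of_real (ln (2 * sin (s / 2))) + Ln (cis ((s - pi) / 2))"
    unfolding one_minus_cis using Ln_times_of_real[OF pos cis_neq_zero] Ln_of_real[OF pos] by simp
  moreover have "Ln (cis ((s - pi) / 2)) = \<i> * of_real ((s - pi) / 2)"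
    unfolding cis_conv_exp using assms by (subst Ln_exp) auto
  ultimately have "Im (Ln (1 - cis s)) = (s - pi) / 2" by simp
  then show ?thesis by (simp add: field_simps)
qed

text \<open>
  Termwise integration of the sine series at radius \<open>r < 1\<close> gives the cosine series damped by \<open>r\<^sup>n\<close>. As \<open>r\<close> tends to
  \<open>1\<close>, the series converges by uniform convergence and the integral by dominated convergence, the integrand being
  the argument of a complex number, which is bounded by \<open>pi\<close>.
\<close>

lemma cosine_series:
  assumes z: "0 \<le> z" "z \<le> 2 * pi"
  shows "(\<lambda>n. (1 - cos (real n * z)) / (real n)\<^sup>2) sums (pi * z / 2 - z\<^sup>2 / 4)"
proof (cases "z = 2 * pi")
  case True
  have "cos (real n * z) = 1" for n using cos_2npi[of n] by (simp add: True mult_ac)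
  then show ?thesis by (simp add: True power2_eq_square field_simps)
next
  case False
  with z have z2: "z < 2 * pi" by simp
  define f where "f r s = - Im (Ln (1 - of_real r * cis s))" for r s :: real
  define a where "a n = (1 - cos (real n * z)) / (real n)\<^sup>2" for n
  let ?t = "\<lambda>r n s. r ^ n * sin (real n * s) / real n"
  have a0: "0 \<le> a n" for n by (simp add: a_def)
  have abound: "\<bar>a n\<bar> \<le> 2 * (1 / (real n)\<^sup>2)" for n
  proof -
    have "1 - cos (real n * z) \<le> 2" using cos_ge_minus_one[of "real n * z"] by linarith
    then show ?thesis using a0[of n] by (simp add: a_def divide_right_mono)
  qed
  have sum2: "summable (\<lambda>n. 2 * (1 / (real n)\<^sup>2))"
    using inverse_power_summable[of 2, where 'a=real] by (intro summable_mult) (simp add: inverse_eq_divide power_divide)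
  have suma: "summable a"
    by (rule summable_comparison_test'[OF sum2, of 0]) (use abound in simp)
  have int_f: "(f r has_integral (\<Sum>n. r ^ n * a n)) {0..z}" if r: "0 \<le> r" "r < 1" for r
  proof -
    have unif: "uniform_limit {0..z} (\<lambda>k s. \<Sum>n<k. ?t r n s)
        (\<lambda>s. \<Sum>n. ?t r n s) sequentially"
    proof (rule Weierstrass_m_test)
      show "summable (\<lambda>n. r ^ n)" using r by (simp add: summable_geometric)
      show "norm (?t r n s) \<le> r ^ n" for n s
      proof (cases "n = 0")
        case False
        have "\<bar>sin (real n * s)\<bar> / real n \<le> 1" using False order_trans[OF abs_sin_le_one[of "real n * s"], of "real n"] by (simp add: divide_le_eq)
        then show ?thesis using r mult_left_le[of "\<bar>sin (real n * s)\<bar> / real n" "r ^ n"] by (simp add: abs_mult)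
      qed simp
    qed
    have lim: "f r = (\<lambda>s. \<Sum>n. ?t r n s)"
      unfolding f_def using sums_unique[OF sine_series_abel[OF r]] by (intro ext) simp
    have part: "((\<lambda>s. \<Sum>n<k. ?t r n s) has_integral (\<Sum>n<k. r ^ n * a n)) {0..z}" for k
    proof (rule has_integral_sum)
      fix n
      show "((\<lambda>s. ?t r n s) has_integral r ^ n * a n) {0..z}"
      proof (cases "n = 0")
        case False
        have "((\<lambda>s. ?t r n s) has_integral
            (- (r ^ n * cos (real n * z) / (real n)\<^sup>2)) - (- (r ^ n * cos (real n * 0) / (real n)\<^sup>2))) {0..z}"
        proof (rule fundamental_theorem_of_calculus[OF z(1)])
          show "((\<lambda>s. - (r ^ n * cos (real n * s) / (real n)\<^sup>2)) has_vector_derivative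
             ?t r n s) (at s within {0..z})" for s
            unfolding has_real_derivative_iff_has_vector_derivative[symmetric]
            using False by (auto intro!: derivative_eq_intros simp: power2_eq_square)
        qed
        then show ?thesis using False by (simp add: a_def field_simps)
      qed (simp add: a_def)
    qed simp
    have "continuous_on {0..z} (\<lambda>s. ?t r n s)" for n
      by (cases "n = 0") (auto intro!: continuous_intros)
    then have cont: "continuous_on {0..z} (\<lambda>s. \<Sum>n<k. ?t r n s)" for k
      by (intro continuous_on_sum) blast
    obtain I J where IJ: "\<And>k. ((\<lambda>s. \<Sum>n<k. ?t r n s) has_integral I k) {0..z}"
       "((\<lambda>s. \<Sum>n. ?t r n s) has_integral J) {0..z}" "I \<longlonglongrightarrow> J"
      using uniform_limit_integral[OF unif cont] sequentially_bot by blast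
    have "I k = (\<Sum>n<k. r ^ n * a n)" for k by (rule has_integral_unique[OF IJ(1) part])
    then have "I = (\<lambda>k. \<Sum>n<k. r ^ n * a n)" by (rule ext)
    then have "(\<lambda>n. r ^ n * a n) sums J" using IJ(3) by (simp add: sums_def)
    then show ?thesis using IJ(2) lim by (simp add: sums_iff)
  qed
  define \<rho> where "\<rho> k = 1 - 1 / (real k + 2)" for k
  have rho: "0 \<le> \<rho> k" "\<rho> k < 1" for k by (auto simp: \<rho>_def field_simps)
  have rho1: "\<rho> \<longlonglongrightarrow> 1"
  proof -
    have "(\<lambda>k. 1 / (real k + 2)) \<longlonglongrightarrow> 0" by real_asymp
    then have "(\<lambda>k. 1 - 1 / (real k + 2)) \<longlonglongrightarrow> 1 - 0" by (intro tendsto_intros)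
    then show ?thesis by (simp add: \<rho>_def[abs_def])
  qed
  have limL: "(\<lambda>k. \<Sum>n. \<rho> k ^ n * a n) \<longlonglongrightarrow> (\<Sum>n. a n)"
  proof -
    have unif: "uniform_limit {0..1} (\<lambda>k r. \<Sum>n<k. r ^ n * a n) (\<lambda>r. \<Sum>n. r ^ n * a n) sequentially"
      by (rule Weierstrass_m_test[OF _ suma]) (auto simp: abs_mult power_abs a0 intro!: mult_left_le_one_le power_le_one)
    have "continuous_on {0..1} (\<lambda>r. \<Sum>n. r ^ n * a n)"
      by (rule uniform_limit_theorem[OF _ unif]) (auto intro!: always_eventually continuous_intros)
    then have "((\<lambda>k. \<Sum>n. \<rho> k ^ n * a n) \<longlonglongrightarrow> (\<Sum>n. 1 ^ n * a n))"
      by (rule continuous_on_tendsto_compose[OF _ rho1]) (auto intro!: always_eventually less_imp_le rho)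
    then show ?thesis by simp
  qed
  \<comment> \<open>The limit of the integrands is discontinuous at \<open>0\<close>, where all of them vanish.\<close>
  define g where "g s = (if s = 0 then 0 else (pi - s) / 2)" for s :: real
  have limR: "(\<lambda>k. integral {0..z} (f (\<rho> k))) \<longlonglongrightarrow> integral {0..z} g"
  proof (rule dominated_convergence(2))
    show "f (\<rho> k) integrable_on {0..z}" for k using int_f[OF rho[of k]] by blast
    show "(\<lambda>_. pi) integrable_on {0..z}" by (rule integrable_const_ivl)
    show "norm (f (\<rho> k) s) \<le> pi" for k s
    proof -
      have "1 - of_real (\<rho> k) * cis s \<noteq> 0"
      proof
        assume "1 - of_real (\<rho> k) * cis s = 0"
        then have "1 = complex_of_real (\<rho> k) * cis s" by simp
        from arg_cong[OF this, of norm] have "1 = \<rho> k" using rho[of k] by (simp add: norm_mult)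
        then show False using rho[of k] by simp
      qed
      from Im_Ln_le_pi[OF this] mpi_less_Im_Ln[OF this] show ?thesis by (simp add: f_def abs_le_iff)
    qed
    show "(\<lambda>k. f (\<rho> k) s) \<longlonglongrightarrow> g s" if s: "s \<in> {0..z}" for s
    proof (cases "s = 0")
      case True
      have "Im (Ln (1 - of_real (\<rho> k))) = 0" for k
      proof -
        have "1 - complex_of_real (\<rho> k) = of_real (1 - \<rho> k)" by simp
        moreover have "Im (Ln (complex_of_real (1 - \<rho> k))) = 0"
          using rho[of k] by (subst Ln_of_real) (simp_all only: Im_complex_of_real diff_gt_0_iff_gt)
        ultimately show ?thesis by (simp only:)
      qed
      then show ?thesis by (simp add: True f_def g_def)
    next
      case False
      with s z2 have s2: "0 < s" "s < 2 * pi" by auto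
      have "cos s \<noteq> 1"
      proof
        assume "cos s = 1"
        then have "sin (s / 2) = 0" using cos_double_sin[of "s / 2"] by simp
        moreover have "sin (s / 2) > 0" using s2 by (simp add: sin_gt_zero)
        ultimately show False by simp
      qed
      then have "cos s < 1" using cos_le_one[of s] by linarith
      then have nz: "1 - cis s \<notin> \<real>\<^sub>\<le>\<^sub>0" by (auto simp: complex_nonpos_Reals_iff)
      have "(\<lambda>k. - Im (Ln (1 - of_real (\<rho> k) * cis s))) \<longlonglongrightarrow> - Im (Ln (1 - of_real 1 * cis s))"
        using nz by (intro tendsto_intros tendsto_Ln rho1) auto
      then show ?thesis using Im_Ln_one_minus_cis[OF s2] False by (simp add: f_def g_def)
    qed
  qed
  have "((\<lambda>s. (pi - s) / 2) has_integral (pi * z / 2 - z\<^sup>2 / 4) - (pi * 0 / 2 - 0\<^sup>2 / 4)) {0..z}"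
  proof (rule fundamental_theorem_of_calculus[OF z(1)])
    show "((\<lambda>s. pi * s / 2 - s\<^sup>2 / 4) has_vector_derivative (pi - s) / 2) (at s within {0..z})" for s
      unfolding has_real_derivative_iff_has_vector_derivative[symmetric]
      by (auto intro!: derivative_eq_intros simp: field_simps)
  qed
  then have "((\<lambda>s. (pi - s) / 2) has_integral (pi * z / 2 - z\<^sup>2 / 4)) {0..z}" by simp
  then have "(g has_integral (pi * z / 2 - z\<^sup>2 / 4)) {0..z}"
    by (rule has_integral_spike[OF negligible_sing[of 0], rotated 1]) (auto simp: g_def)
  then have "integral {0..z} g = pi * z / 2 - z\<^sup>2 / 4" by (rule integral_unique)
  moreover have "integral {0..z} (f (\<rho> k)) = (\<Sum>n. \<rho> k ^ n * a n)" for k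
    by (rule integral_unique[OF int_f[OF rho]])
  ultimately have "(\<Sum>n. a n) = pi * z / 2 - z\<^sup>2 / 4"
    using LIMSEQ_unique[OF limL] limR by simp
  then show ?thesis using suma by (simp add: a_def[abs_def] sums_iff)
qed

text \<open>
  The Karhunen-Loeve expansion of the Brownian bridge: \<open>2 sin a sin b = cos (a - b) - cos (a + b)\<close> reduces it to two
  cosine series.
\<close>

lemma brownian_bridge_kernel_sums:
  assumes x: "x \<in> {0..1}" and y: "y \<in> {0..1}"
  shows "(\<lambda>n. 2 * sin (pi * real (Suc n) * x) * sin (pi * real (Suc n) * y) / (pi * real (Suc n))\<^sup>2) sums (min x y - x * y)"
proof -
  let ?c = "\<lambda>z n. (1 - cos (real n * z)) / (real n)\<^sup>2"
  let ?d = "pi * \<bar>x - y\<bar>" and ?e = "pi * (x + y)"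
  have 1: "?c ?e sums (pi * ?e / 2 - ?e\<^sup>2 / 4)"
    using x y by (intro cosine_series) auto
  have 2: "?c ?d sums (pi * ?d / 2 - ?d\<^sup>2 / 4)"
    using x y by (intro cosine_series) (auto simp: abs_if)
  have "(\<lambda>n. (?c ?e n - ?c ?d n) / pi\<^sup>2) sums
    (((pi * ?e / 2 - ?e\<^sup>2 / 4) - (pi * ?d / 2 - ?d\<^sup>2 / 4)) / pi\<^sup>2)"
    by (intro sums_divide sums_diff 1 2)
  also have "(\<lambda>n. (?c ?e n - ?c ?d n) / pi\<^sup>2)
    = (\<lambda>n. 2 * sin (pi * real n * x) * sin (pi * real n * y) / (pi * real n)\<^sup>2)"
  proof
    fix n
    have "cos (real n * ?d) = cos (pi * real n * x - pi * real n * y)"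
      using cos_abs_real[of "pi * real n * x - pi * real n * y"]
      by (simp add: abs_mult flip: right_diff_distrib) (simp add: mult_ac)
    moreover have "cos (real n * ?e) = cos (pi * real n * x + pi * real n * y)"
      by (simp add: algebra_simps)
    ultimately show "(?c ?e n - ?c ?d n) / pi\<^sup>2
      = 2 * sin (pi * real n * x) * sin (pi * real n * y) / (pi * real n)\<^sup>2"
      by (simp add: cos_add cos_diff power_mult_distrib diff_divide_distrib[symmetric] mult.commute)
  qed
  also have "((pi * ?e / 2 - ?e\<^sup>2 / 4) - (pi * ?d / 2 - ?d\<^sup>2 / 4)) / pi\<^sup>2
     = min x y - x * y"
    by (auto simp: min_def abs_if power2_eq_square field_simps)
  finally show ?thesis by (subst sums_Suc_iff) simp
qed

section \<open>Covariances of the spatial increments\<close>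

text \<open>
  The eigenvalue with number \<open>n + 1\<close>, divided by \<open>\<vartheta>2\<close>; modes are counted from \<open>0\<close> to fit series over \<open>nat\<close>.
\<close>

definition mode_rate :: "real \<Rightarrow> nat \<Rightarrow> real" where
  "mode_rate \<Gamma> n = pi\<^sup>2 * (real (Suc n))\<^sup>2 + \<Gamma>"

text \<open>
  The increment of an eigenfunction over \<open>[y, y + \<delta>]\<close>, multiplied by the weight \<open>exp (\<kappa> y / 2)\<close>. Only a factor
  \<open>exp (- \<kappa> \<delta> / 2)\<close>, which is \<open>1 + O(\<delta>)\<close>, remains of the exponentials.
\<close>

definition incr_mode :: "real \<Rightarrow> real \<Rightarrow> real \<Rightarrow> nat \<Rightarrow> real" where
  "incr_mode \<kappa> \<delta> y n = sqrt 2 * (exp (- \<kappa> * \<delta> / 2) * sin (pi * real (Suc n) * (y + \<delta>)) - sin (pi * real (Suc n) * y))"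

text \<open>
  The covariance of two weighted spatial increments at points \<open>y\<close>, \<open>z\<close> and time lag \<open>t\<close>, in units of
  \<open>\<delta> \<sigma>\<^sup>2 / (2 \<vartheta>2)\<close>.
\<close>

definition incr_cov :: "real \<Rightarrow> real \<Rightarrow> real \<Rightarrow> real \<Rightarrow> real \<Rightarrow> real \<Rightarrow> real \<Rightarrow> real" where
  "incr_cov \<theta> \<Gamma> \<kappa> \<delta> t y z =
     (\<Sum>n. exp (- \<theta> * mode_rate \<Gamma> n * t) / mode_rate \<Gamma> n * incr_mode \<kappa> \<delta> y n * incr_mode \<kappa> \<delta> z n) / \<delta>"

lemma abs_exp_minus_one_le: "\<bar>exp x - 1\<bar> \<le> \<bar>x\<bar> * exp \<bar>x\<bar>" for x :: real
proof (cases "x \<ge> 0")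
  case True
  have "1 - x \<le> exp (- x)" using exp_ge_add_one_self[of "-x"] by simp
  then have "(1 - x) * exp x \<le> exp (- x) * exp x" by (intro mult_right_mono) auto
  then have "exp x - 1 \<le> x * exp x" by (simp add: exp_minus field_simps)
  with True show ?thesis by simp
next
  case False
  have "1 + x \<le> exp x" by (rule exp_ge_add_one_self)
  moreover have "exp x < 1" using False by simp
  ultimately have "\<bar>exp x - 1\<bar> \<le> \<bar>x\<bar>" using False by linarith
  also have "\<dots> \<le> \<bar>x\<bar> * exp \<bar>x\<bar>" by (simp add: mult_le_cancel_left1)
  finally show ?thesis .
qed

lemma abs_sin_diff_le: "\<bar>sin x - sin y\<bar> \<le> \<bar>x - y\<bar>" for x y :: real
proof -
  have "\<bar>sin x - sin y\<bar> = 2 * \<bar>sin ((x - y) / 2)\<bar> * \<bar>cos ((x + y) / 2)\<bar>"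
    by (simp add: sin_diff_sin abs_mult)
  also have "\<dots> \<le> 2 * \<bar>(x - y) / 2\<bar> * 1"
    using abs_sin_x_le_abs_x[of "(x - y) / 2"] abs_cos_le_one[of "(x + y) / 2"] by (intro mult_mono) auto
  finally show ?thesis by simp
qed

text \<open>
  Positivity of the first rate yields a bound by a multiple of \<open>(n + 1)\<^sup>2\<close> for all of them, also for negative \<open>\<Gamma>\<close>.
\<close>

lemma mode_rate_lower_bound:
  assumes "\<Gamma> + pi\<^sup>2 > 0"
  obtains c where "c > 0" and "\<And>n. c * (real (Suc n))\<^sup>2 \<le> mode_rate \<Gamma> n"
proof
  show "min (pi\<^sup>2) (pi\<^sup>2 + \<Gamma>) > 0" using assms by (simp add: add.commute)
  fix n
  have 1: "1 \<le> (real (Suc n))\<^sup>2" by (rule one_le_power) simp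
  show "min (pi\<^sup>2) (pi\<^sup>2 + \<Gamma>) * (real (Suc n))\<^sup>2 \<le> mode_rate \<Gamma> n"
  proof (cases "\<Gamma> \<ge> 0")
    case True
    then show ?thesis by (simp add: mode_rate_def)
  next
    case False
    then have "\<Gamma> * (real (Suc n))\<^sup>2 \<le> \<Gamma> * 1" using 1 by (intro mult_left_mono_neg) auto
    then show ?thesis using False by (simp add: mode_rate_def distrib_right min_def)
  qed
qed

lemma damping_factor_bound:
  fixes \<kappa> :: real
  obtains B where "B \<ge> 0" and "\<And>\<delta>. 0 < \<delta> \<Longrightarrow> \<delta> \<le> 1 \<Longrightarrow> \<bar>exp (- \<kappa> * \<delta> / 2) - 1\<bar> \<le> B * \<delta>"
proof
  show "\<bar>\<kappa>\<bar> / 2 * exp (\<bar>\<kappa>\<bar> / 2) \<ge> 0" by simp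
  fix \<delta> :: real assume d: "0 < \<delta>" "\<delta> \<le> 1"
  have "\<bar>- \<kappa> * \<delta> / 2\<bar> = \<bar>\<kappa>\<bar> / 2 * \<delta>" using d by (simp add: abs_mult)
  then have "\<bar>exp (- \<kappa> * \<delta> / 2) - 1\<bar> \<le> \<bar>\<kappa>\<bar> / 2 * \<delta> * exp (\<bar>\<kappa>\<bar> / 2 * \<delta>)"
    using abs_exp_minus_one_le[of "- \<kappa> * \<delta> / 2"] by simp
  also have "\<dots> \<le> \<bar>\<kappa>\<bar> / 2 * \<delta> * exp (\<bar>\<kappa>\<bar> / 2)"
    using d mult_left_mono[OF d(2), of "\<bar>\<kappa>\<bar> / 2"] by (intro mult_left_mono) auto
  finally show "\<bar>exp (- \<kappa> * \<delta> / 2) - 1\<bar> \<le> \<bar>\<kappa>\<bar> / 2 * exp (\<bar>\<kappa>\<bar> / 2) * \<delta>" by (simp add: mult_ac)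
qed

lemma incr_mode_bound:
  obtains A where "A \<ge> 0" and "\<And>\<delta> y n. 0 < \<delta> \<Longrightarrow> \<delta> \<le> 1 \<Longrightarrow> \<bar>incr_mode \<kappa> \<delta> y n\<bar> \<le> A * \<delta> * real (Suc n)"
proof -
  obtain B where B: "B \<ge> 0" "\<And>\<delta>. 0 < \<delta> \<Longrightarrow> \<delta> \<le> 1 \<Longrightarrow> \<bar>exp (- \<kappa> * \<delta> / 2) - 1\<bar> \<le> B * \<delta>"
    using damping_factor_bound[of \<kappa>] by blast
  show thesis
  proof (rule that[of "sqrt 2 * (pi + B)"])
    show "sqrt 2 * (pi + B) \<ge> 0" using B by simp
    fix \<delta> y :: real and n :: nat assume d: "0 < \<delta>" "\<delta> \<le> 1"
    let ?a = "exp (- \<kappa> * \<delta> / 2)" and ?u = "sin (pi * real (Suc n) * (y + \<delta>))" and ?v = "sin (pi * real (Suc n) * y)"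
    have "\<bar>?u - ?v\<bar> \<le> \<bar>pi * real (Suc n) * (y + \<delta>) - pi * real (Suc n) * y\<bar>" by (rule abs_sin_diff_le)
    also have "\<dots> = pi * real (Suc n) * \<delta>" using d by (simp add: algebra_simps abs_mult)
    finally have 1: "\<bar>?u - ?v\<bar> \<le> pi * real (Suc n) * \<delta>" .
    have "\<bar>(?a - 1) * ?u\<bar> \<le> (B * \<delta>) * 1"
      unfolding abs_mult using B(2)[OF d] B(1) d by (intro mult_mono abs_sin_le_one) auto
    also have "\<dots> \<le> (B * \<delta>) * real (Suc n)" using B(1) d by (intro mult_left_mono) auto
    finally have 2: "\<bar>(?a - 1) * ?u\<bar> \<le> B * \<delta> * real (Suc n)" .
    have "?a * ?u - ?v = (?u - ?v) + (?a - 1) * ?u" by (simp add: algebra_simps)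
    then have "\<bar>?a * ?u - ?v\<bar> \<le> (pi + B) * \<delta> * real (Suc n)" using 1 2 by (simp add: algebra_simps)
    then show "\<bar>incr_mode \<kappa> \<delta> y n\<bar> \<le> sqrt 2 * (pi + B) * \<delta> * real (Suc n)"
      by (simp add: incr_mode_def abs_mult mult.assoc del: of_nat_Suc)
  qed
qed

lemma incr_mode_bounded:
  shows "\<bar>incr_mode \<kappa> \<delta> y n\<bar> \<le> sqrt 2 * (exp (- \<kappa> * \<delta> / 2) + 1)"
proof -
  have "\<bar>exp (- \<kappa> * \<delta> / 2) * sin (pi * real (Suc n) * (y + \<delta>))\<bar> \<le> exp (- \<kappa> * \<delta> / 2) * 1"
    unfolding abs_mult by (intro mult_mono) auto
  then have "\<bar>exp (- \<kappa> * \<delta> / 2) * sin (pi * real (Suc n) * (y + \<delta>)) - sin (pi * real (Suc n) * y)\<bar> \<le> exp (- \<kappa> * \<delta> / 2) + 1"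
    using abs_sin_le_one[of "pi * real (Suc n) * y"] by linarith
  then show ?thesis by (simp add: incr_mode_def abs_mult del: of_nat_Suc)
qed

lemma summable_inverse_Suc_squares: "summable (\<lambda>n. 1 / (real (Suc n))\<^sup>2)"
  using inverse_power_summable[of 2, where 'a=real]
  by (subst summable_Suc_iff[where f="\<lambda>n. 1 / (real n)\<^sup>2"]) (simp add: inverse_eq_divide power_divide)

lemma incr_cov_summable:
  assumes G: "\<Gamma> + pi\<^sup>2 > 0" and \<theta>: "\<theta> \<ge> 0" and t: "t \<ge> 0"
  shows "summable (\<lambda>n. exp (- \<theta> * mode_rate \<Gamma> n * t) / mode_rate \<Gamma> n * incr_mode \<kappa> \<delta> y n * incr_mode \<kappa> \<delta> z n)"
proof -
  let ?e = "\<lambda>n. exp (- \<theta> * mode_rate \<Gamma> n * t) / mode_rate \<Gamma> n"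
  obtain c where c: "c > 0" "\<And>n. c * (real (Suc n))\<^sup>2 \<le> mode_rate \<Gamma> n"
    using mode_rate_lower_bound[OF G] by blast
  define D where "D = sqrt 2 * (exp (- \<kappa> * \<delta> / 2) + 1)"
  have D0: "D \<ge> 0" by (simp add: D_def)
  show ?thesis
  proof (rule summable_comparison_test'[where N=0])
    show "summable (\<lambda>n. D * D / c * (1 / (real (Suc n))\<^sup>2))"
      by (rule summable_mult[OF summable_inverse_Suc_squares])
    fix n :: nat
    have s: "0 < c * (real (Suc n))\<^sup>2" using c by simp
    have r: "0 < mode_rate \<Gamma> n" using s c(2)[of n] by (rule less_le_trans)
    have "exp (- \<theta> * mode_rate \<Gamma> n * t) \<le> 1" using \<theta> t r by simp
    then have "?e n \<le> 1 / (c * (real (Suc n))\<^sup>2)"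
      using c(2)[of n] s by (intro frac_le) auto
    then have "\<bar>?e n\<bar> \<le> 1 / (c * (real (Suc n))\<^sup>2)" using r by simp
    then have "\<bar>?e n\<bar> * \<bar>incr_mode \<kappa> \<delta> y n\<bar> * \<bar>incr_mode \<kappa> \<delta> z n\<bar>
      \<le> 1 / (c * (real (Suc n))\<^sup>2) * D * D"
      unfolding D_def using s by (intro mult_mono incr_mode_bounded) auto
    then show "norm (?e n * incr_mode \<kappa> \<delta> y n * incr_mode \<kappa> \<delta> z n)
      \<le> D * D / c * (1 / (real (Suc n))\<^sup>2)"
      by (simp only: real_norm_def abs_mult) (simp add: mult_ac)
  qed
qed

lemma incr_cov_commute: "incr_cov \<theta> \<Gamma> \<kappa> \<delta> t y z = incr_cov \<theta> \<Gamma> \<kappa> \<delta> t z y"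
  by (simp add: incr_cov_def mult_ac)

abbreviation bridge :: "real \<Rightarrow> real \<Rightarrow> real" where
  "bridge x y \<equiv> min x y - x * y"

lemma bridge_increment_sums:
  fixes \<kappa> \<delta> y z :: real
  assumes y: "0 \<le> y" "y + \<delta> \<le> 1" and z: "0 \<le> z" "z + \<delta> \<le> 1" and d: "0 \<le> \<delta>"
  defines "a \<equiv> exp (- \<kappa> * \<delta> / 2)"
  shows "(\<lambda>n. incr_mode \<kappa> \<delta> y n * incr_mode \<kappa> \<delta> z n / (pi * real (Suc n))\<^sup>2) sums
    (a\<^sup>2 * bridge (y + \<delta>) (z + \<delta>) - a * bridge (y + \<delta>) z - a * bridge y (z + \<delta>) + bridge y z)"
proof -
  let ?s = "\<lambda>x n. sin (pi * real (Suc n) * x)"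
  let ?k = "\<lambda>x y n. 2 * ?s x n * ?s y n / (pi * real (Suc n))\<^sup>2"
  have "(\<lambda>n. a\<^sup>2 * ?k (y + \<delta>) (z + \<delta>) n - a * ?k (y + \<delta>) z n - a * ?k y (z + \<delta>) n + ?k y z n) sums
    (a\<^sup>2 * bridge (y + \<delta>) (z + \<delta>) - a * bridge (y + \<delta>) z - a * bridge y (z + \<delta>) + bridge y z)"
    using y z d by (intro sums_add sums_diff sums_mult brownian_bridge_kernel_sums) auto
  also have "(\<lambda>n. a\<^sup>2 * ?k (y + \<delta>) (z + \<delta>) n - a * ?k (y + \<delta>) z n - a * ?k y (z + \<delta>) n + ?k y z n)
    = (\<lambda>n. incr_mode \<kappa> \<delta> y n * incr_mode \<kappa> \<delta> z n / (pi * real (Suc n))\<^sup>2)"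
  proof
    fix n
    have expand: "r * (a * p - q) * (r * (a * u - v)) = r\<^sup>2 * (a\<^sup>2 * (p * u) - a * (p * v) - a * (q * u) + q * v)"
      for r p q u v :: real by (simp add: power2_eq_square algebra_simps)
    have "incr_mode \<kappa> \<delta> y n * incr_mode \<kappa> \<delta> z n
      = 2 * (a\<^sup>2 * (?s (y + \<delta>) n * ?s (z + \<delta>) n) - a * (?s (y + \<delta>) n * ?s z n) - a * (?s y n * ?s (z + \<delta>) n) + ?s y n * ?s z n)"
      unfolding incr_mode_def a_def[symmetric] expand by simp
    then show "a\<^sup>2 * ?k (y + \<delta>) (z + \<delta>) n - a * ?k (y + \<delta>) z n - a * ?k y (z + \<delta>) n + ?k y z n
      = incr_mode \<kappa> \<delta> y n * incr_mode \<kappa> \<delta> z n / (pi * real (Suc n))\<^sup>2"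
      by (simp only:) (simp only: diff_divide_distrib add_divide_distrib distrib_left right_diff_distrib times_divide_eq_right mult.assoc mult.left_commute)
  qed
  finally show ?thesis .
qed

text \<open>
  For \<open>a = 1\<close> this is the covariance of Brownian bridge increments, namely \<open>\<delta> - \<delta>\<^sup>2\<close> on one cell and \<open>- \<delta>\<^sup>2\<close> on two disjoint
  cells. For disjoint cells the expression factorises into two terms that are both \<open>O(\<delta>)\<close>.
\<close>

lemma bridge_increment_bound:
  fixes a B \<delta> y z :: real
  assumes y: "0 \<le> y" "y + \<delta> \<le> 1" and z: "0 \<le> z" "z + \<delta> \<le> 1" and d: "0 < \<delta>"
    and a: "\<bar>a - 1\<bar> \<le> B * \<delta>" and sep: "y = z \<or> y + \<delta> \<le> z \<or> z + \<delta> \<le> y"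
  shows "\<bar>a\<^sup>2 * bridge (y + \<delta>) (z + \<delta>) - a * bridge (y + \<delta>) z - a * bridge y (z + \<delta>) + bridge y z
      - (if y = z then \<delta> else 0)\<bar> \<le> 2 * (1 + B)\<^sup>2 * \<delta>\<^sup>2" (is "\<bar>?S y z - _\<bar> \<le> _")
proof -
  have B0: "B * \<delta> \<ge> 0" using a by linarith
  then have B: "B \<ge> 0" using d by (simp add: zero_le_mult_iff)
  let ?r = "(1 + B)\<^sup>2 * \<delta>\<^sup>2"
  have off: "\<bar>?S y z\<bar> \<le> ?r" if "0 \<le> y" "y + \<delta> \<le> 1" "0 \<le> z" "z + \<delta> \<le> 1" "y + \<delta> \<le> z" for y z
  proof -
    have eq: "?S y z = ((a - 1) * (y + \<delta>) + \<delta>) * ((a - 1) * (1 - (z + \<delta>)) - \<delta>)"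
      using that d by (simp add: min_def power2_eq_square algebra_simps)
    have 1: "\<bar>(a - 1) * (y + \<delta>)\<bar> \<le> B * \<delta> * 1" unfolding abs_mult using a that d B0 by (intro mult_mono) auto
    have 2: "\<bar>(a - 1) * (1 - (z + \<delta>))\<bar> \<le> B * \<delta> * 1" unfolding abs_mult using a that d B0 by (intro mult_mono) auto
    have "\<bar>(a - 1) * (y + \<delta>) + \<delta>\<bar> * \<bar>(a - 1) * (1 - (z + \<delta>)) - \<delta>\<bar> \<le> ((1 + B) * \<delta>) * ((1 + B) * \<delta>)"
      using 1 2 d B0 by (intro mult_mono) (auto simp: algebra_simps abs_le_iff)
    then show ?thesis unfolding eq abs_mult by (simp add: power2_eq_square mult_ac)
  qed
  consider (eq) "y = z" | (lt) "y \<noteq> z" "y + \<delta> \<le> z" | (gt) "y \<noteq> z" "z + \<delta> \<le> y" using sep by blast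
  then show ?thesis
  proof cases
    case eq
    have e: "?S y z - \<delta> = - \<delta>\<^sup>2 + (1 - a) * (1 - (y + \<delta>)) * (- 2 * \<delta> + (1 - a) * (y + \<delta>))"
      using d unfolding eq by (simp add: min_def power2_eq_square algebra_simps)
    have "\<bar>(1 - a) * (1 - (y + \<delta>))\<bar> \<le> B * \<delta> * 1" unfolding abs_mult using a y d B0 by (intro mult_mono) auto
    moreover have "\<bar>(1 - a) * (y + \<delta>)\<bar> \<le> B * \<delta> * 1" unfolding abs_mult using a y d B0 by (intro mult_mono) auto
    ultimately have "\<bar>(1 - a) * (1 - (y + \<delta>))\<bar> * \<bar>- 2 * \<delta> + (1 - a) * (y + \<delta>)\<bar> \<le> (B * \<delta>) * (2 * \<delta> + B * \<delta>)"
      using d B0 by (intro mult_mono) auto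
    then have "\<bar>?S y z - \<delta>\<bar> \<le> \<delta>\<^sup>2 + (B * \<delta>) * (2 * \<delta> + B * \<delta>)"
      unfolding e abs_mult[symmetric] by (smt (verit) zero_le_power2)
    also have "\<dots> = (1 + B)\<^sup>2 * \<delta>\<^sup>2" by (simp add: power2_eq_square algebra_simps)
    also have "\<dots> \<le> 2 * (1 + B)\<^sup>2 * \<delta>\<^sup>2" by simp
    finally show ?thesis using eq by simp
  next
    case lt
    have "\<bar>?S y z\<bar> \<le> ?r" by (rule off[OF y z lt(2)])
    also have "\<dots> \<le> 2 * (1 + B)\<^sup>2 * \<delta>\<^sup>2" by simp
    finally show ?thesis using lt by simp
  next
    case gt
    have comm: "bridge u v = bridge v u" for u v :: real by (simp add: min.commute mult.commute)
    have "?S y z = ?S z y"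
      unfolding comm[of "y + \<delta>" "z + \<delta>"] comm[of "y + \<delta>" z] comm[of y "z + \<delta>"] comm[of y z] by simp
    then have "\<bar>?S y z\<bar> \<le> ?r" using off[OF z y gt(2)] by (simp only:)
    also have "\<dots> \<le> 2 * (1 + B)\<^sup>2 * \<delta>\<^sup>2" by simp
    finally show ?thesis using gt by simp
  qed
qed

text \<open>
  Replacing the rate by \<open>(\<pi> (n + 1))\<^sup>2\<close> gives the Brownian bridge, whose increments are almost uncorrelated. The
  error of this replacement is of order \<open>\<delta>\<^sup>2\<close> before division by \<open>\<delta>\<close>, because the difference of the reciprocals decays
  like the fourth power of the mode number.
\<close>

lemma incr_cov_equal_times:
  assumes G: "\<Gamma> + pi\<^sup>2 > 0"
  obtains K where "K \<ge> 0" and "\<And>\<theta> \<delta> y z. \<lbrakk>0 < \<delta>; 0 \<le> y; y + \<delta> \<le> 1; 0 \<le> z; z + \<delta> \<le> 1;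
      y = z \<or> y + \<delta> \<le> z \<or> z + \<delta> \<le> y\<rbrakk> \<Longrightarrow>
      \<bar>incr_cov \<theta> \<Gamma> \<kappa> \<delta> 0 y z - (if y = z then 1 else 0)\<bar> \<le> K * \<delta>"
proof -
  obtain c where c: "c > 0" "\<And>n. c * (real (Suc n))\<^sup>2 \<le> mode_rate \<Gamma> n"
    using mode_rate_lower_bound[OF G] by blast
  obtain A where A: "A \<ge> 0" "\<And>\<delta> y n. 0 < \<delta> \<Longrightarrow> \<delta> \<le> 1 \<Longrightarrow> \<bar>incr_mode \<kappa> \<delta> y n\<bar> \<le> A * \<delta> * real (Suc n)"
    using incr_mode_bound[of \<kappa>] by blast
  obtain B where B: "B \<ge> 0" "\<And>\<delta>. 0 < \<delta> \<Longrightarrow> \<delta> \<le> 1 \<Longrightarrow> \<bar>exp (- \<kappa> * \<delta> / 2) - 1\<bar> \<le> B * \<delta>"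
    using damping_factor_bound[of \<kappa>] by blast
  define Z where "Z = (\<Sum>n. 1 / (real (Suc n))\<^sup>2)"
  define K2 where "K2 = \<bar>\<Gamma>\<bar> * A\<^sup>2 / (pi\<^sup>2 * c) * Z"
  have Z0: "Z \<ge> 0" unfolding Z_def by (intro suminf_nonneg summable_inverse_Suc_squares) simp
  have K20: "K2 \<ge> 0" using Z0 c by (simp add: K2_def)
  show thesis
  proof (rule that[of "2 * (1 + B)\<^sup>2 + K2"])
    show "2 * (1 + B)\<^sup>2 + K2 \<ge> 0" using K20 by simp
    fix \<theta> \<delta> y z :: real
    assume d: "0 < \<delta>" and y: "0 \<le> y" "y + \<delta> \<le> 1" and z: "0 \<le> z" "z + \<delta> \<le> 1"
      and sep: "y = z \<or> y + \<delta> \<le> z \<or> z + \<delta> \<le> y"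
    have d1: "\<delta> \<le> 1" using y by simp
    let ?m = "\<lambda>n. incr_mode \<kappa> \<delta> y n * incr_mode \<kappa> \<delta> z n"
    let ?c = "incr_cov \<theta> \<Gamma> \<kappa> \<delta> 0 y z" and ?r = "\<lambda>n. ?m n / mode_rate \<Gamma> n - ?m n / (pi * real (Suc n))\<^sup>2"
    let ?b = "\<lambda>n. \<bar>\<Gamma>\<bar> * A\<^sup>2 * \<delta>\<^sup>2 / (pi\<^sup>2 * c) * (1 / (real (Suc n))\<^sup>2)"
    define a where "a = exp (- \<kappa> * \<delta> / 2)"
    define S where "S = a\<^sup>2 * bridge (y + \<delta>) (z + \<delta>) - a * bridge (y + \<delta>) z - a * bridge y (z + \<delta>) + bridge y z"
    have main: "(\<lambda>n. ?m n / (pi * real (Suc n))\<^sup>2) sums S"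
      unfolding S_def a_def using d by (intro bridge_increment_sums y z) simp
    have full: "(\<lambda>n. ?m n / mode_rate \<Gamma> n) sums (\<delta> * ?c)"
      using summable_sums[OF incr_cov_summable[OF G, of 0 0 \<kappa> \<delta> y z]] d by (simp add: incr_cov_def)
    have "(\<lambda>n. ?r n) sums (\<delta> * ?c - S)"
      by (rule sums_diff[OF full main])
    then have rem: "\<delta> * ?c - S = (\<Sum>n. ?r n)"
      by (rule sums_unique)
    have bd: "norm (?r n) \<le> ?b n" for n
    proof -
      define l where "l = real (Suc n)"
      have l: "l > 0" by (simp add: l_def)
      have r: "mode_rate \<Gamma> n \<ge> c * l\<^sup>2" using c(2)[of n] by (simp add: l_def)
      have cl: "c * l\<^sup>2 > 0" using c l by simp
      have r0: "mode_rate \<Gamma> n > 0" using r cl by linarith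
      have "?m n / mode_rate \<Gamma> n - ?m n / (pi * l)\<^sup>2 = - ?m n * \<Gamma> / (mode_rate \<Gamma> n * (pi * l)\<^sup>2)"
        using r0 l by (simp add: field_simps) (simp add: mode_rate_def l_def power_mult_distrib algebra_simps)
      then have "norm (?m n / mode_rate \<Gamma> n - ?m n / (pi * l)\<^sup>2) = \<bar>?m n\<bar> * \<bar>\<Gamma>\<bar> / (mode_rate \<Gamma> n * (pi * l)\<^sup>2)"
        using r0 by (simp add: abs_mult)
      also have "\<dots> \<le> (A * \<delta> * l * (A * \<delta> * l)) * \<bar>\<Gamma>\<bar> / ((c * l\<^sup>2) * (pi * l)\<^sup>2)"
        unfolding abs_mult l_def
        using A d d1 cl r l unfolding l_def
        by (intro frac_le mult_right_mono mult_mono) auto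
      also have "\<dots> = \<bar>\<Gamma>\<bar> * A\<^sup>2 * \<delta>\<^sup>2 / (pi\<^sup>2 * c) * (1 / l\<^sup>2)"
        using l c by (simp add: power2_eq_square field_simps)
      finally show ?thesis by (simp only: l_def)
    qed
    have "norm (\<Sum>n. ?r n) \<le> (\<Sum>n. ?b n)"
    proof (rule order_trans[OF summable_norm suminf_le])
      show *: "summable (\<lambda>n. ?b n)"
        by (rule summable_mult[OF summable_inverse_Suc_squares])
      show **: "summable (\<lambda>n. norm (?r n))"
        by (rule summable_comparison_test'[OF *, of 0]) (use bd in simp)
      then show "summable (\<lambda>n. norm (?r n))" .
    qed (rule bd)
    also have "\<dots> = K2 * \<delta>\<^sup>2"
      by (subst suminf_mult[OF summable_inverse_Suc_squares]) (simp add: K2_def Z_def)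
    finally have R: "\<bar>\<delta> * ?c - S\<bar> \<le> K2 * \<delta>\<^sup>2" unfolding rem by simp
    have "\<bar>S - (if y = z then \<delta> else 0)\<bar> \<le> 2 * (1 + B)\<^sup>2 * \<delta>\<^sup>2"
      unfolding S_def by (rule bridge_increment_bound[OF y z d _ sep]) (use B(2)[OF d d1] in \<open>simp add: a_def\<close>)
    with R have "\<bar>\<delta> * ?c - (if y = z then \<delta> else 0)\<bar> \<le> (2 * (1 + B)\<^sup>2 + K2) * \<delta>\<^sup>2"
      by (simp add: distrib_right)
    moreover have "\<delta> * ?c - (if y = z then \<delta> else 0) = \<delta> * (?c - (if y = z then 1 else 0))"
      by (simp add: right_diff_distrib)
    ultimately have "\<delta> * \<bar>?c - (if y = z then 1 else 0)\<bar> \<le> \<delta> * ((2 * (1 + B)\<^sup>2 + K2) * \<delta>)"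
      using d by (simp add: abs_mult power2_eq_square mult_ac)
    then show "\<bar>?c - (if y = z then 1 else 0)\<bar> \<le> (2 * (1 + B)\<^sup>2 + K2) * \<delta>"
      using d by (simp only: mult_le_cancel_left_pos)
  qed
qed

lemma has_integral_cos_cos:
  fixes m n :: nat
  shows "((\<lambda>y. cos (pi * real (Suc n) * y) * cos (pi * real (Suc m) * y)) has_integral (if n = m then 1 / 2 else 0)) {0..1}"
proof -
  define F where "F k y = (if k = 0 then y else sin (pi * of_int k * y) / (pi * of_int k))" for k :: int and y :: real
  have F: "((\<lambda>y. cos (pi * of_int k * y)) has_integral (if k = 0 then 1 else 0)) {0..1}" for k :: int
  proof -
    have "((\<lambda>y. cos (pi * of_int k * y)) has_integral F k 1 - F k 0) {0..1}"
    proof (rule fundamental_theorem_of_calculus)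
      show "(F k has_vector_derivative cos (pi * of_int k * y)) (at y within {0..1})" for y
        unfolding has_real_derivative_iff_has_vector_derivative[symmetric] F_def
        by (cases "k = 0") (auto intro!: derivative_eq_intros)
    qed simp
    moreover have "F k 1 - F k 0 = (if k = 0 then 1 else 0)"
      using sin_int_times_real[of k pi] by (auto simp: F_def mult.commute sin_integer_2pi)
    ultimately show ?thesis by simp
  qed
  have "((\<lambda>y. (cos (pi * of_int (int n - int m) * y) + cos (pi * of_int (int n + int m + 2) * y)) / 2)
     has_integral ((if int n - int m = 0 then 1 else 0) + (if int n + int m + 2 = 0 then 1 else 0)) / 2) {0..1}"
    by (intro has_integral_divide has_integral_add F)
  moreover have "(cos (pi * of_int (int n - int m) * y) + cos (pi * of_int (int n + int m + 2) * y)) / 2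
    = cos (pi * real (Suc n) * y) * cos (pi * real (Suc m) * y)" for y
  proof -
    have "pi * of_int (int n - int m) * y = pi * real (Suc n) * y - pi * real (Suc m) * y"
      "pi * of_int (int n + int m + 2) * y = pi * real (Suc n) * y + pi * real (Suc m) * y"
      by (simp_all add: algebra_simps)
    then show ?thesis by (simp only: cos_times_cos)
  qed
  moreover have "((if int n - int m = 0 then 1 else 0) + (if int n + int m + 2 = 0 then 1 else 0)) / 2 = (if n = m then 1 / 2 else 0 :: real)"
    by auto
  ultimately show ?thesis by simp
qed

text \<open>
  Jensen's inequality: the integral of \<open>(f' - m)\<^sup>2\<close> is nonnegative, where \<open>m\<close> is the mean slope.
\<close>

lemma square_increment_le_integral:
  fixes f f' :: "real \<Rightarrow> real"
  assumes ab: "a < b" and d: "\<And>y. (f has_real_derivative f' y) (at y)" and c: "continuous_on UNIV f'"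
  shows "(f b - f a)\<^sup>2 \<le> (b - a) * integral {a..b} (\<lambda>y. (f' y)\<^sup>2)"
proof -
  define m where "m = (f b - f a) / (b - a)"
  have c': "continuous_on {a..b} f'" using c by (rule continuous_on_subset) simp
  have i2: "(\<lambda>y. (f' y)\<^sup>2) integrable_on {a..b}" using c' by (intro integrable_continuous_real continuous_intros)
  have i1: "(f' has_integral (f b - f a)) {a..b}"
    using ab d by (intro fundamental_theorem_of_calculus)
      (auto simp: has_real_derivative_iff_has_vector_derivative[symmetric] intro: has_field_derivative_at_within)
  have "((\<lambda>y. (f' y)\<^sup>2 - 2 * m * f' y + m\<^sup>2) has_integral
      (integral {a..b} (\<lambda>y. (f' y)\<^sup>2) - 2 * m * (f b - f a) + m\<^sup>2 * (b - a))) {a..b}"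
    using ab by (intro has_integral_add has_integral_diff integrable_integral[OF i2] has_integral_mult_right i1)
      (use has_integral_const_real[of "m\<^sup>2" a b] in \<open>simp add: mult.commute\<close>)
  moreover have "(f' y)\<^sup>2 - 2 * m * f' y + m\<^sup>2 \<ge> 0" for y
    using zero_le_power2[of "f' y - m"] by (simp add: power2_eq_square algebra_simps)
  ultimately have "0 \<le> integral {a..b} (\<lambda>y. (f' y)\<^sup>2) - 2 * m * (f b - f a) + m\<^sup>2 * (b - a)"
    by (rule has_integral_nonneg)
  also have "2 * m * (f b - f a) = 2 * ((f b - f a)\<^sup>2 / (b - a))" by (simp add: m_def power2_eq_square)
  also have "m\<^sup>2 * (b - a) = (f b - f a)\<^sup>2 / (b - a)" using ab by (simp add: m_def power2_eq_square)
  finally have "(f b - f a)\<^sup>2 / (b - a) \<le> integral {a..b} (\<lambda>y. (f' y)\<^sup>2)" by simp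
  then show ?thesis using ab by (simp add: field_simps)
qed

text \<open>
  The inner sum is, up to the damping factor, the increment of \<open>f = \<Sum>\<^sub>n \<alpha>\<^sub>n sqrt 2 sin (\<pi> (n + 1) y)\<close> over a cell.
  Squared increments over disjoint cells sum up to at most \<open>\<delta>\<close> times the integral of \<open>f'\<^sup>2\<close>, which is evaluated by
  the orthogonality of the cosines.
\<close>

lemma incr_mode_bessel:
  obtains K where "K \<ge> 0" and "\<And>\<delta> b M L \<alpha>. \<lbrakk>0 < \<delta>; 0 \<le> b; b + real M * \<delta> \<le> 1\<rbrakk> \<Longrightarrow>
    (\<Sum>k<M. (\<Sum>n<L. \<alpha> n * incr_mode \<kappa> \<delta> (b + real k * \<delta>) n)\<^sup>2) \<le> K * \<delta> * (\<Sum>n<L. (\<alpha> n)\<^sup>2 * (real (Suc n))\<^sup>2)"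
proof -
  obtain B where B: "B \<ge> 0" "\<And>\<delta>. 0 < \<delta> \<Longrightarrow> \<delta> \<le> 1 \<Longrightarrow> \<bar>exp (- \<kappa> * \<delta> / 2) - 1\<bar> \<le> B * \<delta>"
    using damping_factor_bound[of \<kappa>] by blast
  show thesis
  proof (rule that[of "(2 + 2 * B\<^sup>2) * pi\<^sup>2"])
    show "(2 + 2 * B\<^sup>2) * pi\<^sup>2 \<ge> 0" by simp
    fix \<delta> b :: real and M L :: nat and \<alpha> :: "nat \<Rightarrow> real"
    assume d: "0 < \<delta>" and b: "0 \<le> b" "b + real M * \<delta> \<le> 1"
    define f where "f y = (\<Sum>n<L. \<alpha> n * sqrt 2 * sin (pi * real (Suc n) * y))" for y
    define f' where "f' y = (\<Sum>n<L. \<alpha> n * sqrt 2 * (pi * real (Suc n)) * cos (pi * real (Suc n) * y))" for y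
    let ?f2 = "\<lambda>y. (f' y)\<^sup>2"
    define J where "J = (\<Sum>n<L. (\<alpha> n)\<^sup>2 * (pi * real (Suc n))\<^sup>2)"
    define a where "a = exp (- \<kappa> * \<delta> / 2)"
    have deriv: "(f has_real_derivative f' y) (at y)" for y
      unfolding f_def f'_def by (rule DERIV_sum) (auto intro!: derivative_eq_intros)
    have cont: "continuous_on UNIV f'" unfolding f'_def by (intro continuous_intros)
    have cont2: "continuous_on S ?f2" for S
      using continuous_on_subset[OF cont, of S] by (intro continuous_intros) simp
    have int2: "?f2 integrable_on {u..v}" for u v
      by (intro integrable_continuous_real cont2)
    have "(?f2 has_integral J) {0..1}"
    proof -
      let ?w = "\<lambda>n. \<alpha> n * sqrt 2 * (pi * real (Suc n))"
      have "((\<lambda>y. \<Sum>n<L. \<Sum>m<L. ?w n * ?w m * (cos (pi * real (Suc n) * y) * cos (pi * real (Suc m) * y)))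
         has_integral (\<Sum>n<L. \<Sum>m<L. ?w n * ?w m * (if n = m then 1 / 2 else 0))) {0..1}"
        by (intro has_integral_sum has_integral_mult_right has_integral_cos_cos) auto
      moreover have "(\<Sum>n<L. \<Sum>m<L. ?w n * ?w m * (cos (pi * real (Suc n) * y) * cos (pi * real (Suc m) * y))) = (f' y)\<^sup>2" for y
        unfolding f'_def power2_eq_square sum_product by (intro sum.cong refl) (simp add: mult_ac del: of_nat_Suc)
      moreover have "(\<Sum>n<L. \<Sum>m<L. ?w n * ?w m * (if n = m then 1 / 2 else 0)) = J"
        unfolding J_def
      proof (rule sum.cong[OF refl])
        fix n assume n: "n \<in> {..<L}"
        have "(\<Sum>m<L. ?w n * ?w m * (if n = m then 1 / 2 else 0)) = (\<Sum>m<L. if n = m then ?w n * ?w m * (1 / 2) else 0)"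
          by (intro sum.cong refl) simp
        also have "\<dots> = ?w n * ?w n * (1 / 2)" using n by (subst sum.delta') auto
        also have "\<dots> = (\<alpha> n)\<^sup>2 * (pi * real (Suc n))\<^sup>2" by (simp add: power2_eq_square mult_ac del: of_nat_Suc)
        finally show "(\<Sum>m<L. ?w n * ?w m * (if n = m then 1 / 2 else 0)) = (\<alpha> n)\<^sup>2 * (pi * real (Suc n))\<^sup>2" .
      qed
      ultimately show ?thesis by simp
    qed
    then have J: "integral {0..1} ?f2 = J" by (rule integral_unique)
    have J0: "J \<ge> 0" unfolding J_def by (intro sum_nonneg) simp
    have sub: "integral {u..v} ?f2 \<le> J" if "0 \<le> u" "v \<le> 1" for u v
      unfolding J[symmetric] using that by (intro integral_subset_le int2) auto
    have fb: "(f y)\<^sup>2 \<le> J" if y: "0 < y" "y \<le> 1" for y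
    proof -
      have "(f y - f 0)\<^sup>2 \<le> (y - 0) * integral {0..y} ?f2"
        by (rule square_increment_le_integral[OF y(1) deriv cont])
      also have "\<dots> \<le> 1 * J" using y sub[of 0 y] by (intro mult_mono integral_nonneg int2) auto
      finally show ?thesis by (simp add: f_def)
    qed
    let ?y = "\<lambda>k. b + real k * \<delta>"
    let ?J = "\<lambda>k. integral {?y k..?y (Suc k)} ?f2"
    let ?S = "\<lambda>k. \<Sum>n<L. \<alpha> n * incr_mode \<kappa> \<delta> (?y k) n"
    have y: "0 \<le> ?y k" for k using b d by simp
    have yle: "?y k \<le> 1" if "k \<le> M" for k
    proof -
      have "real k * \<delta> \<le> real M * \<delta>" using that d by (intro mult_right_mono) auto
      then show ?thesis using b by linarith
    qed
    have ySuc: "?y k + \<delta> = ?y (Suc k)" for k by (simp add: algebra_simps)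
    have cell: "(?S k)\<^sup>2
      \<le> 2 * (\<delta> * ?J k) + 2 * (B\<^sup>2 * \<delta>\<^sup>2 * J)" if k: "k < M" for k
    proof -
      have d1: "\<delta> \<le> 1" using yle[of "Suc k"] k y[of k] ySuc[of k] by simp
      have "(?S k) = a * f (?y (Suc k)) - f (?y k)"
        unfolding incr_mode_def f_def a_def ySuc sum_distrib_left sum_subtractf[symmetric]
        by (intro sum.cong refl) (simp add: algebra_simps del: of_nat_Suc)
      also have "\<dots> = (f (?y (Suc k)) - f (?y k)) + (a - 1) * f (?y (Suc k))" by (simp add: algebra_simps)
      also have "\<dots>\<^sup>2 \<le> 2 * (f (?y (Suc k)) - f (?y k))\<^sup>2 + 2 * ((a - 1) * f (?y (Suc k)))\<^sup>2"
        using sum_squares_bound[of "f (?y (Suc k)) - f (?y k)" "(a - 1) * f (?y (Suc k))"] by (simp add: power2_sum)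
      finally have 1: "(?S k)\<^sup>2
        \<le> 2 * (f (?y (Suc k)) - f (?y k))\<^sup>2 + 2 * ((a - 1) * f (?y (Suc k)))\<^sup>2" .
      have "(f (?y (Suc k)) - f (?y k))\<^sup>2 \<le> (?y (Suc k) - ?y k) * ?J k"
        using d by (intro square_increment_le_integral deriv cont) (simp add: algebra_simps)
      then have 2: "(f (?y (Suc k)) - f (?y k))\<^sup>2 \<le> \<delta> * ?J k"
        by (simp add: algebra_simps)
      have "\<bar>a - 1\<bar> \<le> \<bar>B * \<delta>\<bar>" using B(2)[OF d d1] B(1) d by (simp add: a_def)
      then have "(a - 1)\<^sup>2 \<le> (B * \<delta>)\<^sup>2" by (simp only: abs_le_square_iff)
      moreover have "0 < ?y (Suc k)" using b d by (simp add: add_nonneg_pos)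
      ultimately have "(a - 1)\<^sup>2 * (f (?y (Suc k)))\<^sup>2 \<le> (B * \<delta>)\<^sup>2 * J"
        using fb[of "?y (Suc k)"] yle[of "Suc k"] k by (intro mult_mono) auto
      then have 3: "((a - 1) * f (?y (Suc k)))\<^sup>2 \<le> B\<^sup>2 * \<delta>\<^sup>2 * J" by (simp only: power_mult_distrib)
      from 1 2 3 show ?thesis by linarith
    qed
    have tele: "(\<Sum>k<m. ?J k) = integral {b..?y m} ?f2" for m
    proof (induction m)
      case (Suc m)
      have "integral {b..?y m} ?f2 + integral {?y m..?y (Suc m)} ?f2 = integral {b..?y (Suc m)} ?f2"
        using d by (intro Henstock_Kurzweil_Integration.integral_combine int2) (auto simp: algebra_simps)
      then show ?case using Suc by simp
    qed simp
    have "(\<Sum>k<M. (?S k)\<^sup>2)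
      \<le> (\<Sum>k<M. 2 * (\<delta> * ?J k) + 2 * (B\<^sup>2 * \<delta>\<^sup>2 * J))"
      using cell by (intro sum_mono) simp
    also have "\<dots> = 2 * \<delta> * integral {b..?y M} ?f2 + 2 * B\<^sup>2 * \<delta> * J * (real M * \<delta>)"
      unfolding tele[symmetric] by (simp add: sum.distrib sum_distrib_left power2_eq_square mult_ac)
    also have "\<dots> \<le> 2 * \<delta> * J + 2 * B\<^sup>2 * \<delta> * J * 1"
      using d b J0 sub[of b "?y M"] by (intro add_mono mult_left_mono) auto
    also have "\<dots> = (2 + 2 * B\<^sup>2) * pi\<^sup>2 * \<delta> * (\<Sum>n<L. (\<alpha> n)\<^sup>2 * (real (Suc n))\<^sup>2)"
    proof -
      have "J = pi\<^sup>2 * (\<Sum>n<L. (\<alpha> n)\<^sup>2 * (real (Suc n))\<^sup>2)"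
        unfolding J_def sum_distrib_left by (intro sum.cong refl) (simp only: power_mult_distrib mult_ac)
      then show ?thesis by (simp add: algebra_simps del: of_nat_Suc)
    qed
    finally show "(\<Sum>k<M. (?S k)\<^sup>2)
      \<le> (2 + 2 * B\<^sup>2) * pi\<^sup>2 * \<delta> * (\<Sum>n<L. (\<alpha> n)\<^sup>2 * (real (Suc n))\<^sup>2)" .
  qed
qed

text \<open>
  Comparison with \<open>1 / (1 + s x\<^sup>2)\<close>, whose primitive is an arcus tangens.
\<close>

lemma gaussian_sum_bound:
  assumes s: "s > 0"
  shows "(\<Sum>n<L. exp (- s * (real (Suc n))\<^sup>2)) \<le> pi / (2 * sqrt s)"
proof -
  have r: "sqrt s > 0" using s by simp
  have step: "exp (- s * (real (Suc n))\<^sup>2) \<le> (arctan (sqrt s * real (Suc n)) - arctan (sqrt s * real n)) / sqrt s" for n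
  proof -
    let ?g = "\<lambda>x. arctan (sqrt s * x)"
    obtain z where z: "real n < z" "z < real (Suc n)"
      and eq: "?g (real (Suc n)) - ?g (real n) = (real (Suc n) - real n) * (sqrt s / (1 + (sqrt s * z)\<^sup>2))"
    proof -
      have "(?g has_real_derivative sqrt s / (1 + (sqrt s * x)\<^sup>2)) (at x)" for x
        by (auto intro!: derivative_eq_intros simp: divide_inverse)
      then have "\<exists>z>real n. z < real (Suc n) \<and>
          ?g (real (Suc n)) - ?g (real n) = (real (Suc n) - real n) * (sqrt s / (1 + (sqrt s * z)\<^sup>2))"
      proof (intro MVT2)
        show "real n < real (Suc n)" by simp
      qed blast
      then show thesis using that by blast
    qed
    have "exp (- s * (real (Suc n))\<^sup>2) \<le> 1 / (1 + s * (real (Suc n))\<^sup>2)"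
    proof -
      have "1 + s * (real (Suc n))\<^sup>2 \<le> exp (s * (real (Suc n))\<^sup>2)" by (rule exp_ge_add_one_self)
      moreover have "1 + s * (real (Suc n))\<^sup>2 > 0" using s by (simp add: add_pos_nonneg)
      ultimately have "1 / exp (s * (real (Suc n))\<^sup>2) \<le> 1 / (1 + s * (real (Suc n))\<^sup>2)" by (intro divide_left_mono) auto
      then show ?thesis by (simp add: exp_minus inverse_eq_divide del: of_nat_Suc)
    qed
    also have "\<dots> \<le> 1 / (1 + (sqrt s * z)\<^sup>2)"
    proof -
      have "z\<^sup>2 \<le> (real (Suc n))\<^sup>2" using z by (intro power_mono) auto
      then have "s * z\<^sup>2 \<le> s * (real (Suc n))\<^sup>2" using s by (intro mult_left_mono) auto
      moreover have "(sqrt s * z)\<^sup>2 = s * z\<^sup>2" using s by (simp add: power_mult_distrib)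
      moreover have "0 \<le> s * z\<^sup>2" using s by simp
      ultimately show ?thesis by (intro divide_left_mono) (auto intro!: mult_pos_pos add_pos_nonneg simp del: of_nat_Suc)
    qed
    also have "\<dots> = (?g (real (Suc n)) - ?g (real n)) / sqrt s" using r eq by simp
    finally show ?thesis .
  qed
  have "(\<Sum>n<L. exp (- s * (real (Suc n))\<^sup>2)) \<le> (\<Sum>n<L. (arctan (sqrt s * real (Suc n)) - arctan (sqrt s * real n)) / sqrt s)"
    by (intro sum_mono step)
  also have "\<dots> = (arctan (sqrt s * real L) - arctan (sqrt s * real 0)) / sqrt s"
    unfolding sum_divide_distrib[symmetric] by (subst sum_lessThan_telescope) (rule refl)
  also have "\<dots> \<le> (pi / 2) / sqrt s"
    using r arctan_ubound[of "sqrt s * real L"] by (intro divide_right_mono) auto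
  finally show ?thesis by simp
qed

text \<open>
  The Bessel inequality is applied in the first spatial index only, with coefficients that contain the mode increment at
  the second point. This gains \<open>sqrt t\<close> over the pointwise estimate of the covariances, which would only give \<open>K / t\<close>
  and thus a logarithm too much after summation over the time lags.
\<close>

lemma incr_cov_different_times:
  assumes G: "\<Gamma> + pi\<^sup>2 > 0" and \<theta>: "\<theta> > 0"
  obtains K where "K \<ge> 0" and "\<And>t \<delta> b M. \<lbrakk>0 < t; 0 < \<delta>; 0 \<le> b; b + real M * \<delta> \<le> 1\<rbrakk> \<Longrightarrow>
    (\<Sum>k<M. \<Sum>m<M. (incr_cov \<theta> \<Gamma> \<kappa> \<delta> t (b + real k * \<delta>) (b + real m * \<delta>))\<^sup>2) \<le> K / sqrt t"
proof -
  obtain c where c: "c > 0" "\<And>n. c * (real (Suc n))\<^sup>2 \<le> mode_rate \<Gamma> n"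
    using mode_rate_lower_bound[OF G] by blast
  obtain A where A: "A \<ge> 0" "\<And>\<delta> y n. 0 < \<delta> \<Longrightarrow> \<delta> \<le> 1 \<Longrightarrow> \<bar>incr_mode \<kappa> \<delta> y n\<bar> \<le> A * \<delta> * real (Suc n)"
    using incr_mode_bound[of \<kappa>] by blast
  obtain B where B: "B \<ge> 0" "\<And>\<delta> b M L \<alpha>. \<lbrakk>0 < \<delta>; 0 \<le> b; b + real M * \<delta> \<le> 1\<rbrakk> \<Longrightarrow>
    (\<Sum>k<M. (\<Sum>n<L. \<alpha> n * incr_mode \<kappa> \<delta> (b + real k * \<delta>) n)\<^sup>2) \<le> B * \<delta> * (\<Sum>n<L. (\<alpha> n)\<^sup>2 * (real (Suc n))\<^sup>2)"
    using incr_mode_bessel[of \<kappa>] by blast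
  define s where "s = 2 * \<theta> * c"
  have s: "s > 0" using \<theta> c by (simp add: s_def)
  define K where "K = B * (A\<^sup>2 / c\<^sup>2) * (pi / (2 * sqrt s))"
  have K0: "K \<ge> 0" using B A s by (simp add: K_def)
  show thesis
  proof (rule that[OF K0])
    fix t \<delta> b :: real and M :: nat
    assume t: "0 < t" and d: "0 < \<delta>" and b: "0 \<le> b" "b + real M * \<delta> \<le> 1"
    let ?y = "\<lambda>k. b + real k * \<delta>"
    let ?e = "\<lambda>n. exp (- \<theta> * mode_rate \<Gamma> n * t) / mode_rate \<Gamma> n"
    let ?C = "\<lambda>k m. incr_cov \<theta> \<Gamma> \<kappa> \<delta> t (?y k) (?y m)"
    have column: "(\<Sum>k<M. (?C k m)\<^sup>2) \<le> K / sqrt t * \<delta>" if m: "m < M" for m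
    proof -
      have "1 * \<delta> \<le> real M * \<delta>" using m d by (intro mult_right_mono) auto
      then have d1: "\<delta> \<le> 1" using b by simp
      define \<alpha> where "\<alpha> n = ?e n * incr_mode \<kappa> \<delta> (?y m) n" for n
      have bound: "(\<alpha> n)\<^sup>2 * (real (Suc n))\<^sup>2 \<le> (A\<^sup>2 / c\<^sup>2) * \<delta>\<^sup>2 * exp (- (s * t) * (real (Suc n))\<^sup>2)" for n
      proof -
        define l where "l = real (Suc n)"
        let ?E = "exp (- (\<theta> * (c * l\<^sup>2) * t))"
        have l: "l > 0" by (simp add: l_def)
        have r: "mode_rate \<Gamma> n \<ge> c * l\<^sup>2" using c(2)[of n] by (simp add: l_def)
        have cl: "c * l\<^sup>2 > 0" using c l by simp
        have "\<theta> * mode_rate \<Gamma> n * t \<ge> \<theta> * (c * l\<^sup>2) * t" using r \<theta> t by (intro mult_right_mono mult_left_mono) auto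
        then have "exp (- \<theta> * mode_rate \<Gamma> n * t) \<le> ?E" by simp
        then have e: "?e n \<le> ?E / (c * l\<^sup>2)" using r cl by (intro frac_le) auto
        have e0: "?e n \<ge> 0" using r cl by simp
        have "\<bar>\<alpha> n\<bar> \<le> (?E / (c * l\<^sup>2)) * (A * \<delta> * l)"
          unfolding \<alpha>_def abs_mult using e e0 A(2)[OF d d1, of "?y m" n] cl unfolding l_def
          by (intro mult_mono) auto
        then have "\<bar>\<alpha> n\<bar> * l \<le> (?E / (c * l\<^sup>2)) * (A * \<delta> * l) * l"
          using l by (intro mult_right_mono) auto
        also have "\<dots> = A / c * \<delta> * ?E" using l c by (simp add: field_simps power2_eq_square)
        finally have "(\<bar>\<alpha> n\<bar> * l)\<^sup>2 \<le> (A / c * \<delta> * ?E)\<^sup>2"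
          using l by (intro power_mono) auto
        also have "\<dots> = (A\<^sup>2 / c\<^sup>2) * \<delta>\<^sup>2 * exp (- (s * t) * l\<^sup>2)"
          by (simp add: power_mult_distrib power_divide exp_double[symmetric] s_def mult_ac)
        finally show ?thesis by (simp add: power_mult_distrib l_def del: of_nat_Suc)
      qed
      have partial: "(\<Sum>k<M. (\<Sum>n<L. \<alpha> n * incr_mode \<kappa> \<delta> (?y k) n)\<^sup>2) \<le> K / sqrt t * \<delta> ^ 3" for L
      proof -
        have "(\<Sum>n<L. (\<alpha> n)\<^sup>2 * (real (Suc n))\<^sup>2) \<le> (\<Sum>n<L. (A\<^sup>2 / c\<^sup>2) * \<delta>\<^sup>2 * exp (- (s * t) * (real (Suc n))\<^sup>2))"
          by (intro sum_mono bound)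
        also have "\<dots> = (A\<^sup>2 / c\<^sup>2) * \<delta>\<^sup>2 * (\<Sum>n<L. exp (- (s * t) * (real (Suc n))\<^sup>2))"
          by (rule sum_distrib_left[symmetric])
        also have "\<dots> \<le> (A\<^sup>2 / c\<^sup>2) * \<delta>\<^sup>2 * (pi / (2 * sqrt (s * t)))"
          using s t by (intro mult_left_mono gaussian_sum_bound) auto
        finally have "B * \<delta> * (\<Sum>n<L. (\<alpha> n)\<^sup>2 * (real (Suc n))\<^sup>2) \<le> B * \<delta> * ((A\<^sup>2 / c\<^sup>2) * \<delta>\<^sup>2 * (pi / (2 * sqrt (s * t))))"
          using B(1) d by (intro mult_left_mono) auto
        also have "\<dots> = K / sqrt t * \<delta> ^ 3"
          by (simp add: K_def real_sqrt_mult power2_eq_square power3_eq_cube field_simps)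
        finally show ?thesis using B(2)[OF d b, where L=L and \<alpha>=\<alpha>] by linarith
      qed
      have lim: "(\<lambda>L. \<Sum>n<L. \<alpha> n * incr_mode \<kappa> \<delta> (?y k) n) \<longlonglongrightarrow> \<delta> * ?C k m" for k
        using summable_LIMSEQ[OF incr_cov_summable[OF G, of \<theta> t \<kappa> \<delta> "?y m" "?y k"]] \<theta> t d
        by (subst incr_cov_commute) (simp add: incr_cov_def \<alpha>_def)
      have "(\<lambda>L. \<Sum>k<M. (\<Sum>n<L. \<alpha> n * incr_mode \<kappa> \<delta> (?y k) n)\<^sup>2) \<longlonglongrightarrow> (\<Sum>k<M. (\<delta> * ?C k m)\<^sup>2)"
        by (intro tendsto_sum tendsto_power lim)
      then have "(\<Sum>k<M. (\<delta> * ?C k m)\<^sup>2) \<le> K / sqrt t * \<delta> ^ 3"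
        by (rule LIMSEQ_le_const2) (use partial in blast)
      then have "\<delta>\<^sup>2 * (\<Sum>k<M. (?C k m)\<^sup>2) \<le> \<delta>\<^sup>2 * (K / sqrt t * \<delta>)"
        by (simp add: power_mult_distrib sum_distrib_left[symmetric] power2_eq_square power3_eq_cube mult_ac)
      then show ?thesis by (rule mult_left_le_imp_le) (use d in simp)
    qed
    have "(\<Sum>k<M. \<Sum>m<M. (?C k m)\<^sup>2) = (\<Sum>m<M. \<Sum>k<M. (?C k m)\<^sup>2)"
      by (rule sum.swap)
    also have "\<dots> \<le> (\<Sum>m<M. K / sqrt t * \<delta>)" using column by (intro sum_mono) simp
    also have "\<dots> = K / sqrt t * (real M * \<delta>)" by simp
    also have "\<dots> \<le> K / sqrt t * 1" using K0 t b d by (intro mult_left_mono) auto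
    finally show "(\<Sum>k<M. \<Sum>m<M. (?C k m)\<^sup>2) \<le> K / sqrt t" by simp
  qed
qed

lemma sum_inverse_sqrt_le: "(\<Sum>j<n. 1 / sqrt (real (Suc j))) \<le> 2 * sqrt (real n)"
proof (induction n)
  case (Suc n)
  let ?x = "sqrt (real n)" and ?y = "sqrt (real (Suc n))"
  have y: "?y > 0" by simp
  have "?y\<^sup>2 = ?x\<^sup>2 + 1" by simp
  moreover have "1 \<le> 2 * (y - x) * y" if "y\<^sup>2 = x\<^sup>2 + 1" for x y :: real
    using that zero_le_power2[of "y - x"] by (simp add: power2_eq_square algebra_simps)
  ultimately have "1 \<le> 2 * (?y - ?x) * ?y" by blast
  then have "1 / ?y \<le> 2 * (?y - ?x)" using y by (simp add: divide_le_eq del: of_nat_Suc)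
  then show ?case using Suc by simp
qed simp

text \<open>
  Summed over the time lags, the singularity \<open>t\<^sup>-\<^sup>1\<^sup>/\<^sup>2\<close> at lag \<open>0\<close> is integrable.
\<close>

lemma sum_inverse_sqrt_distance_le:
  assumes i: "i < N"
  shows "(\<Sum>j\<in>{..<N} - {i}. 1 / sqrt \<bar>real i - real j\<bar>) \<le> 4 * sqrt (real N)"
proof -
  have "(\<Sum>j\<in>{..<N} - {i}. 1 / sqrt \<bar>real i - real j\<bar>)
      = (\<Sum>j\<in>{..<i}. 1 / sqrt \<bar>real i - real j\<bar>) + (\<Sum>j\<in>{Suc i..<N}. 1 / sqrt \<bar>real i - real j\<bar>)"
    using i by (subst sum.union_disjoint[symmetric]) (auto intro!: sum.cong)
  also have "(\<Sum>j\<in>{..<i}. 1 / sqrt \<bar>real i - real j\<bar>) = (\<Sum>j<i. 1 / sqrt (real (Suc j)))"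
    by (rule sum.reindex_bij_witness[where i="\<lambda>j. i - Suc j" and j="\<lambda>j. i - Suc j"]) (auto simp: of_nat_diff)
  also have "(\<Sum>j\<in>{Suc i..<N}. 1 / sqrt \<bar>real i - real j\<bar>) = (\<Sum>j<N - Suc i. 1 / sqrt (real (Suc j)))"
    by (rule sum.reindex_bij_witness[where i="\<lambda>j. j + Suc i" and j="\<lambda>j. j - Suc i"]) (auto simp: of_nat_diff)
  also have "(\<Sum>j<i. 1 / sqrt (real (Suc j))) + (\<Sum>j<N - Suc i. 1 / sqrt (real (Suc j))) \<le> 2 * sqrt (real i) + 2 * sqrt (real (N - Suc i))"
    by (intro add_mono sum_inverse_sqrt_le)
  also have "\<dots> \<le> 2 * sqrt (real N) + 2 * sqrt (real N)" using i by (intro add_mono) auto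
  finally show ?thesis by simp
qed

definition grid_cov ::
  "real \<Rightarrow> real \<Rightarrow> real \<Rightarrow> real \<Rightarrow> real \<Rightarrow> nat \<Rightarrow> nat \<Rightarrow> nat \<times> nat \<Rightarrow> nat \<times> nat \<Rightarrow> real" where
  "grid_cov \<theta> \<Gamma> \<kappa> T b M N p q = incr_cov \<theta> \<Gamma> \<kappa> (grid_mesh b M)
     \<bar>grid_time T N (fst p) - grid_time T N (fst q)\<bar> (grid_space b M (snd p)) (grid_space b M (snd q))"

lemma grid_cov_commute: "grid_cov \<theta> \<Gamma> \<kappa> T b M N p q = grid_cov \<theta> \<Gamma> \<kappa> T b M N q p"
  unfolding grid_cov_def by (subst incr_cov_commute) (simp add: abs_minus_commute)

text \<open>
  Equal times contribute at most \<open>(K \<delta>)\<^sup>2\<close> for each of the \<open>N M\<^sup>2\<close> pairs, that is \<open>O(N)\<close>. Different times contribute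
  \<open>\<Sum> K (N / |i - j|)\<^sup>1\<^sup>/\<^sup>2\<close> over \<open>i \<noteq> j\<close>, that is \<open>O(N\<^sup>2)\<close>.
\<close>

lemma grid_cov_bounds:
  assumes G: "\<Gamma> + pi\<^sup>2 > 0" and \<theta>: "\<theta> > 0" and T: "T > 0" and b: "0 \<le> b" "b < 1 / 2"
  obtains K where "K \<ge> 0"
    and "\<And>M N. M \<ge> 1 \<Longrightarrow> N \<ge> 1 \<Longrightarrow>
      (\<Sum>p\<in>{..<N} \<times> {..<M}. \<bar>grid_cov \<theta> \<Gamma> \<kappa> T b M N p p - 1\<bar>) \<le> K * real N"
    and "\<And>M N. M \<ge> 1 \<Longrightarrow> N \<ge> 1 \<Longrightarrow>
      (\<Sum>p\<in>{..<N} \<times> {..<M}. \<Sum>q\<in>({..<N} \<times> {..<M}) - {p}. (grid_cov \<theta> \<Gamma> \<kappa> T b M N p q)\<^sup>2) \<le> K * (real N + (real N)\<^sup>2)"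
proof -
  obtain K1 where K1: "K1 \<ge> 0" "\<And>\<theta> \<delta> y z. \<lbrakk>0 < \<delta>; 0 \<le> y; y + \<delta> \<le> 1; 0 \<le> z; z + \<delta> \<le> 1;
      y = z \<or> y + \<delta> \<le> z \<or> z + \<delta> \<le> y\<rbrakk> \<Longrightarrow> \<bar>incr_cov \<theta> \<Gamma> \<kappa> \<delta> 0 y z - (if y = z then 1 else 0)\<bar> \<le> K1 * \<delta>"
    using incr_cov_equal_times[OF G, of \<kappa>] by blast
  obtain K2 where K2: "K2 \<ge> 0" "\<And>t \<delta> b M. \<lbrakk>0 < t; 0 < \<delta>; 0 \<le> b; b + real M * \<delta> \<le> 1\<rbrakk> \<Longrightarrow>
    (\<Sum>k<M. \<Sum>m<M. (incr_cov \<theta> \<Gamma> \<kappa> \<delta> t (b + real k * \<delta>) (b + real m * \<delta>))\<^sup>2) \<le> K2 / sqrt t"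
    using incr_cov_different_times[OF G \<theta>, of \<kappa>] by blast
  define K where "K = K1 + K1\<^sup>2 + 4 * K2 / sqrt T"
  have K2T: "K2 / sqrt T \<ge> 0" using K2(1) T by simp
  have K0: "K \<ge> 0" using K1 K2T by (simp add: K_def)
  have K1K: "K1 \<le> K" using K2T by (simp add: K_def)
  show thesis
  proof (rule that[OF K0])
    fix M N :: nat assume M: "M \<ge> 1" and N: "N \<ge> 1"
    let ?C = "grid_cov \<theta> \<Gamma> \<kappa> T b M N" and ?I = "{..<N} \<times> {..<M}"
    define \<delta> where "\<delta> = grid_mesh b M"
    have d: "\<delta> > 0" using b M by (simp add: \<delta>_def grid_mesh_def)
    have Md: "real M * \<delta> = 1 - 2 * b" using M by (simp add: \<delta>_def grid_mesh_def)
    have Md1: "real M * \<delta> \<le> 1" using Md b by simp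
    let ?y = "grid_space b M"
    have y: "?y k = b + real k * \<delta>" for k by (simp add: grid_space_def \<delta>_def)
    have y0: "?y k \<ge> 0" for k using b d by (simp add: y)
    have kd: "real k * \<delta> + \<delta> \<le> real m * \<delta>" if "k < m" for k m
      using that d mult_right_mono[of "real (Suc k)" "real m" \<delta>] by (simp add: algebra_simps)
    have y1: "?y k + \<delta> \<le> 1" if "k < M" for k
      using kd[OF that] Md b by (simp add: y)
    have sep: "?y k = ?y m \<or> ?y k + \<delta> \<le> ?y m \<or> ?y m + \<delta> \<le> ?y k" for k m
      using kd[of k m] kd[of m k] by (cases k m rule: linorder_cases) (auto simp: y)
    have inj: "?y k = ?y m \<longleftrightarrow> k = m" for k m using d by (simp add: y)
    have same: "\<bar>?C (i, k) (i, m) - (if k = m then 1 else 0)\<bar> \<le> K1 * \<delta>" if "k < M" "m < M" for i k m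
      using K1(2)[OF d y0 y1[OF that(1)] y0 y1[OF that(2)] sep, of \<theta>] by (simp add: grid_cov_def inj \<delta>_def)
    have diag: "\<bar>?C p p - 1\<bar> \<le> K1 * \<delta>" if "p \<in> ?I" for p
      using same[of "snd p" "snd p" "fst p"] that by auto
    have "(\<Sum>p\<in>?I. \<bar>?C p p - 1\<bar>) \<le> (\<Sum>p\<in>?I. K1 * \<delta>)"
      by (intro sum_mono diag)
    also have "\<dots> = K1 * real N * (real M * \<delta>)" by (simp add: card_cartesian_product)
    also have "\<dots> \<le> K1 * real N * 1" using K1 Md1 by (intro mult_left_mono) auto
    also have "\<dots> \<le> K * real N" using K1K by (simp add: mult_right_mono)
    finally show "(\<Sum>p\<in>?I. \<bar>?C p p - 1\<bar>) \<le> K * real N" .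
    define f where "f i j = (\<Sum>k<M. \<Sum>m<M. if (i, k) = (j, m) then 0 else (?C (i, k) (j, m))\<^sup>2)" for i j
    have f_eq: "f i i \<le> K1\<^sup>2" for i
    proof -
      have "f i i \<le> (\<Sum>k<M. \<Sum>m<M. (K1 * \<delta>)\<^sup>2)"
        unfolding f_def
      proof (intro sum_mono)
        fix k m assume "k \<in> {..<M}" "m \<in> {..<M}"
        then show "(if (i, k) = (i, m) then 0 else (?C (i, k) (i, m))\<^sup>2) \<le> (K1 * \<delta>)\<^sup>2"
          using same[of k m i] K1(1) d by (auto intro: power2_le_iff_abs_le[THEN iffD2])
      qed
      also have "\<dots> = K1\<^sup>2 * (real M * \<delta>)\<^sup>2" by (simp add: power2_eq_square)
      also have "\<dots> \<le> K1\<^sup>2 * 1" using Md1 d by (intro mult_left_mono power_le_one) auto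
      finally show ?thesis by simp
    qed
    have f_ne: "f i j \<le> K2 / sqrt T * sqrt (real N) * (1 / sqrt \<bar>real i - real j\<bar>)" if ij: "i \<noteq> j" for i j
    proof -
      have t: "\<bar>grid_time T N i - grid_time T N j\<bar> = \<bar>real i - real j\<bar> * (T / real N)"
      proof -
        have "grid_time T N i - grid_time T N j = (real i - real j) * (T / real N)"
          by (simp add: grid_time_def left_diff_distrib diff_divide_distrib)
        then show ?thesis using T by (simp only: abs_mult) simp
      qed
      have t0: "\<bar>grid_time T N i - grid_time T N j\<bar> > 0" unfolding t using ij T N by simp
      have "f i j = (\<Sum>k<M. \<Sum>m<M. (incr_cov \<theta> \<Gamma> \<kappa> \<delta> \<bar>grid_time T N i - grid_time T N j\<bar> (b + real k * \<delta>) (b + real m * \<delta>))\<^sup>2)"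
        unfolding f_def using ij by (simp add: grid_cov_def y \<delta>_def)
      also have "\<dots> \<le> K2 / sqrt \<bar>grid_time T N i - grid_time T N j\<bar>"
        using Md b by (intro K2(2) t0 d) auto
      also have "\<dots> = K2 / sqrt T * sqrt (real N) * (1 / sqrt \<bar>real i - real j\<bar>)"
        unfolding t by (simp add: real_sqrt_mult real_sqrt_divide)
      finally show ?thesis .
    qed
    have row: "(\<Sum>j<N. f i j) \<le> K1\<^sup>2 + 4 * K2 / sqrt T * real N" if i: "i < N" for i
    proof -
      have "(\<Sum>j<N. f i j) = f i i + (\<Sum>j\<in>{..<N} - {i}. f i j)" using i by (intro sum.remove) auto
      also have "(\<Sum>j\<in>{..<N} - {i}. f i j) \<le> (\<Sum>j\<in>{..<N} - {i}. K2 / sqrt T * sqrt (real N) * (1 / sqrt \<bar>real i - real j\<bar>))"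
        by (intro sum_mono f_ne) auto
      also have "\<dots> = K2 / sqrt T * sqrt (real N) * (\<Sum>j\<in>{..<N} - {i}. 1 / sqrt \<bar>real i - real j\<bar>)"
        by (rule sum_distrib_left[symmetric])
      also have "\<dots> \<le> K2 / sqrt T * sqrt (real N) * (4 * sqrt (real N))"
        using K2T by (intro mult_left_mono sum_inverse_sqrt_distance_le i mult_nonneg_nonneg) auto
      also have "\<dots> = 4 * K2 / sqrt T * real N" by simp
      finally show ?thesis using f_eq[of i] by linarith
    qed
    have "(\<Sum>p\<in>?I. \<Sum>q\<in>?I - {p}. (?C p q)\<^sup>2)
      = (\<Sum>p\<in>?I. \<Sum>q\<in>?I. if p = q then 0 else (?C p q)\<^sup>2)"
      by (rule sum_off_diagonal[symmetric]) simp
    also have "\<dots> = (\<Sum>i<N. \<Sum>k<M. \<Sum>j<N. \<Sum>m<M. if (i, k) = (j, m) then 0 else (?C (i, k) (j, m))\<^sup>2)"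
      unfolding sum.cartesian_product' ..
    also have "\<dots> = (\<Sum>i<N. \<Sum>j<N. f i j)"
      unfolding f_def by (intro sum.cong refl sum.swap)
    also have "\<dots> \<le> (\<Sum>i<N. K1\<^sup>2 + 4 * K2 / sqrt T * real N)" using row by (intro sum_mono) auto
    also have "\<dots> = K1\<^sup>2 * real N + 4 * K2 / sqrt T * (real N)\<^sup>2" by (simp add: algebra_simps power2_eq_square)
    also have "\<dots> \<le> K * real N + K * (real N)\<^sup>2"
      using K1 K2T by (intro add_mono mult_right_mono) (auto simp: K_def)
    finally show "(\<Sum>p\<in>?I. \<Sum>q\<in>?I - {p}. (?C p q)\<^sup>2) \<le> K * (real N + (real N)\<^sup>2)"
      by (simp add: distrib_left)
  qed
qed

section \<open>Stationary Ornstein-Uhlenbeck families\<close>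

text \<open>
  The Wiener integral of \<open>exp (a s)\<close> as a pathwise limit: by summation by parts, the Riemann sum differs from the
  increment of \<open>exp (a s) u s\<close> by cell integrals whose integrand is small by uniform continuity.
\<close>

lemma ou_path_limit:
  fixes u B :: "real \<Rightarrow> real"
  assumes cont: "continuous_on {0..} u" and t: "t > 0"
    and eq: "\<And>t. t \<ge> 0 \<Longrightarrow> u t = u 0 - a * integral {0..t} u + \<sigma> * B t"
  shows "(\<lambda>n. \<Sum>j<n. exp (a * (real j * (t / real n))) * (\<sigma> * (B (real (Suc j) * (t / real n)) - B (real j * (t / real n)))))
     \<longlonglongrightarrow> exp (a * t) * u t - u 0"
proof (rule LIMSEQ_I)
  let ?T = "\<lambda>n. \<Sum>j<n. exp (a * (real j * (t / real n))) * (\<sigma> * (B (real (Suc j) * (t / real n)) - B (real j * (t / real n))))"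
  fix r :: real assume r: "r > 0"
  define e where "e = r / 2 / (\<bar>a\<bar> * t + 1)"
  have at: "\<bar>a\<bar> * t + 1 > 0" using t by (simp add: add_nonneg_pos)
  have e: "e > 0" using r at by (simp add: e_def)
  have cu: "continuous_on {0..t} u" using cont by (rule continuous_on_subset) auto
  have "continuous_on ({0..t} \<times> {0..t}) (\<lambda>z. exp (a * fst z) * u (snd z))"
    by (intro continuous_intros continuous_on_compose2[OF cu]) auto
  then have "uniformly_continuous_on ({0..t} \<times> {0..t}) (\<lambda>z. exp (a * fst z) * u (snd z))"
    by (rule compact_uniformly_continuous) (intro compact_Times compact_Icc)
  then obtain d where d: "d > 0" and unif: "\<And>x y. x \<in> {0..t} \<times> {0..t} \<Longrightarrow> y \<in> {0..t} \<times> {0..t} \<Longrightarrow> dist y x < d \<Longrightarrow>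
     dist (exp (a * fst y) * u (snd y)) (exp (a * fst x) * u (snd x)) < e"
    using e unfolding uniformly_continuous_on_def by metis
  obtain n0 :: nat where n0: "2 * t / d < real n0" using reals_Archimedean2 by blast
  have "norm (?T n
     - (exp (a * t) * u t - u 0)) < r" if n: "n \<ge> Suc n0" for n
  proof -
    define h where "h = t / real n"
    have npos: "real n > 0" using n by simp
    have h: "h > 0" using t npos by (simp add: h_def)
    have nh: "real n * h = t" using npos by (simp add: h_def)
    have h2: "2 * h < d"
    proof -
      have "2 * t / d < real n" using n0 n by linarith
      then show ?thesis using d npos by (simp add: h_def field_simps)
    qed
    define s where "s j = real j * h" for j :: nat
    have sle: "s j \<le> t" if "j \<le> n" for j
      using that h mult_right_mono[of "real j" "real n" h] by (simp add: s_def nh)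
    have s0: "s j \<ge> 0" for j using h by (simp add: s_def)
    have sS: "s (Suc j) = s j + h" for j by (simp add: s_def algebra_simps)
    let ?n = "\<lambda>j. exp (a * s j) * (\<sigma> * (B (s (Suc j)) - B (s j)))" and ?i = "\<lambda>j. integral {s j..s (Suc j)} u"
    let ?g = "\<lambda>j. exp (a * s (Suc j)) * u (s (Suc j)) - exp (a * s j) * u (s j)"
    \<comment> \<open>The equation turns the Brownian increment into the increment of \<open>u\<close> plus an integral of \<open>u\<close> over the cell.\<close>
    have cell: "\<bar>?g j - ?n j\<bar>
        \<le> \<bar>a\<bar> * e * h" if j: "j < n" for j
    proof -
      have cj: "continuous_on {s j..s (Suc j)} u" using cu
        by (rule continuous_on_subset) (use s0[of j] sle[of "Suc j"] j in auto)
      have iu: "(u has_integral ?i j) {s j..s (Suc j)}"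
        by (intro integrable_integral integrable_continuous_real cj)
      have "integral {0..s j} u + ?i j = integral {0..s (Suc j)} u"
        using s0[of j] sS[of j] h
        by (intro Henstock_Kurzweil_Integration.integral_combine integrable_continuous_real continuous_on_subset[OF cont]) auto
      then have du: "\<sigma> * (B (s (Suc j)) - B (s j)) = u (s (Suc j)) - u (s j) + a * ?i j"
      proof -
        have add: "integral {0..s (Suc j)} u = integral {0..s j} u + ?i j"
          using \<open>integral {0..s j} u + ?i j = integral {0..s (Suc j)} u\<close> by simp
        show ?thesis using eq[OF s0[of j]] eq[OF s0[of "Suc j"]] unfolding add by (simp add: algebra_simps)
      qed
      have ie: "((\<lambda>x. a * exp (a * x)) has_integral (exp (a * s (Suc j)) - exp (a * s j))) {s j..s (Suc j)}"
        using h sS[of j]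
        by (intro fundamental_theorem_of_calculus)
          (auto intro!: derivative_eq_intros simp: has_real_derivative_iff_has_vector_derivative[symmetric])
      have "((\<lambda>x. a * exp (a * x) * u (s (Suc j)) - a * exp (a * s j) * u x) has_integral
          ((exp (a * s (Suc j)) - exp (a * s j)) * u (s (Suc j)) - a * exp (a * s j) * ?i j)) {s j..s (Suc j)}"
        by (intro has_integral_diff has_integral_mult_left ie has_integral_mult_right iu)
      note hi = this
      have "norm ((exp (a * s (Suc j)) - exp (a * s j)) * u (s (Suc j)) - a * exp (a * s j) * ?i j)
          \<le> (\<bar>a\<bar> * e) * measure lborel {s j..s (Suc j)}"
      proof (rule has_integral_bound_real[OF _ _ hi, where S="{}"])
        fix x assume "x \<in> {s j..s (Suc j)} - {}"
        then have x: "x \<in> {s j..s (Suc j)}" by simp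
        have "dist (x, s (Suc j)) (s j, x) \<le> \<bar>x - s j\<bar> + \<bar>s (Suc j) - x\<bar>"
          unfolding dist_Pair_Pair dist_real_def by (rule sqrt_sum_squares_le_sum_abs[THEN order_trans]) simp
        also have "\<dots> < d" using x sS[of j] h2 h by auto
        finally have "dist (exp (a * x) * u (s (Suc j))) (exp (a * s j) * u x) < e"
          using unif[of "(s j, x)" "(x, s (Suc j))"] x s0[of j] s0[of "Suc j"] sle[of "Suc j"] sle[of j] j by auto
        then have "\<bar>a\<bar> * \<bar>exp (a * x) * u (s (Suc j)) - exp (a * s j) * u x\<bar> \<le> \<bar>a\<bar> * e"
          by (intro mult_left_mono) (auto simp: dist_real_def)
        then show "norm (a * exp (a * x) * u (s (Suc j)) - a * exp (a * s j) * u x) \<le> \<bar>a\<bar> * e"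
          unfolding abs_mult[symmetric] by (simp add: right_diff_distrib mult.assoc)
      qed (use e in simp_all)
      moreover have "measure lborel {s j..s (Suc j)} = h" using sS[of j] h by simp
      moreover have "?g j - ?n j
        = (exp (a * s (Suc j)) - exp (a * s j)) * u (s (Suc j)) - a * exp (a * s j) * ?i j"
        unfolding du by (simp add: algebra_simps)
      ultimately show ?thesis by simp
    qed
    have "exp (a * t) * u t - u 0 = exp (a * s n) * u (s n) - exp (a * s 0) * u (s 0)"
      by (simp add: s_def nh)
    also have "\<dots> = (\<Sum>j<n. ?g j)"
      by (rule sum_lessThan_telescope[symmetric])
    finally have "norm ((\<Sum>j<n. ?n j) - (exp (a * t) * u t - u 0))
      = \<bar>\<Sum>j<n. ?g j - ?n j\<bar>"
      by (simp add: sum_subtractf abs_minus_commute)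
    also have "\<dots> \<le> (\<Sum>j<n. \<bar>a\<bar> * e * h)"
      by (rule order_trans[OF sum_abs sum_mono]) (use cell in simp)
    also have "\<dots> = \<bar>a\<bar> * t * e" by (simp add: nh[symmetric])
    also have "\<dots> \<le> (\<bar>a\<bar> * t + 1) * e" using e by (intro mult_right_mono) auto
    also have "\<dots> = r / 2"
    proof -
      have "K * (r / 2 / K) = r / 2" if "K > 0" for K :: real using that by simp
      from this[OF at] show ?thesis by (simp only: e_def)
    qed
    also have "\<dots> < r" using r by simp
    finally show ?thesis by (simp only: s_def h_def)
  qed
  then show "\<exists>no. \<forall>n\<ge>no. norm (?T n
     - (exp (a * t) * u t - u 0)) < r" by blast
qed

lemma (in prob_space) expectation_iexp_normal:
  assumes X: "distributed M lborel X (normal_density 0 s)" and s: "s > 0"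
  shows "(\<integral>\<omega>. iexp (c * X \<omega>) \<partial>M) = of_real (exp (- (c\<^sup>2 * s\<^sup>2) / 2))"
proof -
  have m: "X \<in> borel_measurable M" using distributed_measurable[OF X] by simp
  have D: "distributed M lborel (\<lambda>x. X x / s) std_normal_density"
    using X s normal_standard_normal_convert[of s X 0] by simp
  have "distr M borel (\<lambda>x. X x / s) = distr M lborel (\<lambda>x. X x / s)" by (intro distr_cong) auto
  also have "\<dots> = std_normal_distribution" using distributed_distr_eq_density[OF D] by simp
  finally have "char (distr M borel (\<lambda>x. X x / s)) (c * s) = of_real (exp (- (c * s)\<^sup>2 / 2))"
    by (simp add: char_std_normal_distribution)
  moreover have "char (distr M borel (\<lambda>x. X x / s)) (c * s) = (\<integral>\<omega>. iexp (c * X \<omega>) \<partial>M)"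
    using m s by (simp add: char_def integral_distr)
  ultimately show ?thesis by (simp add: power_mult_distrib)
qed

lemma exponential_riemann_sum_limit:
  fixes a t :: real
  assumes a: "a > 0" and \<Delta>: "\<Delta> > 0"
  shows "(\<lambda>m. \<Sum>j<k * m. exp (a * (real j * (\<Delta> / real m))) * (\<Delta> / real m)) \<longlonglongrightarrow> (exp (a * (real k * \<Delta>)) - 1) / a"
proof -
  let ?S = "\<lambda>m. \<Sum>j<k * m. exp (a * (real j * (\<Delta> / real m))) * (\<Delta> / real m)" and ?E = "exp (a * (real k * \<Delta>))"
  have ev: "\<forall>\<^sub>F m in sequentially. (?E - 1) * ((\<Delta> / real m) / (exp (a * (\<Delta> / real m)) - 1))
    = ?S m"
  proof (rule eventually_sequentiallyI[of 1])
    fix m :: nat assume m: "1 \<le> m"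
    let ?q = "exp (a * (\<Delta> / real m))"
    have q: "?q \<noteq> 1" using a \<Delta> m by simp
    have "?S m = (\<Sum>j<k * m. ?q ^ j) * (\<Delta> / real m)"
      unfolding sum_distrib_right by (intro sum.cong refl) (simp add: exp_of_nat_mult[symmetric] mult_ac)
    also have "(\<Sum>j<k * m. ?q ^ j) = (?q ^ (k * m) - 1) / (?q - 1)" by (rule geometric_sum[OF q])
    also have "?q ^ (k * m) = ?E"
      using m by (simp add: exp_of_nat_mult[symmetric])
    finally show "(?E - 1) * ((\<Delta> / real m) / (?q - 1)) = ?S m"
      by simp
  qed
  have "((\<lambda>h. h / (exp (a * h) - 1)) \<longlongrightarrow> inverse a) (at_right 0)" using a by real_asymp
  then have "((\<lambda>h. h / (exp (a * h) - 1)) \<longlongrightarrow> 1 / a) (at_right 0)" by (simp add: inverse_eq_divide)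
  moreover have "filterlim (\<lambda>m. \<Delta> / real m) (at_right 0) sequentially" using \<Delta> by real_asymp
  ultimately have "(\<lambda>m. (\<Delta> / real m) / (exp (a * (\<Delta> / real m)) - 1)) \<longlonglongrightarrow> 1 / a"
    by (rule filterlim_compose)
  then have "(\<lambda>m. (?E - 1) * ((\<Delta> / real m) / (exp (a * (\<Delta> / real m)) - 1))) \<longlonglongrightarrow> (?E - 1) * (1 / a)"
    by (rule tendsto_mult[OF tendsto_const])
  then show ?thesis using tendsto_cong[OF ev] by simp
qed

lemma (in prob_space) expectation_iexp_gaussian_limit:
  fixes S :: "nat \<Rightarrow> 'a \<Rightarrow> real"
  assumes [measurable]: "\<And>n. S n \<in> borel_measurable M" "L \<in> borel_measurable M"
    and lim: "AE \<omega> in M. (\<lambda>n. S n \<omega>) \<longlonglongrightarrow> L \<omega>" and V: "V \<longlonglongrightarrow> v"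
    and char: "\<And>n. (\<integral>\<omega>. iexp (S n \<omega>) \<partial>M) = of_real (exp (- V n / 2))"
  shows "(\<integral>\<omega>. iexp (L \<omega>) \<partial>M) = of_real (exp (- v / 2))"
proof (rule LIMSEQ_unique)
  show "(\<lambda>n. \<integral>\<omega>. iexp (S n \<omega>) \<partial>M) \<longlonglongrightarrow> (\<integral>\<omega>. iexp (L \<omega>) \<partial>M)"
  proof (rule integral_dominated_convergence[where w="\<lambda>_. 1"])
    show "AE \<omega> in M. (\<lambda>n. iexp (S n \<omega>)) \<longlonglongrightarrow> iexp (L \<omega>)"
      using lim by eventually_elim (intro tendsto_intros)
  qed simp_all
  show "(\<lambda>n. \<integral>\<omega>. iexp (S n \<omega>) \<partial>M) \<longlonglongrightarrow> of_real (exp (- v / 2))"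
    unfolding char using V by (intro tendsto_of_real tendsto_exp tendsto_divide tendsto_minus tendsto_const) simp_all
qed

text \<open>
  The coefficient processes of the spectral expansion, with an arbitrary sequence of rates.
\<close>

locale stationary_ou_family = prob_space M for M :: "'a measure" +
  fixes a :: "nat \<Rightarrow> real" and \<sigma> :: real
    and \<beta> u :: "nat \<Rightarrow> real \<Rightarrow> 'a \<Rightarrow> real"
  assumes rate_pos: "\<And>l. l \<ge> 1 \<Longrightarrow> a l > 0" and sigma: "\<sigma>\<^sup>2 > 0"
    and brownian: "\<And>l. l \<ge> 1 \<Longrightarrow> brownian_motion M (\<beta> l)"
    and drivers: "indep_drivers M \<beta> (\<lambda>l. u l 0)"
    and initial: "\<And>l. l \<ge> 1 \<Longrightarrow> distributed M lborel (u l 0) (normal_density 0 (sqrt (\<sigma>\<^sup>2 / (2 * a l))))"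
    and sde: "\<And>l. l \<ge> 1 \<Longrightarrow> solves_ou_sde M (a l) \<sigma> (\<beta> l) (u l)"
begin

lemma measurable_drivers:
  assumes "l \<ge> 1"
  shows "t \<ge> 0 \<Longrightarrow> \<beta> l t \<in> borel_measurable M" and "t \<ge> 0 \<Longrightarrow> u l t \<in> borel_measurable M"
  using brownian[OF assms] sde[OF assms] by (auto simp: brownian_motion_def solves_ou_sde_def)

text \<open>
  Each of these variables is measurable with respect to one of the \<open>\<sigma>\<close>-algebras that are assumed to be independent.
\<close>

lemma indep_driver_functionals:
  fixes \<tau> :: "nat \<Rightarrow> real" and w :: "nat \<Rightarrow> nat \<Rightarrow> real" and c :: "nat \<Rightarrow> real"
  assumes A: "A \<subseteq> {1..}" and \<tau>: "\<And>j. \<tau> j \<ge> 0"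
  shows "indep_vars (\<lambda>_. borel)
    (case_sum (\<lambda>l \<omega>. \<Sum>j<J. w l j * (\<beta> l (\<tau> (Suc j)) \<omega> - \<beta> l (\<tau> j) \<omega>)) (\<lambda>l \<omega>. c l * u l 0 \<omega>)) (A <+> A)"
proof -
  let ?F = "case_sum
          (\<lambda>l. sets (vimage_algebra (space M) (\<lambda>\<omega>. \<lambda>t\<in>{0..}. \<beta> l t \<omega>) (\<Pi>\<^sub>M t\<in>{0::real..}. (borel :: real measure))))
          (\<lambda>l. sets (vimage_algebra (space M) (u l 0) borel))"
  let ?Y = "case_sum (\<lambda>l \<omega>. \<Sum>j<J. w l j * (\<beta> l (\<tau> (Suc j)) \<omega> - \<beta> l (\<tau> j) \<omega>)) (\<lambda>l \<omega>. c l * u l 0 \<omega>)"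
  have F: "indep_sets ?F ({1..} <+> {1..})" using drivers by (simp add: indep_drivers_def)
  have meas: "?Y i \<in> borel_measurable M" if "i \<in> A <+> A" for i
  proof -
    have "Suc 0 \<le> l" if "l \<in> A" for l using A that by auto
    then show ?thesis
      using that \<tau> by (auto intro!: borel_measurable_sum borel_measurable_times borel_measurable_diff measurable_drivers)
  qed
  have sub: "{?Y i -` S \<inter> space M |S. S \<in> sets borel} \<subseteq> ?F i" if i: "i \<in> A <+> A" for i
  proof (cases i)
    case (Inl l)
    let ?path = "\<lambda>\<omega>. \<lambda>t\<in>{0..}. \<beta> l t \<omega>"
    let ?N = "\<Pi>\<^sub>M t\<in>{0::real..}. (borel :: real measure)"
    have p: "?path \<in> measurable (vimage_algebra (space M) ?path ?N) ?N"
      by (rule measurable_vimage_algebra1) (auto simp: space_PiM)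
    have "(\<lambda>x. \<Sum>j<J. w l j * (x (\<tau> (Suc j)) - x (\<tau> j))) \<in> borel_measurable ?N"
      using \<tau> by (intro borel_measurable_sum borel_measurable_times borel_measurable_diff borel_measurable_const
          measurable_component_singleton) auto
    from measurable_compose[OF p this]
    have "(\<lambda>\<omega>. \<Sum>j<J. w l j * (\<beta> l (\<tau> (Suc j)) \<omega> - \<beta> l (\<tau> j) \<omega>)) \<in> borel_measurable (vimage_algebra (space M) ?path ?N)"
      using \<tau> by simp
    from measurable_sets[OF this] show ?thesis unfolding Inl by auto
  next
    case (Inr l)
    have "u l 0 \<in> borel_measurable (vimage_algebra (space M) (u l 0) borel)"
      by (rule measurable_vimage_algebra1) auto
    then have "(\<lambda>\<omega>. c l * u l 0 \<omega>) \<in> borel_measurable (vimage_algebra (space M) (u l 0) borel)"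
      by (intro borel_measurable_times borel_measurable_const)
    from measurable_sets[OF this] show ?thesis unfolding Inr by auto
  qed
  have "indep_sets (\<lambda>i. {?Y i -` S \<inter> space M |S. S \<in> sets borel}) (A <+> A)"
    by (rule indep_sets_mono[OF F]) (use A sub in auto)
  then show ?thesis unfolding indep_vars_def2 using meas by blast
qed

lemma expectation_iexp_increments:
  fixes \<tau> :: "nat \<Rightarrow> real"
  assumes l: "l \<ge> 1" and \<tau>: "\<tau> 0 \<ge> 0" "\<And>j. \<tau> j < \<tau> (Suc j)"
  shows "(\<integral>\<omega>. iexp (\<Sum>j<J. w j * (\<beta> l (\<tau> (Suc j)) \<omega> - \<beta> l (\<tau> j) \<omega>)) \<partial>M)
    = of_real (exp (- (\<Sum>j<J. (w j)\<^sup>2 * (\<tau> (Suc j) - \<tau> j)) / 2))"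
proof -
  let ?v = "\<lambda>j. (w j)\<^sup>2 * (\<tau> (Suc j) - \<tau> j)"
  let ?d = "\<lambda>j \<omega>. \<beta> l (\<tau> (Suc j)) \<omega> - \<beta> l (\<tau> j) \<omega>"
  have t0: "\<tau> j \<ge> 0" for j by (induction j) (use \<tau> in \<open>auto intro: order_trans less_imp_le\<close>)
  note B = brownian[OF l, unfolded brownian_motion_def]
  have ind: "indep_vars (\<lambda>_. borel) (\<lambda>j \<omega>. ?d j \<omega>) {..<J}"
    using B \<tau> by blast
  have N: "distributed M lborel (\<lambda>\<omega>. ?d j \<omega>) (normal_density 0 (sqrt (\<tau> (Suc j) - \<tau> j)))" for j
    using B \<tau>(2)[of j] t0[of j] by blast
  have "(\<integral>\<omega>. iexp (\<Sum>j<J. w j * ?d j \<omega>) \<partial>M)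
    = (\<Prod>j<J. \<integral>\<omega>. iexp (w j * ?d j \<omega>) \<partial>M)"
    by (rule expectation_iexp_sum_indep[OF _ indep_vars_of_vars[OF ind, where f="\<lambda>j x. w j * x"]]) simp_all
  also have "\<dots> = (\<Prod>j<J. of_real (exp (- (?v j) / 2)))"
  proof (rule prod.cong[OF refl])
    fix j
    show "(\<integral>\<omega>. iexp (w j * ?d j \<omega>) \<partial>M) = of_real (exp (- (?v j) / 2))"
      using expectation_iexp_normal[OF N[of j], of "w j"] \<tau>(2)[of j] by simp
  qed
  also have "\<dots> = of_real (exp (- (\<Sum>j<J. ?v j) / 2))"
    by (simp add: exp_sum[symmetric] sum_negf sum_divide_distrib flip: of_real_prod)
  finally show ?thesis .
qed

text \<open>
  Independence splits the expectation twice: across the drivers, and across the increments of one Brownian motion.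
\<close>

lemma expectation_iexp_drivers:
  fixes \<tau> :: "nat \<Rightarrow> real"
  assumes A: "finite A" "A \<subseteq> {1..}" and \<tau>: "\<tau> 0 \<ge> 0" "\<And>j. \<tau> j < \<tau> (Suc j)"
  shows "(\<integral>\<omega>. iexp (\<Sum>l\<in>A. c l * u l 0 \<omega> + (\<Sum>j<J. w l j * (\<beta> l (\<tau> (Suc j)) \<omega> - \<beta> l (\<tau> j) \<omega>))) \<partial>M)
    = of_real (exp (- (\<Sum>l\<in>A. (c l)\<^sup>2 * (\<sigma>\<^sup>2 / (2 * a l)) + (\<Sum>j<J. (w l j)\<^sup>2 * (\<tau> (Suc j) - \<tau> j))) / 2))"
proof -
  have t0: "\<tau> j \<ge> 0" for j by (induction j) (use \<tau> in \<open>auto intro: order_trans less_imp_le\<close>)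
  let ?D = "\<lambda>l \<omega>. \<Sum>j<J. w l j * (\<beta> l (\<tau> (Suc j)) \<omega> - \<beta> l (\<tau> j) \<omega>)"
  let ?p = "\<lambda>l. (c l)\<^sup>2 * (\<sigma>\<^sup>2 / (2 * a l))" and ?q = "\<lambda>l. \<Sum>j<J. (w l j)\<^sup>2 * (\<tau> (Suc j) - \<tau> j)"
  let ?Y = "case_sum ?D (\<lambda>l \<omega>. c l * u l 0 \<omega>)"
  have "(\<integral>\<omega>. iexp (\<Sum>i\<in>A <+> A. ?Y i \<omega>) \<partial>M) = (\<Prod>i\<in>A <+> A. \<integral>\<omega>. iexp (?Y i \<omega>) \<partial>M)"
    by (rule expectation_iexp_sum_indep[OF _ indep_driver_functionals[OF A(2) t0]]) (use A in simp)
  moreover have "(\<Sum>i\<in>A <+> A. ?Y i \<omega>) = (\<Sum>l\<in>A. c l * u l 0 \<omega> + ?D l \<omega>)" for \<omega>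
    using A by (subst sum.Plus) (simp_all add: sum.distrib)
  moreover have "(\<Prod>i\<in>A <+> A. \<integral>\<omega>. iexp (?Y i \<omega>) \<partial>M)
    = (\<Prod>l\<in>A. \<integral>\<omega>. iexp (?D l \<omega>) \<partial>M) * (\<Prod>l\<in>A. \<integral>\<omega>. iexp (c l * u l 0 \<omega>) \<partial>M)"
    using A by (subst prod.Plus) simp_all
  moreover have "(\<Prod>l\<in>A. \<integral>\<omega>. iexp (?D l \<omega>) \<partial>M) = (\<Prod>l\<in>A. of_real (exp (- ?q l / 2)))"
    using A by (intro prod.cong refl expectation_iexp_increments \<tau>) auto
  moreover have "(\<Prod>l\<in>A. \<integral>\<omega>. iexp (c l * u l 0 \<omega>) \<partial>M) = (\<Prod>l\<in>A. of_real (exp (- ?p l / 2)))"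
  proof (rule prod.cong[OF refl])
    fix l assume "l \<in> A"
    then have l: "l \<ge> 1" using A by auto
    have v: "\<sigma>\<^sup>2 / (2 * a l) > 0" using rate_pos[OF l] sigma by simp
    show "(\<integral>\<omega>. iexp (c l * u l 0 \<omega>) \<partial>M) = of_real (exp (- ?p l / 2))"
      using expectation_iexp_normal[OF initial[OF l], of "c l"] v by (simp only: real_sqrt_gt_zero real_sqrt_pow2 less_imp_le)
  qed
  moreover have "(\<Prod>l\<in>A. complex_of_real (exp (- ?q l / 2))) * (\<Prod>l\<in>A. of_real (exp (- ?p l / 2)))
    = of_real (exp (- (\<Sum>l\<in>A. ?p l + ?q l) / 2))"
  proof -
    have e: "exp x * exp y = exp (y + x)" for x y :: real by (simp add: exp_add mult.commute)
    have "(\<Prod>l\<in>A. exp (- ?q l / 2)) * (\<Prod>l\<in>A. exp (- ?p l / 2))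
      = exp (\<Sum>l\<in>A. - ?p l / 2 + - ?q l / 2)"
      unfolding prod.distrib[symmetric] e exp_sum[OF A(1)] ..
    also have "(\<Sum>l\<in>A. - ?p l / 2 + - ?q l / 2)
      = - (\<Sum>l\<in>A. ?p l + ?q l) / 2"
    proof -
      have "(\<Sum>l\<in>A. - p l / 2 + - q l / 2) = - (\<Sum>l\<in>A. p l + q l) / 2" for p q :: "nat \<Rightarrow> real"
        using A(1) by (induction A rule: finite_induct) (simp_all add: field_simps)
      then show ?thesis .
    qed
    finally show ?thesis by (simp only: of_real_prod[symmetric] of_real_mult[symmetric])
  qed
  ultimately show ?thesis by (simp only:)
qed

lemma ou_discretisation:
  assumes l: "l \<ge> 1" and \<Delta>: "\<Delta> > 0"
  shows "AE \<omega> in M. \<forall>i::nat. (\<lambda>m. \<Sum>j<i * m. exp (a l * (real j * (\<Delta> / real m))) *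
      (\<sigma> * (\<beta> l (real (Suc j) * (\<Delta> / real m)) \<omega> - \<beta> l (real j * (\<Delta> / real m)) \<omega>)))
    \<longlonglongrightarrow> exp (a l * (real i * \<Delta>)) * u l (real i * \<Delta>) \<omega> - u l 0 \<omega>"
proof -
  have "AE \<omega> in M. continuous_on {0..} (\<lambda>t. u l t \<omega>) \<and>
        (\<forall>t\<ge>0. u l t \<omega> = u l 0 \<omega> - a l * integral {0..t} (\<lambda>s. u l s \<omega>) + \<sigma> * \<beta> l t \<omega>)"
    using sde[OF l] by (simp add: solves_ou_sde_def)
  then show ?thesis
  proof eventually_elim
    case (elim \<omega>)
    let ?L = "\<lambda>i. exp (a l * (real i * \<Delta>)) * u l (real i * \<Delta>) \<omega> - u l 0 \<omega>"
    show ?case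
    proof
      fix i :: nat
      show "(\<lambda>m. \<Sum>j<i * m. exp (a l * (real j * (\<Delta> / real m))) *
        (\<sigma> * (\<beta> l (real (Suc j) * (\<Delta> / real m)) \<omega> - \<beta> l (real j * (\<Delta> / real m)) \<omega>)))
        \<longlonglongrightarrow> ?L i"
      proof (cases "i = 0")
        case False
        let ?f = "\<lambda>n. \<Sum>j<n. exp (a l * (real j * (real i * \<Delta> / real n))) *
          (\<sigma> * (\<beta> l (real (Suc j) * (real i * \<Delta> / real n)) \<omega> - \<beta> l (real j * (real i * \<Delta> / real n)) \<omega>))"
        have "?f \<longlonglongrightarrow> ?L i"
        proof (rule ou_path_limit[where u="\<lambda>t. u l t \<omega>" and B="\<lambda>t. \<beta> l t \<omega>" and t="real i * \<Delta>"])
          show "0 < real i * \<Delta>" using False \<Delta> by simp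
        qed (use elim in blast)+
        moreover have "filterlim (\<lambda>m. i * m) at_top sequentially"
          using False by (intro filterlim_subseq) (auto simp: strict_mono_def)
        ultimately have "(\<lambda>m. ?f (i * m)) \<longlonglongrightarrow> ?L i"
          by (rule filterlim_compose)
        moreover have "real i * \<Delta> / real (i * m) = \<Delta> / real m" for m using False by simp
        ultimately show ?thesis by (simp only:)
      qed simp
    qed
  qed
qed

text \<open>
  The covariance of the discretised processes at the times \<open>i \<Delta>\<close> and \<open>k \<Delta>\<close>. Two Wiener integrals share the cells below
  the smaller end point, which brings in \<open>min i k\<close>. The stationary initial variance cancels the lower boundary term of the
  limit integral, and the remaining exponents combine to the absolute time difference.
\<close>

lemma discretised_covariance_limit:
  fixes i k N :: nat and \<alpha> \<Delta> s :: real
  assumes \<alpha>: "\<alpha> > 0" and \<Delta>: "\<Delta> > 0" and ik: "i \<le> N" "k \<le> N"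
  defines "D \<equiv> \<lambda>m i j. if j < i * m then s * exp (\<alpha> * (real j * (\<Delta> / real m)) - \<alpha> * (real i * \<Delta>)) else 0"
  shows "(\<lambda>m. exp (- \<alpha> * (real i * \<Delta>)) * exp (- \<alpha> * (real k * \<Delta>)) * (s\<^sup>2 / (2 * \<alpha>)) + (\<Sum>j<N * m. D m i j * D m k j * (\<Delta> / real m)))
    \<longlonglongrightarrow> s\<^sup>2 / (2 * \<alpha>) * exp (- \<alpha> * \<bar>real i * \<Delta> - real k * \<Delta>\<bar>)"
proof -
  define E where "E = exp (- \<alpha> * (real i * \<Delta>)) * exp (- \<alpha> * (real k * \<Delta>))"
  let ?e = "\<lambda>m j. exp (2 * \<alpha> * (real j * (\<Delta> / real m))) * (\<Delta> / real m)" and ?M = "exp (2 * \<alpha> * (real (min i k) * \<Delta>))"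
  have sum: "(\<Sum>j<N * m. D m i j * D m k j * (\<Delta> / real m)) = E * s\<^sup>2 * (\<Sum>j<min i k * m. ?e m j)" for m
  proof -
    have "(\<Sum>j<N * m. D m i j * D m k j * (\<Delta> / real m)) = (\<Sum>j<min i k * m. E * s\<^sup>2 * ?e m j)"
    proof (rule sum.mono_neutral_cong_right)
      have iff: "j < min i k * m \<longleftrightarrow> j < i * m \<and> j < k * m" for j
        by (cases "i \<le> k") (auto simp: min_def intro: less_le_trans mult_le_mono1)
      show "{..<min i k * m} \<subseteq> {..<N * m}" using ik mult_le_mono1[of "min i k" N m] by auto
      show "\<forall>j\<in>{..<N * m} - {..<min i k * m}. D m i j * D m k j * (\<Delta> / real m) = 0"
      proof
        fix j assume "j \<in> {..<N * m} - {..<min i k * m}"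
        then have "\<not> (j < i * m \<and> j < k * m)" by (auto simp flip: iff)
        then show "D m i j * D m k j * (\<Delta> / real m) = 0" by (auto simp: D_def)
      qed
      show "D m i j * D m k j * (\<Delta> / real m) = E * s\<^sup>2 * ?e m j" if "j \<in> {..<min i k * m}" for j
      proof -
        have exps: "exp (\<alpha> * x - \<alpha> * y) * exp (\<alpha> * x - \<alpha> * z) = exp (- \<alpha> * y) * exp (- \<alpha> * z) * exp (2 * \<alpha> * x)" for x y z
          unfolding exp_add[symmetric] by (rule arg_cong[where f=exp]) (simp add: algebra_simps)
        have alg: "s * x * (s * y) * h = x * y * s\<^sup>2 * h" for x y h :: real by (simp add: power2_eq_square)
        have "j < i * m" "j < k * m" using that iff[of j] by auto
        then have "D m i j * D m k j * (\<Delta> / real m) = E * exp (2 * \<alpha> * (real j * (\<Delta> / real m))) * s\<^sup>2 * (\<Delta> / real m)"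
          unfolding D_def E_def by (simp only: if_True alg exps)
        then show ?thesis by (simp only: mult_ac)
      qed
    qed simp
    then show ?thesis by (simp only: sum_distrib_left)
  qed
  have "(\<lambda>m. E * (s\<^sup>2 / (2 * \<alpha>)) + E * s\<^sup>2 * (\<Sum>j<min i k * m. ?e m j)) \<longlonglongrightarrow> E * (s\<^sup>2 / (2 * \<alpha>)) + E * s\<^sup>2 * ((?M - 1) / (2 * \<alpha>))"
    using \<alpha> \<Delta> by (intro tendsto_add tendsto_mult tendsto_const exponential_riemann_sum_limit) auto
  moreover have "E * (s\<^sup>2 / (2 * \<alpha>)) + E * s\<^sup>2 * ((?M - 1) / (2 * \<alpha>)) = s\<^sup>2 / (2 * \<alpha>) * (E * ?M)"
    by (simp add: diff_divide_distrib algebra_simps)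
  moreover have "E * ?M = exp (- \<alpha> * \<bar>real i * \<Delta> - real k * \<Delta>\<bar>)"
  proof -
    have "real i * \<Delta> + real k * \<Delta> - 2 * (real (min i k) * \<Delta>) = \<bar>real i * \<Delta> - real k * \<Delta>\<bar>"
      using \<Delta> mult_right_mono[of "real i" "real k" \<Delta>] mult_right_mono[of "real k" "real i" \<Delta>]
      by (cases "i \<le> k") (auto simp: min_def)
    note abs = this
    have "- \<alpha> * (real i * \<Delta>) + - \<alpha> * (real k * \<Delta>) + 2 * \<alpha> * (real (min i k) * \<Delta>) = - \<alpha> * \<bar>real i * \<Delta> - real k * \<Delta>\<bar>"
      unfolding abs[symmetric] by (simp add: algebra_simps)
    then show ?thesis unfolding E_def exp_add[symmetric] by (simp only:)
  qed
  ultimately show ?thesis unfolding sum E_def[symmetric] by (simp only:)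
qed

text \<open>
  A linear form in the values of the processes on a time grid is the limit of linear forms in the initial values and the
  Brownian increments on the refined grid of mesh \<open>\<Delta> / m\<close>. Their characteristic functions are explicit, and the
  limit of their variances is the stationary Ornstein-Uhlenbeck covariance.
\<close>

lemma finite_dim_char:
  fixes b :: "nat \<Rightarrow> 'i \<Rightarrow> real" and \<tau> :: "'i \<Rightarrow> nat"
  assumes A: "finite A" "A \<subseteq> {1..}" and I: "finite I" and \<Delta>: "\<Delta> > 0"
  shows "(\<integral>\<omega>. iexp (\<Sum>l\<in>A. \<Sum>p\<in>I. b l p * u l (real (\<tau> p) * \<Delta>) \<omega>) \<partial>M)
    = of_real (exp (- (\<Sum>l\<in>A. \<Sum>p\<in>I. \<Sum>q\<in>I. b l p * b l q *
        (\<sigma>\<^sup>2 / (2 * a l) * exp (- a l * \<bar>real (\<tau> p) * \<Delta> - real (\<tau> q) * \<Delta>\<bar>))) / 2))"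
proof -
  define N where "N = (\<Sum>p\<in>I. \<tau> p)"
  have N: "\<tau> p \<le> N" if "p \<in> I" for p unfolding N_def using I that by (intro member_le_sum) auto
  define h where "h m = \<Delta> / real m" for m
  define E where "E l p = exp (- a l * (real (\<tau> p) * \<Delta>))" for l p
  \<comment> \<open>The weight of the increment with number \<open>j\<close> in the process at time \<open>\<tau> p \<Delta>\<close>; increments after that time do not enter.\<close>
  define D where "D m l p j = (if j < \<tau> p * m then \<sigma> * exp (a l * (real j * h m) - a l * (real (\<tau> p) * \<Delta>)) else 0)" for m l p j
  let ?v = "\<lambda>l. \<sigma>\<^sup>2 / (2 * a l)" and ?d = "\<lambda>m l j \<omega>. \<beta> l (real (Suc j) * h m) \<omega> - \<beta> l (real j * h m) \<omega>"
  define S where "S m \<omega> = (\<Sum>l\<in>A. (\<Sum>p\<in>I. b l p * E l p) * u l 0 \<omega>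
      + (\<Sum>j<N * m. (\<Sum>p\<in>I. b l p * D m l p j) * ?d m l j \<omega>))" for m \<omega>
  define V where "V m = (\<Sum>l\<in>A. (\<Sum>p\<in>I. b l p * E l p)\<^sup>2 * ?v l + (\<Sum>j<N * m. (\<Sum>p\<in>I. b l p * D m l p j)\<^sup>2 * h m))" for m
  have l1: "l \<ge> 1" if "l \<in> A" for l using A that by auto
  have hpos: "h (Suc m) > 0" for m using \<Delta> by (simp add: h_def)
  show ?thesis
  proof (rule expectation_iexp_gaussian_limit)
    show "S (Suc m) \<in> borel_measurable M" for m
      unfolding S_def using l1 hpos[of m] by (intro borel_measurable_sum borel_measurable_add borel_measurable_times
          borel_measurable_diff borel_measurable_const measurable_drivers) auto
    show "(\<lambda>\<omega>. \<Sum>l\<in>A. \<Sum>p\<in>I. b l p * u l (real (\<tau> p) * \<Delta>) \<omega>) \<in> borel_measurable M"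
      using l1 \<Delta> by (intro borel_measurable_sum borel_measurable_times borel_measurable_const measurable_drivers) auto
    show "(\<integral>\<omega>. iexp (S (Suc m) \<omega>) \<partial>M) = of_real (exp (- V (Suc m) / 2))" for m
    proof -
      have "(\<integral>\<omega>. iexp (S (Suc m) \<omega>) \<partial>M) = of_real (exp (- (\<Sum>l\<in>A. (\<Sum>p\<in>I. b l p * E l p)\<^sup>2 * ?v l
          + (\<Sum>j<N * Suc m. (\<Sum>p\<in>I. b l p * D (Suc m) l p j)\<^sup>2 * (real (Suc j) * h (Suc m) - real j * h (Suc m)))) / 2))"
        unfolding S_def using hpos[of m] by (intro expectation_iexp_drivers A) auto
      moreover have "real (Suc j) * h (Suc m) - real j * h (Suc m) = h (Suc m)" for j by (simp add: algebra_simps)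
      ultimately show ?thesis by (simp only: V_def)
    qed
    have "AE \<omega> in M. \<forall>l\<in>A. \<forall>i::nat. (\<lambda>m. \<Sum>j<i * m. exp (a l * (real j * h m)) * (\<sigma> * ?d m l j \<omega>))
      \<longlonglongrightarrow> exp (a l * (real i * \<Delta>)) * u l (real i * \<Delta>) \<omega> - u l 0 \<omega>"
      unfolding h_def using A l1 \<Delta> by (intro AE_finite_allI ou_discretisation) auto
    then show "AE \<omega> in M. (\<lambda>m. S (Suc m) \<omega>) \<longlonglongrightarrow> (\<Sum>l\<in>A. \<Sum>p\<in>I. b l p * u l (real (\<tau> p) * \<Delta>) \<omega>)"
    proof eventually_elim
      case (elim \<omega>)
      let ?z = "\<lambda>m l j. exp (a l * (real j * h m)) * (\<sigma> * ?d m l j \<omega>)"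
      have "S m \<omega> = (\<Sum>l\<in>A. \<Sum>p\<in>I. b l p * (E l p * (u l 0 \<omega> + (\<Sum>j<\<tau> p * m. ?z m l j))))" for m
        unfolding S_def
      proof (rule sum.cong[OF refl])
        fix l
        have "(\<Sum>j<N * m. D m l p j * ?d m l j \<omega>) = E l p * (\<Sum>j<\<tau> p * m. ?z m l j)" if p: "p \<in> I" for p
          unfolding sum_distrib_left
        proof (rule sum.mono_neutral_cong_right)
          show "{..<\<tau> p * m} \<subseteq> {..<N * m}" using mult_le_mono1[OF N[OF p], of m] by auto
          show "D m l p j * ?d m l j \<omega> = E l p * ?z m l j" if "j \<in> {..<\<tau> p * m}" for j
            using that by (simp add: D_def E_def exp_diff exp_minus field_simps)
        qed (auto simp: D_def)
        then have "(\<Sum>p\<in>I. \<Sum>j<N * m. b l p * D m l p j * ?d m l j \<omega>) = (\<Sum>p\<in>I. b l p * (E l p * (\<Sum>j<\<tau> p * m. ?z m l j)))"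
          by (simp add: mult.assoc sum_distrib_left[symmetric])
        moreover have "(\<Sum>j<N * m. (\<Sum>p\<in>I. b l p * D m l p j) * ?d m l j \<omega>) = (\<Sum>p\<in>I. \<Sum>j<N * m. b l p * D m l p j * ?d m l j \<omega>)"
          unfolding sum_distrib_right by (rule sum.swap)
        ultimately show "(\<Sum>p\<in>I. b l p * E l p) * u l 0 \<omega> + (\<Sum>j<N * m. (\<Sum>p\<in>I. b l p * D m l p j) * ?d m l j \<omega>)
          = (\<Sum>p\<in>I. b l p * (E l p * (u l 0 \<omega> + (\<Sum>j<\<tau> p * m. ?z m l j))))"
          by (simp only: sum_distrib_right sum.distrib distrib_left mult.assoc)
      qed
      moreover have "(\<lambda>m. \<Sum>l\<in>A. \<Sum>p\<in>I. b l p * (E l p * (u l 0 \<omega> + (\<Sum>j<\<tau> p * m. ?z m l j)))) \<longlonglongrightarrow>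
         (\<Sum>l\<in>A. \<Sum>p\<in>I. b l p * (E l p * (u l 0 \<omega> + (exp (a l * (real (\<tau> p) * \<Delta>)) * u l (real (\<tau> p) * \<Delta>) \<omega> - u l 0 \<omega>))))"
        using elim by (intro tendsto_sum tendsto_mult tendsto_add tendsto_const) blast
      moreover have "E l p * (u l 0 \<omega> + (exp (a l * (real (\<tau> p) * \<Delta>)) * u l (real (\<tau> p) * \<Delta>) \<omega> - u l 0 \<omega>)) = u l (real (\<tau> p) * \<Delta>) \<omega>" for l p
        by (simp add: E_def exp_minus)
      ultimately have "(\<lambda>m. S m \<omega>) \<longlonglongrightarrow> (\<Sum>l\<in>A. \<Sum>p\<in>I. b l p * u l (real (\<tau> p) * \<Delta>) \<omega>)" by (simp only:)
      then show ?case by (rule LIMSEQ_Suc)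
    qed
    have V_eq: "V m = (\<Sum>l\<in>A. \<Sum>p\<in>I. \<Sum>q\<in>I. b l p * b l q * (E l p * E l q * ?v l + (\<Sum>j<N * m. D m l p j * D m l q j * h m)))" for m
      unfolding V_def
    proof (rule sum.cong[OF refl])
      fix l
      have square: "(\<Sum>p\<in>I. b l p * x p)\<^sup>2 * c = (\<Sum>p\<in>I. \<Sum>q\<in>I. b l p * b l q * (x p * x q * c))" for x c
      proof -
        have "(\<Sum>p\<in>I. b l p * x p)\<^sup>2 = (\<Sum>p\<in>I. \<Sum>q\<in>I. b l p * x p * (b l q * x q))"
          by (simp only: power2_eq_square sum_product)
        then show ?thesis by (simp only: sum_distrib_right) (intro sum.cong refl, simp only: mult_ac)
      qed
      have "(\<Sum>j<N * m. (\<Sum>p\<in>I. b l p * D m l p j)\<^sup>2 * h m) = (\<Sum>p\<in>I. \<Sum>j<N * m. \<Sum>q\<in>I. b l p * b l q * (D m l p j * D m l q j * h m))"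
        unfolding square by (rule sum.swap)
      also have "\<dots> = (\<Sum>p\<in>I. \<Sum>q\<in>I. b l p * b l q * (\<Sum>j<N * m. D m l p j * D m l q j * h m))"
        unfolding sum_distrib_left by (intro sum.cong refl sum.swap)
      finally show "(\<Sum>p\<in>I. b l p * E l p)\<^sup>2 * ?v l + (\<Sum>j<N * m. (\<Sum>p\<in>I. b l p * D m l p j)\<^sup>2 * h m)
        = (\<Sum>p\<in>I. \<Sum>q\<in>I. b l p * b l q * (E l p * E l q * ?v l + (\<Sum>j<N * m. D m l p j * D m l q j * h m)))"
        unfolding square by (simp only: distrib_left sum.distrib)
    qed
    have "(\<lambda>m. \<Sum>l\<in>A. \<Sum>p\<in>I. \<Sum>q\<in>I. b l p * b l q * (E l p * E l q * ?v l + (\<Sum>j<N * m. D m l p j * D m l q j * h m))) \<longlonglongrightarrow>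
      (\<Sum>l\<in>A. \<Sum>p\<in>I. \<Sum>q\<in>I. b l p * b l q * (?v l * exp (- a l * \<bar>real (\<tau> p) * \<Delta> - real (\<tau> q) * \<Delta>\<bar>)))"
      unfolding E_def D_def h_def using l1 \<Delta> rate_pos N
      by (intro tendsto_sum tendsto_mult tendsto_const discretised_covariance_limit) auto
    from LIMSEQ_Suc[OF this]
    show "(\<lambda>m. V (Suc m)) \<longlonglongrightarrow> (\<Sum>l\<in>A. \<Sum>p\<in>I. \<Sum>q\<in>I. b l p * b l q * (?v l * exp (- a l * \<bar>real (\<tau> p) * \<Delta> - real (\<tau> q) * \<Delta>\<bar>)))"
      unfolding V_eq .
  qed
qed

end

section \<open>The realized spatial quadratic variation\<close>

lemma spde_eigenval_eq: "spde_eigenval \<theta>0 \<theta>1 \<theta>2 (Suc n) = \<theta>2 * mode_rate (spde_Gamma \<theta>0 \<theta>1 \<theta>2) n"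
  by (simp add: spde_eigenval_def mode_rate_def)

lemma spde_eigenfun_increment:
  fixes \<theta>1 \<theta>2 y \<delta> :: real
  defines "\<kappa> \<equiv> spde_kappa \<theta>1 \<theta>2"
  shows "exp (\<kappa> * y / 2) * (spde_eigenfun \<theta>1 \<theta>2 (Suc n) (y + \<delta>) - spde_eigenfun \<theta>1 \<theta>2 (Suc n) y) = incr_mode \<kappa> \<delta> y n"
proof -
  have e1: "exp (\<kappa> * y / 2) * exp (- \<kappa> * (y + \<delta>) / 2) = exp (- \<kappa> * \<delta> / 2)"
    unfolding exp_add[symmetric] by (rule arg_cong[where f=exp]) (simp add: field_simps)
  have e2: "exp (\<kappa> * y / 2) * exp (- \<kappa> * y / 2) = 1"
    unfolding exp_add[symmetric] by simp
  have alg: "E * (r * p * F - r * q * F') = r * (E * F * p - E * F' * q)" for E F F' r p q :: real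
    by (simp add: algebra_simps)
  show ?thesis
    unfolding spde_eigenfun_def incr_mode_def \<kappa>_def[symmetric] by (subst alg) (simp only: e1 e2 mult_1_left)
qed

lemma stationary_ou_familyI:
  assumes \<sigma>: "\<sigma>\<^sup>2 > 0" and \<theta>2: "\<theta>2 > 0" and G: "spde_Gamma \<theta>0 \<theta>1 \<theta>2 + pi\<^sup>2 > 0"
    and sol: "stationary_spde_solution P \<sigma> \<theta>0 \<theta>1 \<theta>2 \<beta> u X"
  shows "stationary_ou_family P (spde_eigenval \<theta>0 \<theta>1 \<theta>2) \<sigma> \<beta> u"
proof -
  obtain c where c: "c > 0" "\<And>n. c * (real (Suc n))\<^sup>2 \<le> mode_rate (spde_Gamma \<theta>0 \<theta>1 \<theta>2) n"
    using mode_rate_lower_bound[OF G] by blast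
  have pos: "spde_eigenval \<theta>0 \<theta>1 \<theta>2 l > 0" if l1: "l \<ge> 1" for l
  proof -
    obtain n where l: "l = Suc n" using l1 by (cases l) auto
    have "0 < c * (real (Suc n))\<^sup>2" using c(1) by simp
    then have "0 < mode_rate (spde_Gamma \<theta>0 \<theta>1 \<theta>2) n" using c(2)[of n] by linarith
    then show ?thesis using \<theta>2 by (simp only: l spde_eigenval_eq mult_pos_pos)
  qed
  have "prob_space P" using sol by (simp add: stationary_spde_solution_def)
  then show ?thesis
    unfolding stationary_ou_family_def stationary_ou_family_axioms_def
    using sol \<sigma> pos by (simp add: stationary_spde_solution_def)
qed

text \<open>
  Dividing by \<open>sqrt (v \<delta>)\<close>, where \<open>v\<close> is the limit of the statistic, makes the variances close to \<open>1\<close>.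
\<close>

definition scaled_increment ::
  "real \<Rightarrow> real \<Rightarrow> real \<Rightarrow> real \<Rightarrow> (real \<Rightarrow> real \<Rightarrow> 'a \<Rightarrow> real) \<Rightarrow> nat \<Rightarrow> nat \<Rightarrow> nat \<times> nat \<Rightarrow> 'a \<Rightarrow> real" where
  "scaled_increment \<kappa> v T b X M N p \<omega> =
     exp (\<kappa> * grid_space b M (snd p) / 2) *
     (X (grid_time T N (fst p)) (grid_space b M (Suc (snd p))) \<omega> - X (grid_time T N (fst p)) (grid_space b M (snd p)) \<omega>)
     / sqrt (v * grid_mesh b M)"

lemma grid_space_Suc: "grid_space b M (Suc k) = grid_space b M k + grid_mesh b M"
  by (simp add: grid_space_def algebra_simps)

lemma grid_space_mem_unit_interval:
  assumes b: "0 \<le> b" "b < 1 / 2" and k: "k \<le> M" and M: "M \<ge> 1"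
  shows "grid_space b M k \<in> {0..1}"
proof -
  have d: "grid_mesh b M > 0" and Md: "real M * grid_mesh b M = 1 - 2 * b" using b M by (simp_all add: grid_mesh_def)
  have "real k * grid_mesh b M \<le> real M * grid_mesh b M" using k d by (intro mult_right_mono) auto
  then show ?thesis using d b Md by (simp add: grid_space_def)
qed

lemma grid_time_nonneg: "T > 0 \<Longrightarrow> grid_time T N i \<ge> 0"
  by (simp add: grid_time_def)

text \<open>
  A linear form in the increments is the almost sure limit of linear forms in finitely many coefficient processes, whose
  characteristic functions are known; the series for the covariance converges absolutely.
\<close>

lemma scaled_increment_gaussian_family:
  assumes \<sigma>: "\<sigma>\<^sup>2 > 0" and \<theta>2: "\<theta>2 > 0" and G: "spde_Gamma \<theta>0 \<theta>1 \<theta>2 + pi\<^sup>2 > 0"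
    and sol: "stationary_spde_solution P \<sigma> \<theta>0 \<theta>1 \<theta>2 \<beta> u X"
    and T: "T > 0" and b: "0 \<le> b" "b < 1 / 2" and M: "M \<ge> 1" and N: "N \<ge> 1"
  defines "\<kappa> \<equiv> spde_kappa \<theta>1 \<theta>2" and "v \<equiv> \<sigma>\<^sup>2 / (2 * \<theta>2)"
  shows "gaussian_family P ({..<N} \<times> {..<M}) (scaled_increment \<kappa> v T b X M N)
    (grid_cov \<theta>2 (spde_Gamma \<theta>0 \<theta>1 \<theta>2) \<kappa> T b M N)"
proof -
  define \<Gamma> where "\<Gamma> = spde_Gamma \<theta>0 \<theta>1 \<theta>2"
  interpret stationary_ou_family P "spde_eigenval \<theta>0 \<theta>1 \<theta>2" \<sigma> \<beta> u
    by (rule stationary_ou_familyI[OF \<sigma> \<theta>2 G sol])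
  let ?I = "{..<N} \<times> {..<M}"
  define \<delta> where "\<delta> = grid_mesh b M"
  define \<Delta> where "\<Delta> = T / real N"
  have \<Delta>: "\<Delta> > 0" using T N by (simp add: \<Delta>_def)
  have d: "\<delta> > 0" using b M by (simp add: \<delta>_def grid_mesh_def)
  have v: "v > 0" using \<sigma> \<theta>2 by (simp add: v_def)
  have vd: "v * \<delta> > 0" using v d by simp
  define y where "y k = grid_space b M k" for k
  have ySuc: "grid_space b M (Suc k) = y k + \<delta>" for k by (simp add: grid_space_Suc y_def \<delta>_def)
  have y01: "y k \<in> {0..1}" if "k \<le> M" for k unfolding y_def by (rule grid_space_mem_unit_interval[OF b that M])
  have y01S: "y k + \<delta> \<in> {0..1}" if "k < M" for k unfolding ySuc[symmetric] using that by (intro grid_space_mem_unit_interval b M) auto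
  have X: "X t x \<in> borel_measurable P" "AE \<omega> in P. (\<lambda>n. u (Suc n) t \<omega> * spde_eigenfun \<theta>1 \<theta>2 (Suc n) x) sums X t x \<omega>"
    if "t \<ge> 0" "x \<in> {0..1}" for t x using sol that by (auto simp: stationary_spde_solution_def)
  have time: "grid_time T N i = real i * \<Delta>" for i by (simp add: grid_time_def \<Delta>_def)
  have time0: "real i * \<Delta> \<ge> 0" for i using \<Delta> by simp
  let ?C = "grid_cov \<theta>2 \<Gamma> \<kappa> T b M N"
  let ?d = "\<lambda>(p :: nat \<times> nat) n. incr_mode \<kappa> \<delta> (y (snd p)) n"
  let ?u = "\<lambda>n i. u (Suc n) (real i * \<Delta>)" and ?f = "\<lambda>n. spde_eigenfun \<theta>1 \<theta>2 (Suc n)"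
  let ?\<xi> = "scaled_increment \<kappa> v T b X M N"
  have \<xi>: "?\<xi> (i, k) \<omega> = exp (\<kappa> * y k / 2) * (X (real i * \<Delta>) (y k + \<delta>) \<omega> - X (real i * \<Delta>) (y k) \<omega>) / sqrt (v * \<delta>)" for i k \<omega>
    unfolding scaled_increment_def fst_conv snd_conv time ySuc unfolding y_def \<delta>_def ..
  have meas: "?\<xi> p \<in> borel_measurable P" if p: "p \<in> ?I" for p
  proof -
    obtain i k where p': "p = (i, k)" "k < M" using p by auto
    have "X (real i * \<Delta>) (y k + \<delta>) \<in> borel_measurable P" "X (real i * \<Delta>) (y k) \<in> borel_measurable P"
      using p'(2) by (intro X(1) time0 y01S y01; simp)+
    then show ?thesis unfolding p' \<xi> by simp
  qed
  have ser: "AE \<omega> in P. \<forall>p\<in>?I. (\<lambda>n. ?u n (fst p) \<omega> * (?d p n / sqrt (v * \<delta>))) sums ?\<xi> p \<omega>"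
  proof (rule AE_finite_allI)
    fix p assume p: "p \<in> ?I"
    obtain i k where p': "p = (i, k)" "k < M" using p by auto
    have "AE \<omega> in P. (\<lambda>n. ?u n i \<omega> * ?f n (y k + \<delta>)) sums X (real i * \<Delta>) (y k + \<delta>) \<omega>"
      by (rule X(2)[OF time0 y01S[OF p'(2)]])
    moreover have "AE \<omega> in P. (\<lambda>n. ?u n i \<omega> * ?f n (y k)) sums X (real i * \<Delta>) (y k) \<omega>"
      using p'(2) by (intro X(2) time0 y01) simp
    ultimately have "AE \<omega> in P. (\<lambda>n. ?u n i \<omega> * (incr_mode \<kappa> \<delta> (y k) n / sqrt (v * \<delta>))) sums ?\<xi> (i, k) \<omega>"
    proof eventually_elim
      case (elim \<omega>)
      have "(\<lambda>n. exp (\<kappa> * y k / 2) * (?u n i \<omega> * ?f n (y k + \<delta>)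
          - ?u n i \<omega> * ?f n (y k)) / sqrt (v * \<delta>)) sums ?\<xi> (i, k) \<omega>"
        unfolding \<xi> by (intro sums_divide sums_mult sums_diff elim)
      moreover have "exp (\<kappa> * y k / 2) * (?u n i \<omega> * ?f n (y k + \<delta>)
          - ?u n i \<omega> * ?f n (y k)) / sqrt (v * \<delta>)
        = ?u n i \<omega> * (incr_mode \<kappa> \<delta> (y k) n / sqrt (v * \<delta>))" for n
        unfolding \<kappa>_def spde_eigenfun_increment[symmetric] by (simp add: algebra_simps)
      ultimately show ?case by (simp only:)
    qed
    then show "AE \<omega> in P. (\<lambda>n. ?u n (fst p) \<omega> * (?d p n / sqrt (v * \<delta>))) sums ?\<xi> p \<omega>"
      by (simp only: p' fst_conv snd_conv)
  qed simp
  have "(\<integral>\<omega>. iexp (\<Sum>p\<in>?I. x p * ?\<xi> p \<omega>) \<partial>P)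
      = of_real (exp (- (\<Sum>p\<in>?I. \<Sum>q\<in>?I. ?C p q * x p * x q) / 2))" for x :: "nat \<times> nat \<Rightarrow> real"
  proof -
    let ?l = "spde_eigenval \<theta>0 \<theta>1 \<theta>2"
    define B where "B l p = x p * (?d p (l - 1) / sqrt (v * \<delta>))" for l p
    define S where "S L \<omega> = (\<Sum>l\<in>{1..L}. \<Sum>p\<in>?I. B l p * u l (real (fst p) * \<Delta>) \<omega>)" for L \<omega>
    define e where "e n p q = exp (- \<theta>2 * mode_rate \<Gamma> n * \<bar>real (fst p) * \<Delta> - real (fst q) * \<Delta>\<bar>) / mode_rate \<Gamma> n"
      for n and p q :: "nat \<times> nat"
    let ?t = "\<lambda>n p q. e n p q * ?d p n * ?d q n"
    let ?F = "\<lambda>l p q. B l p * B l q * (\<sigma>\<^sup>2 / (2 * ?l l) * exp (- ?l l * \<bar>real (fst p) * \<Delta> - real (fst q) * \<Delta>\<bar>))"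
    have shift: "(\<Sum>l\<in>{1..L}. f l) = (\<Sum>n<L. f (Suc n))" for f :: "nat \<Rightarrow> real" and L
      by (rule sum.reindex_bij_witness[where i=Suc and j="\<lambda>l. l - 1"]) auto
    show ?thesis
    proof (rule expectation_iexp_gaussian_limit)
      show "S L \<in> borel_measurable P" for L
        unfolding S_def using time0 by (intro borel_measurable_sum borel_measurable_times borel_measurable_const measurable_drivers) auto
      show "(\<lambda>\<omega>. \<Sum>p\<in>?I. x p * ?\<xi> p \<omega>) \<in> borel_measurable P"
        by (intro borel_measurable_sum borel_measurable_times borel_measurable_const meas)
      show "AE \<omega> in P. (\<lambda>L. S L \<omega>) \<longlonglongrightarrow> (\<Sum>p\<in>?I. x p * ?\<xi> p \<omega>)"
        using ser
      proof eventually_elim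
        case (elim \<omega>)
        have "S L \<omega> = (\<Sum>p\<in>?I. \<Sum>n<L. x p * (?u n (fst p) \<omega> * (?d p n / sqrt (v * \<delta>))))" for L
          unfolding S_def shift B_def diff_Suc_1 by (subst sum.swap) (intro sum.cong refl, simp only: mult_ac)
        moreover have "(\<lambda>L. \<Sum>n<L. ?u n (fst p) \<omega> * (?d p n / sqrt (v * \<delta>))) \<longlonglongrightarrow> ?\<xi> p \<omega>" if "p \<in> ?I" for p
          using elim that unfolding sums_def by blast
        ultimately show ?case unfolding sum_distrib_left[symmetric] by (simp only:) (intro tendsto_sum tendsto_mult tendsto_const, blast)
      qed
      show "(\<integral>\<omega>. iexp (S L \<omega>) \<partial>P) = of_real (exp (- (\<Sum>p\<in>?I. \<Sum>q\<in>?I. (\<Sum>n<L. ?t n p q) / \<delta> * x p * x q) / 2))" for L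
      proof -
        have "?F (Suc n) p q = ?t n p q / \<delta> * x p * x q" for n p q
        proof -
          have sq: "sqrt (v * \<delta>) * sqrt (v * \<delta>) = v * \<delta>" using vd by simp
          have alg: "x1 * (d1 / z) * (x2 * (d2 / z)) * (s / (2 * (th * r)) * E) = (s / (2 * th)) / (z * z) * (E / r * d1 * d2 * x1 * x2)"
            for s th r E x1 d1 z x2 d2 :: real by (simp add: field_simps)
          have canc: "v / (v * \<delta>) = 1 / \<delta>" using v by simp
          show ?thesis
            unfolding B_def diff_Suc_1 e_def spde_eigenval_eq \<Gamma>_def[symmetric] alg sq v_def[symmetric] canc
            by (simp add: mult_ac)
        qed
        then have "(\<Sum>l\<in>{1..L}. \<Sum>p\<in>?I. \<Sum>q\<in>?I. ?F l p q) = (\<Sum>n<L. \<Sum>p\<in>?I. \<Sum>q\<in>?I. ?t n p q / \<delta> * x p * x q)"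
          by (simp only: shift)
        also have "\<dots> = (\<Sum>p\<in>?I. \<Sum>n<L. \<Sum>q\<in>?I. ?t n p q / \<delta> * x p * x q)"
          by (rule sum.swap)
        also have "\<dots> = (\<Sum>p\<in>?I. \<Sum>q\<in>?I. \<Sum>n<L. ?t n p q / \<delta> * x p * x q)"
          by (intro sum.cong refl sum.swap)
        finally have "(\<Sum>l\<in>{1..L}. \<Sum>p\<in>?I. \<Sum>q\<in>?I. ?F l p q) = (\<Sum>p\<in>?I. \<Sum>q\<in>?I. (\<Sum>n<L. ?t n p q) / \<delta> * x p * x q)"
          by (simp only: sum_divide_distrib sum_distrib_right)
        moreover have "(\<integral>\<omega>. iexp (S L \<omega>) \<partial>P) = of_real (exp (- (\<Sum>l\<in>{1..L}. \<Sum>p\<in>?I. \<Sum>q\<in>?I. ?F l p q) / 2))"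
          unfolding S_def by (rule finite_dim_char[OF _ _ _ \<Delta>]) auto
        ultimately show ?thesis by (simp only:)
      qed
      have C: "(\<lambda>L. (\<Sum>n<L. ?t n p q) / \<delta>) \<longlonglongrightarrow> ?C p q" for p q
      proof -
        have G': "\<Gamma> + pi\<^sup>2 > 0" using G by (simp add: \<Gamma>_def)
        have "summable (\<lambda>n. ?t n p q)"
          unfolding e_def using \<theta>2 by (intro incr_cov_summable G') auto
        from tendsto_divide[OF summable_LIMSEQ[OF this] tendsto_const[of \<delta>]]
        show ?thesis using d by (simp add: grid_cov_def incr_cov_def e_def time \<delta>_def[symmetric] y_def[symmetric])
      qed
      show "(\<lambda>L. \<Sum>p\<in>?I. \<Sum>q\<in>?I. (\<Sum>n<L. ?t n p q) / \<delta> * x p * x q) \<longlonglongrightarrow> (\<Sum>p\<in>?I. \<Sum>q\<in>?I. ?C p q * x p * x q)"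
        by (intro tendsto_sum tendsto_mult tendsto_const C)
    qed
  qed
  then show ?thesis
    unfolding gaussian_family_def using meas by (auto simp: \<Gamma>_def intro: prob_space_axioms)
qed

lemma V_sp_eq_scaled_increments:
  assumes v: "v > 0" and b: "b < 1 / 2" and M: "M \<ge> 1" and N: "N \<ge> 1"
  shows "sqrt (real M * real N) * (V_sp \<kappa> T b X M N \<omega> - v)
    = v / sqrt (real (card ({..<N} \<times> {..<M}))) * ((\<Sum>p\<in>{..<N} \<times> {..<M}. (scaled_increment \<kappa> v T b X M N p \<omega>)\<^sup>2) - real (card ({..<N} \<times> {..<M})))"
proof -
  let ?I = "{..<N} \<times> {..<M}"
  define \<delta> where "\<delta> = grid_mesh b M"
  define K where "K = real M * real N"
  have K: "K > 0" using M N by (simp add: K_def)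
  have card: "real (card (?I)) = K" by (simp add: card_cartesian_product K_def)
  have d: "\<delta> > 0" using b M by (simp add: \<delta>_def grid_mesh_def)
  define Q where "Q = (\<Sum>i<N. \<Sum>k<M. exp (\<kappa> * grid_space b M k) *
        (X (grid_time T N i) (grid_space b M (Suc k)) \<omega> - X (grid_time T N i) (grid_space b M k) \<omega>)\<^sup>2)"
  have V: "V_sp \<kappa> T b X M N \<omega> = Q / (K * \<delta>)" by (simp add: V_sp_def Q_def K_def \<delta>_def mult_ac)
  have "(\<Sum>p\<in>?I. (scaled_increment \<kappa> v T b X M N p \<omega>)\<^sup>2) = Q / (v * \<delta>)"
    unfolding sum.cartesian_product' Q_def sum_divide_distrib
  proof (intro sum.cong refl)
    fix i k
    have "(exp (\<kappa> * grid_space b M k / 2))\<^sup>2 = exp (\<kappa> * grid_space b M k)" by (simp add: exp_double[symmetric])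
    moreover have "(sqrt (v * \<delta>))\<^sup>2 = v * \<delta>" using v d by simp
    ultimately show "(scaled_increment \<kappa> v T b X M N (i, k) \<omega>)\<^sup>2 = exp (\<kappa> * grid_space b M k) *
        (X (grid_time T N i) (grid_space b M (Suc k)) \<omega> - X (grid_time T N i) (grid_space b M k) \<omega>)\<^sup>2 / (v * \<delta>)"
      unfolding scaled_increment_def \<delta>_def[symmetric] by (simp only: power_mult_distrib power_divide fst_conv snd_conv)
  qed
  moreover have "sqrt K * (Q / (K * \<delta>) - v) = v / sqrt K * (Q / (v * \<delta>) - K)"
  proof -
    have "sqrt K * (Q / (K * \<delta>) - v) = K / sqrt K * (Q / (K * \<delta>) - v)" using K by (simp add: real_div_sqrt)
    also have "\<dots> = v / sqrt K * (Q / (v * \<delta>) - K)" using K v d by (simp add: field_simps)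
    finally show ?thesis .
  qed
  ultimately show ?thesis unfolding V card K_def[symmetric] by simp
qed

lemma char_centred_normal:
  assumes s: "s > 0"
  shows "char (density lborel (normal_density 0 s)) t = of_real (exp (- (t\<^sup>2 * s\<^sup>2) / 2))"
proof -
  interpret N: prob_space "density lborel (normal_density 0 s)" by (rule prob_space_normal_density[OF s])
  have "distributed (density lborel (normal_density 0 s)) lborel (\<lambda>x. x) (normal_density 0 s)"
    unfolding distributed_def by (auto intro: distr_id2)
  then show ?thesis using N.expectation_iexp_normal[OF _ s, of "\<lambda>x. x" t] by (simp add: char_def)
qed

theorem theorem3p3:
  fixes P :: "'a measure"
    and \<sigma> \<theta>0 \<theta>1 \<theta>2 T b :: real
    and \<beta> u :: "nat \<Rightarrow> real \<Rightarrow> 'a \<Rightarrow> real"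
    and X :: "real \<Rightarrow> real \<Rightarrow> 'a \<Rightarrow> real"
    and M N :: "nat \<Rightarrow> nat"
  assumes "\<sigma>\<^sup>2 > 0" and "\<theta>2 > 0" and "spde_Gamma \<theta>0 \<theta>1 \<theta>2 + pi\<^sup>2 > 0"
    and "stationary_spde_solution P \<sigma> \<theta>0 \<theta>1 \<theta>2 \<beta> u X"
    and "T > 0" and "0 \<le> b" and "b < 1 / 2"
    and "filterlim (\<lambda>n. min (M n) (N n)) at_top sequentially"
    and "(\<lambda>n. real (N n) / real (M n)) \<longlonglongrightarrow> 0"
  shows "weak_conv_m
    (\<lambda>n. distr P borel (\<lambda>\<omega>. sqrt (real (M n) * real (N n)) *
        (V_sp (spde_kappa \<theta>1 \<theta>2) T b X (M n) (N n) \<omega> - \<sigma>\<^sup>2 / (2 * \<theta>2))))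
    (density lborel (normal_density 0 (sqrt (\<sigma>^4 / (2 * \<theta>2\<^sup>2)))))"
proof -
  note \<sigma> = assms(1) and \<theta>2 = assms(2) and G = assms(3) and sol = assms(4) and T = assms(5) and b = assms(6,7)
  define \<kappa> where "\<kappa> = spde_kappa \<theta>1 \<theta>2"
  define \<Gamma> where "\<Gamma> = spde_Gamma \<theta>0 \<theta>1 \<theta>2"
  define v where "v = \<sigma>\<^sup>2 / (2 * \<theta>2)"
  have v: "v > 0" using \<sigma> \<theta>2 by (simp add: v_def)
  have s2: "(sqrt (\<sigma>^4 / (2 * \<theta>2\<^sup>2)))\<^sup>2 = 2 * v\<^sup>2"
    by (simp add: v_def power_divide power_mult_distrib)
  have s: "sqrt (\<sigma>^4 / (2 * \<theta>2\<^sup>2)) > 0"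
    using \<sigma> \<theta>2 by simp
  interpret P: prob_space P using sol by (simp add: stationary_spde_solution_def)
  define I where "I n = {..<N n} \<times> {..<M n}" for n
  define C where "C n = grid_cov \<theta>2 \<Gamma> \<kappa> T b (M n) (N n)" for n
  define \<xi> where "\<xi> n = scaled_increment \<kappa> v T b X (M n) (N n)" for n
  define W where "W n \<omega> = sqrt (real (M n) * real (N n)) * (V_sp \<kappa> T b X (M n) (N n) \<omega> - v)" for n \<omega>
  have card: "card (I n) = N n * M n" for n by (simp add: I_def card_cartesian_product)
  let ?D = "\<lambda>n. \<Sum>p\<in>I n. \<bar>C n p p - 1\<bar>" and ?O = "\<lambda>n. \<Sum>p\<in>I n. \<Sum>q\<in>I n - {p}. (C n p q)\<^sup>2"
  let ?Q = "\<lambda>n \<omega>. (\<Sum>p\<in>I n. (\<xi> n p \<omega>)\<^sup>2) - real (card (I n))"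
  let ?L = "density lborel (normal_density 0 (sqrt (\<sigma>^4 / (2 * \<theta>2\<^sup>2))))"
  have minlim: "filterlim (\<lambda>n. min (M n) (N n)) at_top sequentially" by fact
  \<comment> \<open>Where \<open>M n = 0\<close> or \<open>N n = 0\<close> the mesh widths degenerate, so the Gaussian description is only claimed eventually.\<close>
  have MN1: "\<forall>\<^sub>F n in sequentially. M n \<ge> 1 \<and> N n \<ge> 1"
    using filterlim_at_top[THEN iffD1, OF minlim, rule_format, of 1] by eventually_elim simp
  have Mlim: "filterlim M at_top sequentially"
    by (rule filterlim_at_top_mono[OF minlim]) simp
  have cardlim: "filterlim (\<lambda>n. card (I n)) at_top sequentially"
  proof (rule filterlim_at_top_mono[OF Mlim])
    show "\<forall>\<^sub>F n in sequentially. M n \<le> card (I n)" using MN1 by eventually_elim (simp add: card)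
  qed
  obtain K where K: "K \<ge> 0"
    and Kd: "\<And>M N. M \<ge> 1 \<Longrightarrow> N \<ge> 1 \<Longrightarrow> (\<Sum>p\<in>{..<N} \<times> {..<M}. \<bar>grid_cov \<theta>2 \<Gamma> \<kappa> T b M N p p - 1\<bar>) \<le> K * real N"
    and Ko: "\<And>M N. M \<ge> 1 \<Longrightarrow> N \<ge> 1 \<Longrightarrow>
      (\<Sum>p\<in>{..<N} \<times> {..<M}. \<Sum>q\<in>({..<N} \<times> {..<M}) - {p}. (grid_cov \<theta>2 \<Gamma> \<kappa> T b M N p q)\<^sup>2) \<le> K * (real N + (real N)\<^sup>2)"
    using grid_cov_bounds[OF G \<theta>2 T b, of \<kappa>] unfolding \<Gamma>_def by blast
  have ratio: "(\<lambda>n. real (N n) / real (M n)) \<longlonglongrightarrow> 0" by fact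
  have diag: "(\<lambda>n. ?D n / sqrt (real (card (I n)))) \<longlonglongrightarrow> 0"
  proof (rule Lim_null_comparison)
    show "(\<lambda>n. K * sqrt (real (N n) / real (M n))) \<longlonglongrightarrow> 0"
      using tendsto_mult[OF tendsto_const[of K] tendsto_real_sqrt[OF ratio]] by simp
    show "\<forall>\<^sub>F n in sequentially. norm (?D n / sqrt (real (card (I n)))) \<le> K * sqrt (real (N n) / real (M n))"
      using MN1
    proof eventually_elim
      case (elim n)
      have "norm (?D n / sqrt (real (card (I n)))) = ?D n / sqrt (real (card (I n)))"
        by (simp add: sum_nonneg)
      also have "\<dots> \<le> K * real (N n) / sqrt (real (card (I n)))"
        using Kd elim unfolding I_def C_def by (intro divide_right_mono) auto
      also have "\<dots> = K * (real (N n) / sqrt (real (N n)) / sqrt (real (M n)))"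
        by (simp add: card real_sqrt_mult)
      also have "\<dots> = K * sqrt (real (N n) / real (M n))"
        using elim by (simp add: real_div_sqrt real_sqrt_divide)
      finally show ?case .
    qed
  qed
  have off: "(\<lambda>n. ?O n / real (card (I n))) \<longlonglongrightarrow> 0"
  proof (rule Lim_null_comparison)
    have "(\<lambda>n. 1 / real (M n)) \<longlonglongrightarrow> 0"
      using filterlim_compose[OF lim_1_over_n Mlim] by simp
    then show "(\<lambda>n. K * (1 / real (M n) + real (N n) / real (M n))) \<longlonglongrightarrow> 0"
      using tendsto_mult[OF tendsto_const[of K] tendsto_add[OF _ ratio]] by fastforce
    show "\<forall>\<^sub>F n in sequentially. norm (?O n / real (card (I n))) \<le> K * (1 / real (M n) + real (N n) / real (M n))"
      using MN1
    proof eventually_elim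
      case (elim n)
      have "norm (?O n / real (card (I n))) = ?O n / real (card (I n))"
        by (simp add: sum_nonneg)
      also have "\<dots> \<le> K * (real (N n) + (real (N n))\<^sup>2) / real (card (I n))"
        using Ko elim unfolding I_def C_def by (intro divide_right_mono) auto
      also have "\<dots> = K * (1 / real (M n) + real (N n) / real (M n))"
        using elim by (simp add: card power2_eq_square field_simps)
      finally show ?case .
    qed
  qed
  have gauss: "\<forall>\<^sub>F n in sequentially. gaussian_family P (I n) (\<xi> n) (C n)"
    using MN1
  proof eventually_elim
    case (elim n)
    then show ?case unfolding I_def \<xi>_def C_def \<kappa>_def v_def \<Gamma>_def
      by (intro scaled_increment_gaussian_family[OF \<sigma> \<theta>2 G sol T b]) auto
  qed
  have measW: "W n \<in> borel_measurable P" for n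
  proof -
    have "X (grid_time T (N n) i) (grid_space b (M n) k) \<in> borel_measurable P" if "k \<le> M n" "M n \<ge> 1" for i k
      using sol grid_time_nonneg[OF T] grid_space_mem_unit_interval[OF b that] by (auto simp: stationary_spde_solution_def)
    then show ?thesis unfolding W_def V_sp_def
      by (intro borel_measurable_times borel_measurable_diff borel_measurable_const borel_measurable_sum borel_measurable_power) auto
  qed
  have "weak_conv_m (\<lambda>n. distr P borel (W n)) ?L"
  proof (rule levy_continuity)
    show "real_distribution (distr P borel (W n))" for n
      using measW by (rule P.real_distribution_distr)
    show "real_distribution ?L"
      using prob_space_normal_density[OF s] by (simp add: real_distribution_def real_distribution_axioms_def)
    fix t
    have "(\<lambda>n. \<integral>\<omega>. iexp ((t * v) / sqrt (real (card (I n))) * ?Q n \<omega>) \<partial>P)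
      \<longlonglongrightarrow> of_real (exp (- (t * v)\<^sup>2))"
      by (rule gaussian_families_char_limit[OF gauss _ cardlim diag off]) (simp add: C_def grid_cov_commute)
    moreover have "\<forall>\<^sub>F n in sequentially. (\<integral>\<omega>. iexp ((t * v) / sqrt (real (card (I n))) * ?Q n \<omega>) \<partial>P)
      = char (distr P borel (W n)) t"
      using MN1
    proof eventually_elim
      case (elim n)
      have "t * W n \<omega> = (t * v) / sqrt (real (card (I n))) * ?Q n \<omega>" for \<omega>
        unfolding W_def I_def \<xi>_def using elim
        by (subst V_sp_eq_scaled_increments[OF v b(2)]) auto
      then show ?case using measW[of n] by (subst char_def, subst integral_distr) simp_all
    qed
    ultimately have "(\<lambda>n. char (distr P borel (W n)) t) \<longlonglongrightarrow> of_real (exp (- (t * v)\<^sup>2))"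
      by (rule Lim_transform_eventually)
    moreover have "char ?L t = of_real (exp (- (t * v)\<^sup>2))"
      unfolding char_centred_normal[OF s] s2 by (simp add: power_mult_distrib)
    ultimately show "(\<lambda>n. char (distr P borel (W n)) t) \<longlonglongrightarrow> char ?L t"
      by (simp only:)
  qed
  then show ?thesis by (simp only: W_def[abs_def] \<kappa>_def v_def)
qed

end
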